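(* Let $L>0$, let $a$ be a real-valued $L$-periodic integrable function with magnetic flux $$\alpha=\frac1{2\pi}\int_0^La(x)\,dx\notin\mathbb{Z},$$ and let $M,N\ge1$ be integers. Let $\bm\psi_1,\dots,\bm\psi_N\in H^1([0,L]_{\mathrm{per}};\mathbb{C}^M)$ be vector-functions, orthonormal in $L^2([0,L],\mathbb{C}^M)$, i.e. $\int_0^L\bm\psi_n(x)^T\overline{\bm\psi_m(x)}\,dx=\delta_{nm}$, and let $U(x)$ be the $M\times M$ matrix $$U(x)=\sum_{n=1}^N\bm\psi_n(x)\overline{\bm\psi_n(x)}^T.$$ Then $$\int_0^L\mathrm{Tr}[U(x)^3]\,dx\le\mathrm{K}(\alpha)\sum_{n=1}^N\int_0^L|i\bm\psi_n'(x)-a(x)\bm\psi_n(x)|^2_{\mathbb{C}^M}\,dx,$$ where $\mathrm{K}(\alpha)=\min(\mathrm{K}_1(\alpha),\mathrm{K}_2(\alpha))$.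
   Context: Vectors $\bm\psi_n(x)=(\psi_n(x,1),\dots,\psi_n(x,M))^T$ are columns, $|\cdot|_{\mathbb{C}^M}$ is the Euclidean norm on $\mathbb{C}^M$, $\mathrm{Tr}$ is the matrix trace, and $[0,L]_{\mathrm{per}}$ indicates $L$-periodic functions. The right-hand side is $+\infty$ if some $i\bm\psi_n'-a\bm\psi_n$ is not square integrable. For $\alpha\in\mathbb{R}\setminus\mathbb{Z}$, with $\alpha\,\mathrm{mod}(1)\in(0,1)$ the fractional part of $\alpha$, define $$\mathrm{K}_1(\alpha)=\mathrm{k}(\alpha)^2,\qquad \mathrm{k}(\alpha)=\begin{cases}\dfrac1{|\sin(2\pi\alpha)|},&0<\alpha\,\mathrm{mod}(1)<1/4,\\ 1,&1/4\le\alpha\,\mathrm{mod}(1)\le3/4,\\ \dfrac1{|\sin(2\pi\alpha)|},&3/4<\alpha\,\mathrm{mod}(1)<1,\end{cases}$$ $$\mathrm{K}_2(\alpha)=\frac{5}{3\sqrt3\,\pi}\left[\sup_{b\ge0}b^{5/3}\sum_{k\in\mathbb{Z}}\frac1{(|k+\alpha|^3+b)^2}\right]^2.$$ *)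

theory Defs
  imports "HOL-Analysis.Analysis"
begin

section \<open>Periodic Sobolev functions\<close>

text \<open>
  Elements of the function spaces are represented by \<open>L\<close>-periodic Lebesgue measurable functions
  on the line; functions that agree almost everywhere are not identified.
\<close>

definition L2_per :: "real \<Rightarrow> (real \<Rightarrow> 'b :: euclidean_space) set" where
  "L2_per L = {f. periodic_fun_simple f L \<and>
                  set_borel_measurable lebesgue {0..L} f \<and>
                  set_integrable lebesgue {0..L} (\<lambda>x. (norm (f x))\<^sup>2)}"

definition smooth_per :: "real \<Rightarrow> (real \<Rightarrow> real) set" where
  "smooth_per L = {\<phi>. periodic_fun_simple \<phi> L \<and>
                      (\<forall>k. (deriv ^^ k) \<phi> differentiable_on UNIV)}"

definition is_weak_deriv ::
  "real \<Rightarrow> (real \<Rightarrow> 'b :: euclidean_space) \<Rightarrow> (real \<Rightarrow> 'b) \<Rightarrow> bool" where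
  "is_weak_deriv L f g \<longleftrightarrow>
     (\<forall>\<phi>\<in>smooth_per L.
        (LINT x:{0..L}|lebesgue. deriv \<phi> x *\<^sub>R f x) = - (LINT x:{0..L}|lebesgue. \<phi> x *\<^sub>R g x))"

definition H1_per :: "real \<Rightarrow> (real \<Rightarrow> 'b :: euclidean_space) set" where
  "H1_per L = {f \<in> L2_per L. \<exists>g\<in>L2_per L. is_weak_deriv L f g}"

text \<open>
  The weak derivative is unique up to null sets, so an arbitrary representative is chosen.
\<close>

definition weak_deriv :: "real \<Rightarrow> (real \<Rightarrow> 'b :: euclidean_space) \<Rightarrow> real \<Rightarrow> 'b" where
  "weak_deriv L f = (SOME g. g \<in> L2_per L \<and> is_weak_deriv L f g)"

definition orthonormal_L2 :: "real \<Rightarrow> nat \<Rightarrow> (nat \<Rightarrow> real \<Rightarrow> complex ^ 'm) \<Rightarrow> bool" where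
  "orthonormal_L2 L N \<psi> \<longleftrightarrow>
     (\<forall>n\<in>{1..N}. \<forall>m\<in>{1..N}.
        (LINT x:{0..L}|lebesgue. (\<Sum>j\<in>UNIV. \<psi> n x $ j * cnj (\<psi> m x $ j)))
          = (if n = m then 1 else 0))"


section \<open>Magnetic flux and the matrix density\<close>

definition magnetic_flux :: "real \<Rightarrow> (real \<Rightarrow> real) \<Rightarrow> real" where
  "magnetic_flux L a = 1 / (2 * pi) * (LINT x:{0..L}|lebesgue. a x)"

definition density_matrix ::
  "nat \<Rightarrow> (nat \<Rightarrow> real \<Rightarrow> complex ^ 'm) \<Rightarrow> real \<Rightarrow> complex ^ 'm ^ 'm" where
  "density_matrix N \<psi> x = (\<Sum>n=1..N. \<chi> i j. \<psi> n x $ i * cnj (\<psi> n x $ j))"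

text \<open>
  The trace of the cube is a nonnegative real, so that nothing is lost when it is passed to a
  nonnegative integral as \<open>ennreal (Re \<dots>)\<close>.
\<close>

lemma trace_density_cube:
  fixes \<psi> :: "nat \<Rightarrow> real \<Rightarrow> complex ^ 'm" and N :: nat and x :: real
  defines "U \<equiv> density_matrix N \<psi> x"
  shows "trace (U ** U ** U) =
           of_real (\<Sum>n=1..N. (norm (U *v \<psi> n x))\<^sup>2)"
proof -
  have herm: "cnj (U $ i $ j) = U $ j $ i" for i j
    by (simp add: U_def density_matrix_def mult.commute)
  have norm_eq: "complex_of_real ((norm v)\<^sup>2) = (\<Sum>i\<in>UNIV. v $ i * cnj (v $ i))"
    for v :: "complex ^ 'm"
    by (simp add: norm_vec_def L2_set_def sum_nonneg complex_norm_square del: of_real_power)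
  have U: "U $ j $ k = (\<Sum>n=1..N. \<psi> n x $ j * cnj (\<psi> n x $ k))" for j k
    by (simp add: U_def density_matrix_def)
  have "trace (U ** U ** U) = (\<Sum>i\<in>UNIV. \<Sum>k\<in>UNIV. \<Sum>j\<in>UNIV. U $ i $ j * U $ j $ k * U $ k $ i)"
    by (simp add: trace_def matrix_matrix_mult_def sum_distrib_right)
  also have "\<dots> = (\<Sum>i\<in>UNIV. \<Sum>k\<in>UNIV. \<Sum>j\<in>UNIV. \<Sum>n=1..N.
      U $ i $ j * \<psi> n x $ j * cnj (U $ i $ k * \<psi> n x $ k))"
    by (subst U[of _ k for k]) (simp add: herm sum_distrib_left sum_distrib_right mult_ac)
  also have "\<dots> = (\<Sum>n=1..N. \<Sum>i\<in>UNIV. \<Sum>k\<in>UNIV. \<Sum>j\<in>UNIV.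
      U $ i $ j * \<psi> n x $ j * cnj (U $ i $ k * \<psi> n x $ k))"
    by (simp only: sum.swap[of _ "{1..N}"])
  also have "\<dots> = (\<Sum>n=1..N. \<Sum>i\<in>UNIV. (U *v \<psi> n x) $ i * cnj ((U *v \<psi> n x) $ i))"
    by (simp only: matrix_vector_mult_def vec_lambda_beta cnj_sum sum_distrib_left sum_distrib_right)
  finally show ?thesis
    by (simp only: of_real_sum norm_eq)
qed


section \<open>The constants\<close>

definition k_const :: "real \<Rightarrow> real" where
  "k_const \<alpha> =
     (if 0 < frac \<alpha> \<and> frac \<alpha> < 1 / 4 then 1 / \<bar>sin (2 * pi * \<alpha>)\<bar>
      else if 1 / 4 \<le> frac \<alpha> \<and> frac \<alpha> \<le> 3 / 4 then 1
      else 1 / \<bar>sin (2 * pi * \<alpha>)\<bar>)"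

definition K1 :: "real \<Rightarrow> real" where
  "K1 \<alpha> = (k_const \<alpha>)\<^sup>2"

definition K2 :: "real \<Rightarrow> real" where
  "K2 \<alpha> = 5 / (3 * sqrt 3 * pi) *
     (SUP b\<in>{0..}. b powr (5 / 3) * (\<Sum>\<^sub>\<infinity>k::int. 1 / (\<bar>of_int k + \<alpha>\<bar> ^ 3 + b)\<^sup>2))\<^sup>2"

definition K_const :: "real \<Rightarrow> real" where
  "K_const \<alpha> = min (K1 \<alpha>) (K2 \<alpha>)"

end

theory Submission
  imports Defs "HOL-Real_Asymp.Real_Asymp"
begin

text \<open>
  Let \<open>A\<close> be the primitive of \<open>a\<close> that vanishes at \<open>0\<close>. The gauge transformation
  \<open>v\<^sub>n = exp (\<i> A) \<psi>\<^sub>n\<close> changes neither the density matrix nor orthonormality, and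
  \<open>\<bar>v\<^sub>n'\<bar> = \<bar>\<i> \<psi>\<^sub>n' - a \<psi>\<^sub>n\<bar>\<close>. The magnetic field survives only in the boundary condition
  \<open>v\<^sub>n(L) = exp (2 \<pi> \<i> \<alpha>) v\<^sub>n(0)\<close>. So it is enough to bound the integral of \<open>Tr U\<^sup>3\<close> by
  \<open>K\<close> times the sum of the \<open>\<integral> \<bar>v\<^sub>n'\<bar>\<^sup>2\<close>, for orthonormal quasi-periodic absolutely
  continuous \<open>v\<^sub>n\<close>, once with each of the two constants. Both proofs work at a fixed point \<open>x\<close>
  in an orthonormal basis of eigenvectors \<open>e\<close> of \<open>U(x)\<close>, with eigenvalues \<open>\<lambda>\<close>
  (\<open>density_eigenbasis\<close>), and add up an inequality for \<open>\<lambda>\<^sup>3\<close> over the basis.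

  For the first constant (\<open>integral_cube_le_K1\<close>), a quasi-periodic function \<open>u\<close> satisfies
  \<open>2 b \<bar>u(x)\<bar>\<^sup>2 \<le> k (\<integral> \<bar>u'\<bar>\<^sup>2 + b\<^sup>2 \<integral> \<bar>u\<bar>\<^sup>2)\<close> for all \<open>b > 0\<close>; the sharp
  constant for given \<open>b\<close> comes from the Green function (\<open>pointwise_energy_bound\<close>), and
  \<open>k\<close> is a bound for it over all \<open>b\<close> (\<open>k_const_bound\<close>). Apply this to the linear
  combination \<open>u\<close> of the \<open>v\<^sub>n\<close> whose value at \<open>x\<close> is \<open>U(x) e = \<lambda> e\<close> and whose
  squared norm is \<open>\<lambda>\<close>. With \<open>b = \<lambda> / k\<close> the result is \<open>\<lambda>\<^sup>3 \<le> k\<^sup>2 \<integral> \<bar>u'\<bar>\<^sup>2\<close>.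
  The sum over \<open>e\<close> of the right-hand sides is a quadratic expression in the \<open>v\<^sub>n(x)\<close>, which
  orthonormality reduces to the kinetic energy after integration in \<open>x\<close>.

  For the second constant (\<open>integral_cube_le_K2\<close>), put \<open>f\<^sub>k(t) = p\<^sup>3 / (p\<^sup>3 + t\<^sup>3)\<close> with
  \<open>p = \<bar>k + \<alpha>\<bar>\<close>, and let \<open>v\<^sub>n\<^sup>t\<close> have the Fourier coefficients of \<open>v\<^sub>n\<close>
  multiplied by \<open>f\<^sub>k(t)\<close>. By the Bessel inequality for the orthonormal family \<open>v\<^sub>n\<close>, the components of
  the remainders \<open>v\<^sub>n - v\<^sub>n\<^sup>t\<close> along \<open>e\<close> contribute at most
  \<open>\<Sum>\<^sub>k (1 - f\<^sub>k(t))\<^sup>2 / L \<le> S t / L\<close>, where \<open>S\<close> is the supremum in the definition of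
  the constant. Hence \<open>\<surd>\<lambda> \<le> \<surd>y(t) + \<surd>(S t / L)\<close>, where \<open>y(t)\<close> is the density of the
  \<open>v\<^sub>n\<^sup>t\<close> along \<open>e\<close> (\<open>sqrt_layer_bound\<close>). Integration against \<open>2 t dt\<close> produces
  \<open>\<lambda>\<^sup>3\<close> on the left (\<open>cube_le_layer_integral\<close>) and, because
  \<open>\<integral> 2 t f\<^sub>k(t)\<^sup>2 dt\<close> is a multiple of \<open>p\<^sup>2\<close>, the kinetic energy on the right. This is
  done for finite Fourier sums, where every interchange is one of finite sums; the limit is taken with
  the Fatou lemma.

  That limit, and the fact that functions with a weak derivative are absolutely continuous up to null
  sets, rest on the convergence of the Fourier series at every point (\<open>fourier_pointwise\<close>).
  That convergence is deduced from the value of the sum of the reciprocal squares.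
\<close>

section \<open>Eigenbases of self-adjoint maps and the trace of the cube\<close>

text \<open>
  Induction on the dimension of an invariant subspace: a maximiser \<open>e\<close> of the quadratic form on its
  unit sphere is an eigenvector, and the orthogonal complement of \<open>e\<close> is again invariant.
\<close>

lemma self_adjoint_eigenbasis_on:
  fixes f :: "'a::euclidean_space \<Rightarrow> 'a"
  assumes "linear f" and adj: "\<And>x y. f x \<bullet> y = x \<bullet> f y"
  shows "subspace V \<Longrightarrow> f ` V \<subseteq> V \<Longrightarrow>
    \<exists>B. pairwise orthogonal B \<and> (\<forall>b\<in>B. norm b = 1) \<and> span B = V \<and> (\<forall>b\<in>B. \<exists>c. f b = c *\<^sub>R b)"
proof (induction "dim V" arbitrary: V rule: less_induct)
  case less
  interpret linear f by fact
  show ?case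
  proof (cases "V = {0}")
    case True
    show ?thesis by (rule exI[of _ "{}"]) (auto simp: True)
  next
    case False
    define K where "K = V \<inter> sphere 0 1"
    have "compact K"
      unfolding K_def by (simp add: closed_Int_compact closed_subspace less.prems)
    moreover obtain v where v: "v \<in> V" "v \<noteq> 0"
      using False subspace_0[OF less.prems(1)] by auto
    then have "v /\<^sub>R norm v \<in> K"
      by (simp add: K_def subspace_scale less.prems)
    then have "K \<noteq> {}" by auto
    moreover have "continuous_on K (\<lambda>x. x \<bullet> f x)"
      by (intro continuous_on_inner continuous_on_id linear_continuous_on
          linear_conv_bounded_linear[THEN iffD1] assms(1))
    ultimately obtain e where e: "e \<in> K" and max: "\<And>y. y \<in> K \<Longrightarrow> y \<bullet> f y \<le> e \<bullet> f e"
      using continuous_attains_sup[of K "\<lambda>x. x \<bullet> f x"] by blast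
    have eV: "e \<in> V" and e1: "norm e = 1" and ee: "e \<bullet> e = 1"
      using e by (auto simp: K_def norm_eq_1)
    define c where "c = e \<bullet> f e"
    have quot: "x \<bullet> f x \<le> c * (x \<bullet> x)" if "x \<in> V" for x
    proof (cases "x = 0")
      case False
      have "x /\<^sub>R norm x \<in> K"
        using that False by (simp add: K_def subspace_scale less.prems)
      from max[OF this] False show ?thesis
        by (simp add: c_def scale power2_norm_eq_inner[symmetric] field_simps power2_eq_square)
    qed (simp add: zero)
    define w where "w = f e - c *\<^sub>R e"
    have wV: "w \<in> V"
      unfolding w_def using less.prems eV by (blast intro: subspace_diff subspace_scale)
    define m where "m = c * (w \<bullet> w) - w \<bullet> f w"
    \<comment> \<open>The quotient at \<open>e + t w\<close> cannot exceed its maximum, for small \<open>t\<close> of either sign.\<close>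
    have small: "2 * t * (w \<bullet> w) \<le> t\<^sup>2 * m" for t
    proof -
      have "e + t *\<^sub>R w \<in> V"
        using less.prems eV wV by (blast intro: subspace_add subspace_scale)
      from quot[OF this] have
        "c + 2 * t * (w \<bullet> f e) + t\<^sup>2 * (w \<bullet> f w) \<le> c * (1 + 2 * t * (w \<bullet> e) + t\<^sup>2 * (w \<bullet> w))"
        using adj[of e w]
        by (simp add: add scale inner_add_left inner_add_right c_def[symmetric] ee inner_commute
            power2_eq_square algebra_simps)
      moreover have "w \<bullet> f e = w \<bullet> w + c * (w \<bullet> e)"
        by (simp add: w_def inner_diff_right)
      ultimately show ?thesis
        by (simp add: m_def algebra_simps)
    qed
    have "w = 0"
    proof (rule ccontr)
      assume "w \<noteq> 0"
      then have p: "w \<bullet> w > 0" by simp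
      define t where "t = (w \<bullet> w) / (\<bar>m\<bar> + 1)"
      have "t > 0" using p by (simp add: t_def)
      have "2 * t * (w \<bullet> w) \<le> t * (t * m)"
        using small[of t] by (simp add: power2_eq_square mult.assoc)
      then have "2 * (w \<bullet> w) \<le> t * m" using \<open>t > 0\<close> by simp
      also have "t * m \<le> t * (\<bar>m\<bar> + 1)"
        using \<open>t > 0\<close> by (intro mult_left_mono) auto
      also have "\<dots> = w \<bullet> w"
        unfolding t_def by (simp add: add_nonneg_eq_0_iff)
      finally show False using p by simp
    qed
    then have fe: "f e = c *\<^sub>R e" by (simp add: w_def)
    define W where "W = {x \<in> V. e \<bullet> x = 0}"
    have W: "subspace W"
      unfolding W_def using less.prems(1)
      by (auto simp: subspace_def inner_add_right)
    have fW: "f ` W \<subseteq> W"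
      using less.prems(2) by (auto simp: W_def adj[symmetric] fe)
    have "e \<notin> W" "W \<subseteq> V" using ee by (auto simp: W_def)
    then have "W \<subset> V" using eV by blast
    then have "dim W < dim V"
      by (metis W dim_psubset less.prems(1) span_eq_iff)
    from less.hyps[OF this W fW] obtain B where B: "pairwise orthogonal B"
      "\<forall>b\<in>B. norm b = 1" "span B = W" "\<forall>b\<in>B. \<exists>c. f b = c *\<^sub>R b" by blast
    have BW: "B \<subseteq> W" using B(3) span_superset by blast
    show ?thesis
    proof (intro exI[of _ "insert e B"] conjI ballI)
      show "pairwise orthogonal (insert e B)"
        using B(1) BW by (auto simp: pairwise_insert orthogonal_def W_def inner_commute)
      show "span (insert e B) = V"
      proof
        show "span (insert e B) \<subseteq> V"
          using BW eV by (intro span_minimal less.prems) (auto simp: W_def)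
        show "V \<subseteq> span (insert e B)"
        proof
          fix x assume "x \<in> V"
          then have "x - (e \<bullet> x) *\<^sub>R e \<in> W"
            using less.prems(1) eV
            by (auto simp: W_def inner_diff_right ee intro: subspace_diff subspace_scale)
          then show "x \<in> span (insert e B)"
            unfolding span_insert B(3) by auto
        qed
      qed
    qed (use B e1 fe in auto)
  qed
qed

lemma self_adjoint_eigenbasis:
  fixes f :: "'a::euclidean_space \<Rightarrow> 'a"
  assumes "linear f" and "\<And>x y. f x \<bullet> y = x \<bullet> f y"
  obtains B where "finite B" "pairwise orthogonal B" "\<And>b. b \<in> B \<Longrightarrow> norm b = 1" "span B = UNIV"
    "\<And>b. b \<in> B \<Longrightarrow> \<exists>c. f b = c *\<^sub>R b"
proof -
  obtain B where B: "pairwise orthogonal B" "\<forall>b\<in>B. norm b = 1" "span B = UNIV"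
      "\<forall>b\<in>B. \<exists>c. f b = c *\<^sub>R b"
    using self_adjoint_eigenbasis_on[OF assms subspace_UNIV] by blast
  moreover have "0 \<notin> B" using B(2) by force
  then have "finite B"
    using B(1) by (metis pairwise_orthogonal_independent independent_imp_finite)
  ultimately show ?thesis using that by blast
qed

abbreviation (input) trace_cube :: "nat \<Rightarrow> (nat \<Rightarrow> real \<Rightarrow> complex ^ 'm) \<Rightarrow> real \<Rightarrow> real" where
  "trace_cube N \<psi> x \<equiv>
     Re (trace (density_matrix N \<psi> x ** density_matrix N \<psi> x ** density_matrix N \<psi> x))"

text \<open>
  The Hermitian inner product, linear in the first argument. Its real part is the inner product of
  \<open>complex ^ 'm\<close> as a real Euclidean space.
\<close>

definition herm :: "complex ^ 'm \<Rightarrow> complex ^ 'm \<Rightarrow> complex" where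
  "herm x y = (\<Sum>i\<in>UNIV. x $ i * cnj (y $ i))"

lemma Re_herm: "Re (herm x y) = x \<bullet> y"
  by (simp add: herm_def inner_vec_def inner_complex_def)

lemma Im_herm: "Im (herm x y) = (- \<i> *s x) \<bullet> y"
  by (simp add: herm_def inner_vec_def inner_complex_def)

lemma herm_simps:
  "herm (x + x') y = herm x y + herm x' y" "herm y (x + x') = herm y x + herm y x'"
  "herm (c *s x) y = c * herm x y" "herm x (c *s y) = cnj c * herm x y"
  "herm (r *\<^sub>R x) y = r * herm x y" "herm x (r *\<^sub>R y) = r * herm x y"
  by (auto simp: herm_def distrib_left distrib_right sum.distrib sum_distrib_left mult_ac
      scaleR_conv_of_real[where 'a=complex] intro!: sum.cong)

lemma herm_sum_left: "herm (\<Sum>n\<in>A. x n) y = (\<Sum>n\<in>A. herm (x n) y)"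
  unfolding herm_def by (simp add: sum_distrib_right sum.swap[of _ UNIV])

lemma cnj_herm: "cnj (herm x y) = herm y x"
  by (simp add: herm_def mult.commute)

lemma herm_self: "herm x x = of_real ((norm x)\<^sup>2)"
  by (simp add: complex_eq_iff Re_herm Im_herm power2_norm_eq_inner)
     (simp add: inner_vec_def inner_complex_def)

lemma parseval_real:
  fixes B :: "'a::euclidean_space set"
  assumes "finite B" "pairwise orthogonal B" "\<And>b. b \<in> B \<Longrightarrow> norm b = 1" "span B = UNIV"
  shows "(\<Sum>e\<in>B. (x \<bullet> e) * (y \<bullet> e)) = x \<bullet> y"
proof -
  have "(\<Sum>e\<in>B. (x \<bullet> e) *\<^sub>R e) = x"
    using assms by (intro orthonormal_basis_expand) auto
  then have "x \<bullet> y = (\<Sum>e\<in>B. (x \<bullet> e) *\<^sub>R e) \<bullet> y" by simp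
  also have "\<dots> = (\<Sum>e\<in>B. (x \<bullet> e) * (y \<bullet> e))"
    unfolding inner_sum_left by (simp add: inner_commute)
  finally show ?thesis by simp
qed

text \<open>
  The factor \<open>2\<close> appears because \<open>B\<close> is an orthonormal basis over the reals, so that it has twice as many
  elements as a complex one. Real bases make the real spectral theorem applicable to Hermitian matrices.
\<close>

lemma parseval_herm:
  fixes B :: "(complex ^ 'm) set"
  assumes "finite B" "pairwise orthogonal B" "\<And>b. b \<in> B \<Longrightarrow> norm b = 1" "span B = UNIV"
  shows "(\<Sum>e\<in>B. herm x e * cnj (herm y e)) = 2 * herm x y"
proof -
  note P = parseval_real[OF assms]
  have "(\<i> *s x) \<bullet> (\<i> *s y) = x \<bullet> y" "(\<i> *s x) \<bullet> y + x \<bullet> (\<i> *s y) = 0"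
    by (simp_all add: inner_vec_def inner_complex_def add.commute sum.distrib[symmetric])
  then show ?thesis
    by (simp add: complex_eq_iff sum.distrib sum_subtractf Re_herm Im_herm P sum_negf)
qed

lemma density_matrix_mult:
  "density_matrix N \<psi> x *v y = (\<Sum>n=1..N. herm y (\<psi> n x) *s \<psi> n x)"
proof (rule vec_eq_iff[THEN iffD2], rule allI)
  fix i
  have "(density_matrix N \<psi> x *v y) $ i = (\<Sum>j\<in>UNIV. \<Sum>n=1..N. \<psi> n x $ i * cnj (\<psi> n x $ j) * y $ j)"
    by (simp add: density_matrix_def matrix_vector_mult_def sum_distrib_right)
  also have "\<dots> = (\<Sum>n=1..N. herm y (\<psi> n x) * \<psi> n x $ i)"
    by (subst sum.swap) (simp add: herm_def sum_distrib_right sum_distrib_left mult_ac)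
  finally show "(density_matrix N \<psi> x *v y) $ i = (\<Sum>n=1..N. herm y (\<psi> n x) *s \<psi> n x) $ i"
    by simp
qed

text \<open>
  All that is needed about the density matrix at a point. Halving the sum over the basis compensates for
  \<open>B\<close> being orthonormal over the reals.
\<close>

lemma density_eigenbasis:
  fixes \<psi> :: "nat \<Rightarrow> real \<Rightarrow> complex ^ 'm" and x :: real
  obtains B :: "(complex ^ 'm) set" and lam where "finite B" "\<And>e. e \<in> B \<Longrightarrow> norm e = 1"
    "\<And>y z. (\<Sum>e\<in>B. herm y e * cnj (herm z e)) = 2 * herm y z"
    "\<And>e. e \<in> B \<Longrightarrow> lam e = (\<Sum>n=1..N. (cmod (herm (\<psi> n x) e))\<^sup>2)"
    "\<And>e. e \<in> B \<Longrightarrow> (\<Sum>n=1..N. herm e (\<psi> n x) *s \<psi> n x) = lam e *\<^sub>R e"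
    "trace_cube N \<psi> x
       = (\<Sum>e\<in>B. lam e ^ 3) / 2"
proof -
  define f where "f = (\<lambda>y. density_matrix N \<psi> x *v y)"
  have f: "f y = (\<Sum>n=1..N. herm y (\<psi> n x) *s \<psi> n x)" for y
    by (simp add: f_def density_matrix_mult)
  have herm: "herm (f y) z = herm y (f z)" for y z
  proof -
    have "herm (f y) z = (\<Sum>n=1..N. herm y (\<psi> n x) * herm (\<psi> n x) z)"
      by (simp add: f herm_sum_left herm_simps)
    moreover have "cnj (herm (f z) y) = (\<Sum>n=1..N. cnj (herm z (\<psi> n x)) * cnj (herm (\<psi> n x) y))"
      by (simp add: f herm_sum_left herm_simps)
    ultimately show ?thesis by (simp add: cnj_herm mult.commute)
  qed
  have lin: "linear f"
    by (rule linearI)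
       (simp_all add: f herm_simps sum.distrib vec_eq_iff distrib_right scaleR_sum_right
         scaleR_conv_of_real[where 'a=complex] sum_distrib_left mult.assoc)
  have adj: "f y \<bullet> z = y \<bullet> f z" for y z
    using herm[of y z] by (metis Re_herm)
  obtain B where B: "finite B" "pairwise orthogonal B" "\<And>b. b \<in> B \<Longrightarrow> norm b = 1" "span B = UNIV"
    and eig: "\<And>b. b \<in> B \<Longrightarrow> \<exists>c. f b = c *\<^sub>R b"
    using self_adjoint_eigenbasis[OF lin adj] by blast
  define lam where "lam e = (\<Sum>n=1..N. (cmod (herm (\<psi> n x) e))\<^sup>2)" for e
  have hfe: "herm (f e) e = of_real (lam e)" for e
  proof -
    have "herm (f e) e = (\<Sum>n=1..N. herm (\<psi> n x) e * cnj (herm (\<psi> n x) e))"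
      by (simp add: f herm_sum_left herm_simps cnj_herm mult.commute)
    also have "\<dots> = of_real (lam e)"
      by (simp add: lam_def complex_norm_square del: of_real_power)
    finally show ?thesis .
  qed
  have fe: "f e = lam e *\<^sub>R e" if "e \<in> B" for e
  proof -
    from eig[OF that] obtain c where c: "f e = c *\<^sub>R e" by blast
    then have "c = lam e"
      using hfe[of e] B(3)[OF that] by (simp add: herm_simps herm_self)
    then show ?thesis using c by simp
  qed
  have pars: "(\<Sum>e\<in>B. herm y e * cnj (herm z e)) = 2 * herm y z" for y z
    using parseval_herm[OF B] .
  have nrm: "(norm y)\<^sup>2 = (\<Sum>e\<in>B. (cmod (herm y e))\<^sup>2) / 2" for y
  proof -
    have "complex_of_real (2 * (norm y)\<^sup>2) = of_real (\<Sum>e\<in>B. (cmod (herm y e))\<^sup>2)"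
      using pars[of y y] by (simp add: herm_self complex_norm_square del: of_real_power)
    then show ?thesis unfolding of_real_eq_iff by simp
  qed
  have "trace_cube N \<psi> x
      = (\<Sum>n=1..N. (norm (f (\<psi> n x)))\<^sup>2)"
    unfolding trace_density_cube f_def by simp
  also have "\<dots> = (\<Sum>n=1..N. (\<Sum>e\<in>B. (lam e)\<^sup>2 * (cmod (herm (\<psi> n x) e))\<^sup>2) / 2)"
  proof (intro sum.cong refl)
    fix n
    have "(cmod (herm (f (\<psi> n x)) e))\<^sup>2 = (lam e)\<^sup>2 * (cmod (herm (\<psi> n x) e))\<^sup>2" if "e \<in> B" for e
      by (simp add: herm fe[OF that] herm_simps norm_mult power_mult_distrib)
    then show "(norm (f (\<psi> n x)))\<^sup>2 = (\<Sum>e\<in>B. (lam e)\<^sup>2 * (cmod (herm (\<psi> n x) e))\<^sup>2) / 2"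
      by (simp add: nrm)
  qed
  also have "\<dots> = (\<Sum>e\<in>B. \<Sum>n=1..N. (lam e)\<^sup>2 * (cmod (herm (\<psi> n x) e))\<^sup>2) / 2"
    by (simp add: sum_divide_distrib[symmetric] sum.swap[of _ B])
  also have "\<dots> = (\<Sum>e\<in>B. lam e ^ 3) / 2"
    by (simp only: sum_distrib_left[symmetric] lam_def[symmetric])
       (simp add: power3_eq_cube power2_eq_square)
  finally show ?thesis
    using that[of B lam] B pars fe by (simp add: lam_def f)
qed


section \<open>Absolutely continuous functions\<close>

text \<open>
  Absolute continuity on \<open>[s, t]\<close>, in integrated form so that \<open>f'\<close> matters only up to null
  sets.
\<close>

definition primitive_on :: "real \<Rightarrow> real \<Rightarrow> (real \<Rightarrow> complex) \<Rightarrow> (real \<Rightarrow> complex) \<Rightarrow> bool" where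
  "primitive_on s t f f' \<longleftrightarrow> s \<le> t \<and> f' absolutely_integrable_on {s..t} \<and>
     (\<forall>x\<in>{s..t}. (f' has_integral (f x - f s)) {s..x})"

lemma primitive_on_le: "primitive_on s t f f' \<Longrightarrow> s \<le> t"
  and primitive_on_absolutely_integrable: "primitive_on s t f f' \<Longrightarrow> f' absolutely_integrable_on {s..t}"
  and primitive_on_has_integral: "primitive_on s t f f' \<Longrightarrow> s \<le> x \<Longrightarrow> x \<le> t \<Longrightarrow>
    (f' has_integral (f x - f s)) {s..x}"
  unfolding primitive_on_def by (blast, blast, metis atLeastAtMost_iff)

lemma primitive_onD:
  assumes "primitive_on s t f f'" "s \<le> x" "x \<le> y" "y \<le> t"
  shows "f' absolutely_integrable_on {x..y}" "f' integrable_on {x..y}"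
    "(\<lambda>x. norm (f' x)) integrable_on {x..y}" "f y - f x = integral {x..y} f'"
proof -
  have a: "f' absolutely_integrable_on {x'..y'}" if "s \<le> x'" "y' \<le> t" for x' y'
    by (rule absolutely_integrable_on_subinterval[OF primitive_on_absolutely_integrable[OF assms(1)]])
       (use that in simp)
  show "f' absolutely_integrable_on {x..y}" using assms by (intro a)
  then show i: "f' integrable_on {x..y}" and "(\<lambda>x. norm (f' x)) integrable_on {x..y}"
    by (simp_all add: absolutely_integrable_on_def)
  have "f' integrable_on {s..y}"
    using a[of s y] assms(4) by (simp add: absolutely_integrable_on_def)
  with assms(2,3) have "integral {s..x} f' + integral {x..y} f' = integral {s..y} f'"
    by (rule Henstock_Kurzweil_Integration.integral_combine)
  moreover have "integral {s..x} f' = f x - f s" "integral {s..y} f' = f y - f s"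
    using assms by (simp_all add: primitive_on_has_integral integral_unique)
  ultimately show "f y - f x = integral {x..y} f'" by (simp add: algebra_simps)
qed

lemma primitive_on_total:
  assumes "primitive_on s t f f'"
  shows "f t - f s = integral {s..t} f'" "f' absolutely_integrable_on {s..t}" "f' integrable_on {s..t}"
  by (rule primitive_onD[OF assms order_refl primitive_on_le[OF assms] order_refl])+

lemma primitive_on_subinterval:
  assumes "primitive_on s t f f'" "s \<le> x" "x \<le> y" "y \<le> t"
  shows "primitive_on x y f f'"
  unfolding primitive_on_def
proof (intro conjI ballI)
  fix z assume "z \<in> {x..y}"
  then show "(f' has_integral (f z - f x)) {x..z}"
    using primitive_onD(2,4)[OF assms(1), of x z] assms by (simp add: integrable_integral)
qed (use assms primitive_onD[OF assms] in simp_all)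

lemma primitive_on_continuous:
  assumes "primitive_on s t f f'"
  shows "continuous_on {s..t} f"
proof -
  have "continuous_on {s..t} (\<lambda>x. f s + integral {s..x} f')"
    using primitive_on_total[OF assms]
    by (intro continuous_intros indefinite_integral_continuous_1)
  moreover have "f s + integral {s..x} f' = f x" if "x \<in> {s..t}" for x
    using primitive_onD(4)[OF assms, of s x] that by (simp add: algebra_simps)
  ultimately show ?thesis
    by (rule continuous_on_eq)
qed

lemma absolutely_integrable_continuous_mult:
  fixes f g :: "real \<Rightarrow> complex"
  assumes "continuous_on {s..t} f" "g absolutely_integrable_on {s..t}"
  shows "(\<lambda>x. f x * g x) absolutely_integrable_on {s..t}"
proof (rule absolutely_integrable_bounded_measurable_product[where h = "(*)", OF _ _ _ _ assms(2)])
  show "bilinear ((*) :: complex \<Rightarrow> complex \<Rightarrow> complex)"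
    by (rule bilinear_times)
  show "f \<in> borel_measurable (lebesgue_on {s..t})"
    using assms(1) by (rule continuous_imp_measurable_on_sets_lebesgue) simp
  show "bounded (f ` {s..t})"
    by (intro compact_imp_bounded compact_continuous_image assms) simp
qed simp

lemma primitive_on_C1:
  assumes "s \<le> t" "\<And>x. (f has_vector_derivative f' x) (at x)" "continuous_on {s..t} f'"
  shows "primitive_on s t f f'"
  unfolding primitive_on_def
proof (intro conjI ballI)
  show "f' absolutely_integrable_on {s..t}"
    using absolutely_integrable_continuous_real assms(3) by blast
  fix x assume "x \<in> {s..t}"
  then show "(f' has_integral (f x - f s)) {s..x}"
    by (intro fundamental_theorem_of_calculus) (auto intro: has_vector_derivative_at_within assms(2))
qed fact

lemma primitive_on_const: "s \<le> t \<Longrightarrow> primitive_on s t (\<lambda>_. c) (\<lambda>_. 0)"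
  by (rule primitive_on_C1) auto

lemma primitive_on_indefinite_integral:
  assumes "s \<le> t" "f' absolutely_integrable_on {s..t}"
  shows "primitive_on s t (\<lambda>x. integral {s..x} f') f'"
  unfolding primitive_on_def
proof (intro conjI ballI assms)
  fix x assume "x \<in> {s..t}"
  then have "f' absolutely_integrable_on {s..x}"
    by (intro absolutely_integrable_on_subinterval[OF assms(2)]) auto
  then show "(f' has_integral (integral {s..x} f' - integral {s..s} f')) {s..x}"
    by (simp add: absolutely_integrable_on_def integrable_integral)
qed

lemma primitive_on_cong:
  assumes "primitive_on s t f f'" "\<And>x. x \<in> {s..t} \<Longrightarrow> f x = g x"
    "\<And>x. x \<in> {s..t} \<Longrightarrow> f' x = g' x"
  shows "primitive_on s t g g'"
  unfolding primitive_on_def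
proof (intro conjI ballI)
  show st: "s \<le> t" using assms by (simp add: primitive_on_def)
  have "set_integrable lebesgue {s..t} f' = set_integrable lebesgue {s..t} g'"
    using assms(3) by (intro set_integrable_cong) auto
  then show "g' absolutely_integrable_on {s..t}"
    using primitive_on_total[OF assms(1)] by blast
  fix x assume x: "x \<in> {s..t}"
  then have "(f' has_integral (f x - f s)) {s..x}"
    using assms(1) by (simp add: primitive_on_has_integral)
  moreover have "f x - f s = g x - g s"
    using x st assms(2) by simp
  ultimately show "(g' has_integral (g x - g s)) {s..x}"
    using x assms(3) has_integral_cong[of "{s..x}" f' g'] by auto
qed

lemma primitive_on_add:
  assumes "primitive_on s t f f'" "primitive_on s t g g'"
  shows "primitive_on s t (\<lambda>x. f x + g x) (\<lambda>x. f' x + g' x)"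
  using assms unfolding primitive_on_def
  by (auto simp: add_diff_add intro!: has_integral_add set_integral_add)

lemma primitive_on_cmult:
  assumes "primitive_on s t f f'"
  shows "primitive_on s t (\<lambda>x. c * f x) (\<lambda>x. c * f' x)"
  using assms unfolding primitive_on_def
  by (auto simp: right_diff_distrib[symmetric] intro!: has_integral_mult_right)

lemma primitive_on_sum:
  assumes "s \<le> t" "\<And>i. i \<in> I \<Longrightarrow> primitive_on s t (f i) (f' i)"
  shows "primitive_on s t (\<lambda>x. \<Sum>i\<in>I. f i x) (\<lambda>x. \<Sum>i\<in>I. f' i x)"
  using assms(2)
proof (induction I rule: infinite_finite_induct)
  case (insert i I)
  then show ?case using primitive_on_add[of s t "f i" "f' i"] by simp
qed (use primitive_on_const[OF assms(1), of 0] in auto)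

text \<open>
  The chain rule. On a short interval \<open>[a, b]\<close> the increment of \<open>F \<circ> f\<close> and the integral of
  \<open>(F' \<circ> f) f'\<close> both differ from \<open>F' (f a) (f b - f a)\<close> by a small multiple of
  \<open>\<integral> \<bar>f'\<bar>\<close>. This error estimate is additive in the interval, so it holds on long intervals
  too, and the multiple is arbitrarily small.
\<close>

lemma primitive_on_entire:
  assumes prim: "primitive_on s t f f'"
    and F: "\<And>z. (F has_field_derivative F' z) (at z)" and F': "continuous_on UNIV F'"
  shows "primitive_on s t (\<lambda>x. F (f x)) (\<lambda>x. F' (f x) * f' x)"
proof -
  have st: "s \<le> t" using prim by (rule primitive_on_le)
  have cf: "continuous_on {s..t} f" by (rule primitive_on_continuous[OF prim])
  have cF'f: "continuous_on {s..t} (\<lambda>x. F' (f x))"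
    using cf continuous_on_compose2[OF F' cf] by simp
  have int: "(\<lambda>x. F' (f x) * f' x) absolutely_integrable_on {s..t}"
    by (rule absolutely_integrable_continuous_mult[OF cF'f primitive_on_total(2)[OF prim]])
  note intD = primitive_onD[OF primitive_on_indefinite_integral[OF st int]]
  have "bounded (f ` {s..t})"
    by (intro compact_imp_bounded compact_continuous_image cf) simp
  then obtain R where "\<And>y. y \<in> f ` {s..t} \<Longrightarrow> norm y \<le> R"
    unfolding bounded_iff by blast
  then have R: "f x \<in> cball 0 R" if "x \<in> {s..t}" for x
    using that by simp
  have ucF: "uniformly_continuous_on (cball 0 R) F'"
    by (intro compact_uniformly_continuous continuous_on_subset[OF F']) auto
  let ?g = "\<lambda>x. F' (f x) * f' x" and ?n = "\<lambda>x. norm (f' x)"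
  have est: "norm (F (f y) - F (f x) - integral {x..y} ?g)
      \<le> e * integral {x..y} ?n"
    if e: "e > 0" and xy: "s \<le> x" "x \<le> y" "y \<le> t" for e x y
  proof -
    define P where "P x y \<longleftrightarrow> (s \<le> x \<and> y \<le> t \<longrightarrow>
      norm (F (f y) - F (f x) - integral {x..y} ?g)
        \<le> e * integral {x..y} ?n)" for x y
    have "P x y"
      using xy(2)
    proof (induction rule: Bolzano)
      case (trans a b c)
      show ?case unfolding P_def
      proof
        assume ac: "s \<le> a \<and> c \<le> t"
        have "integral {a..b} ?g + integral {b..c} ?g = integral {a..c} ?g"
          "integral {a..b} ?n + integral {b..c} ?n
            = integral {a..c} ?n"
          using trans ac intD(2)[of a c] primitive_onD(3)[OF prim, of a c]
          by (intro Henstock_Kurzweil_Integration.integral_combine; simp)+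
        then have "F (f c) - F (f a) - integral {a..c} ?g =
            (F (f b) - F (f a) - integral {a..b} ?g) + (F (f c) - F (f b) - integral {b..c} ?g)"
          "e * integral {a..c} ?n =
            e * integral {a..b} ?n + e * integral {b..c} ?n"
          by (simp_all add: algebra_simps flip: distrib_left)
        then show "norm (F (f c) - F (f a) - integral {a..c} ?g)
            \<le> e * integral {a..c} ?n"
          using trans ac unfolding P_def by (smt (verit) norm_triangle_ineq)
      qed
    next
      case (local z)
      obtain d where d: "d > 0" "\<And>u v. u \<in> cball 0 R \<Longrightarrow> v \<in> cball 0 R \<Longrightarrow> dist u v < d
          \<Longrightarrow> dist (F' u) (F' v) < e / 2"
        using ucF e unfolding uniformly_continuous_on_def by (metis half_gt_zero)
      have "uniformly_continuous_on {s..t} f"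
        by (intro compact_uniformly_continuous cf) auto
      then obtain d' where d': "d' > 0" "\<And>u v. u \<in> {s..t} \<Longrightarrow> v \<in> {s..t} \<Longrightarrow> dist u v < d'
          \<Longrightarrow> dist (f u) (f v) < d"
        using d(1) unfolding uniformly_continuous_on_def by metis
      show ?case
      proof (intro exI[of _ d'] conjI d'(1) allI impI)
        fix a b assume ab: "a \<le> z \<and> z \<le> b \<and> b - a < d'"
        show "P a b" unfolding P_def
        proof
          assume st': "s \<le> a \<and> b \<le> t"
          let ?I = "integral {a..b} ?n"
          have I0: "norm (f b - f a) \<le> ?I"
            using primitive_onD[OF prim, of a b] st' ab
            by (auto intro!: integral_norm_bound_integral)
          have fd: "f u \<in> ball (f a) d" "f u \<in> cball 0 R" if "u \<in> {a..b}" for u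
            using d'(2)[of a u] that ab st' R[of u] by (auto simp: dist_real_def)
          have near: "norm (F' u - F' (f a)) \<le> e / 2" if "u \<in> ball (f a) d \<inter> cball 0 R" for u
            using d(2)[of u "f a"] that fd(2)[of a] ab
            by (auto simp: dist_norm norm_minus_commute intro: less_imp_le)
          have 1: "norm ((F (f b) - F' (f a) * f b) - (F (f a) - F' (f a) * f a))
              \<le> e / 2 * norm (f b - f a)"
          proof (rule field_differentiable_bound)
            show "convex (ball (f a) d \<inter> cball 0 R)" by (intro convex_Int) auto
            show "((\<lambda>z. F z - F' (f a) * z) has_field_derivative F' u - F' (f a))
              (at u within ball (f a) d \<inter> cball 0 R)" for u
              by (auto intro!: derivative_eq_intros DERIV_subset[OF F])
          qed (use near fd ab d(1) in auto)
          have 2: "norm (integral {a..b} (\<lambda>x. F' (f x) * f' x - F' (f a) * f' x)) \<le>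
             integral {a..b} (\<lambda>x. e / 2 * norm (f' x))"
          proof (rule integral_norm_bound_integral)
            show "(\<lambda>x. F' (f x) * f' x - F' (f a) * f' x) integrable_on {a..b}"
              using intD(2)[of a b] primitive_onD(2)[OF prim, of a b] st' ab
              by (intro integrable_diff integrable_on_mult_right) auto
            show "(\<lambda>x. e / 2 * norm (f' x)) integrable_on {a..b}"
              using primitive_onD(3)[OF prim, of a b] st' ab
              by (intro integrable_on_mult_right) auto
            show "norm (F' (f x) * f' x - F' (f a) * f' x) \<le> e / 2 * norm (f' x)" if "x \<in> {a..b}" for x
              using mult_right_mono[OF near[of "f x"], of "norm (f' x)"] fd[OF that]
              by (simp add: left_diff_distrib[symmetric] norm_mult)
          qed
          have "integral {a..b} (\<lambda>x. F' (f x) * f' x - F' (f a) * f' x)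
             = integral {a..b} ?g - F' (f a) * (f b - f a)"
            using intD(2)[of a b] primitive_onD(2,4)[OF prim, of a b] st' ab
            by (subst integral_diff) (auto intro!: integrable_on_mult_right)
          then have "F (f b) - F (f a) - integral {a..b} ?g =
             ((F (f b) - F' (f a) * f b) - (F (f a) - F' (f a) * f a))
              - integral {a..b} (\<lambda>x. F' (f x) * f' x - F' (f a) * f' x)"
            by (simp add: algebra_simps)
          also have "norm \<dots> \<le> e / 2 * norm (f b - f a) + e / 2 * ?I"
            by (rule order_trans[OF norm_triangle_ineq4 add_mono[OF 1]]) (use 2 in simp)
          also have "\<dots> \<le> e / 2 * ?I + e / 2 * ?I"
            using I0 e by (intro add_mono mult_left_mono) auto
          finally show "norm (F (f b) - F (f a) - integral {a..b} ?g) \<le> e * ?I"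
            by simp
        qed
      qed
    qed
    then show ?thesis using xy by (simp add: P_def)
  qed
  show ?thesis
    unfolding primitive_on_def
  proof (intro conjI ballI st int)
    fix x assume x: "x \<in> {s..t}"
    let ?I = "integral {s..x} ?n"
    have "norm (F (f x) - F (f s) - integral {s..x} ?g) \<le> 0 + e" if "e > 0" for e
    proof -
      have I: "?I \<ge> 0"
        using primitive_onD(3)[OF prim, of s x] x by (intro integral_nonneg) auto
      have "norm (F (f x) - F (f s) - integral {s..x} ?g) \<le> e / (?I + 1) * ?I"
        using x that I by (intro est) auto
      also have "\<dots> \<le> e"
        using that I by (simp add: field_simps)
      finally show ?thesis by simp
    qed
    then have "norm (F (f x) - F (f s) - integral {s..x} ?g) \<le> 0"
      by (rule field_le_epsilon)
    then show "(?g has_integral (F (f x) - F (f s))) {s..x}"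
      using intD(2)[of s x] x by (simp add: has_integral_integral)
  qed
qed

text \<open>
  The product rule follows from the chain rule for the square by polarization.
\<close>

lemma primitive_on_mult:
  assumes "primitive_on s t f f'" "primitive_on s t g g'"
  shows "primitive_on s t (\<lambda>x. f x * g x) (\<lambda>x. f' x * g x + f x * g' x)"
proof -
  have sq: "primitive_on s t (\<lambda>x. (f x)\<^sup>2) (\<lambda>x. 2 * f x * f' x)" if "primitive_on s t f f'" for f f'
  proof (rule primitive_on_entire[OF that])
    show "((\<lambda>z. z\<^sup>2) has_field_derivative 2 * z) (at z)" for z :: complex
      by (rule derivative_eq_intros | simp)+
  qed (intro continuous_intros)
  have "primitive_on s t (\<lambda>x. f x + - 1 * g x) (\<lambda>x. f' x + - 1 * g' x)"
    using assms by (intro primitive_on_add primitive_on_cmult)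
  from sq[OF primitive_on_add[OF assms]] sq[OF this]
  have "primitive_on s t (\<lambda>x. 1/4 * (f x + g x)\<^sup>2 + (-1/4) * (f x + - 1 * g x)\<^sup>2)
    (\<lambda>x. 1/4 * (2 * (f x + g x) * (f' x + g' x))
        + (-1/4) * (2 * (f x + - 1 * g x) * (f' x + - 1 * g' x)))"
    by (intro primitive_on_add primitive_on_cmult)
  then show ?thesis
    by (rule primitive_on_cong) (auto simp: power2_eq_square field_simps)
qed

lemma primitive_on_exp:
  assumes "primitive_on s t f f'"
  shows "primitive_on s t (\<lambda>x. exp (f x)) (\<lambda>x. exp (f x) * f' x)"
  by (rule primitive_on_entire[OF assms DERIV_exp]) (intro continuous_intros)


section \<open>Square-integrable functions and Fourier coefficients\<close>

definition sq_integrable :: "'a measure \<Rightarrow> ('a \<Rightarrow> 'b::euclidean_space) \<Rightarrow> bool" where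
  "sq_integrable M f \<longleftrightarrow> f \<in> borel_measurable M \<and> integrable M (\<lambda>x. (norm (f x))\<^sup>2)"

lemma sq_integrable_measurable: "sq_integrable M f \<Longrightarrow> f \<in> borel_measurable M"
  and sq_integrable_integrable: "sq_integrable M f \<Longrightarrow> integrable M (\<lambda>x. (norm (f x))\<^sup>2)"
  by (auto simp: sq_integrable_def)

lemma sq_integrable_norm_mult:
  assumes "sq_integrable M f" "sq_integrable M g"
  shows "integrable M (\<lambda>x. norm (f x) * norm (g x))"
proof (rule Bochner_Integration.integrable_bound)
  show "integrable M (\<lambda>x. (norm (f x))\<^sup>2 + (norm (g x))\<^sup>2)"
    using assms by (auto simp: sq_integrable_def)
  show "(\<lambda>x. norm (f x) * norm (g x)) \<in> borel_measurable M"
    using assms by (auto simp: sq_integrable_def)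
  show "AE x in M. norm (norm (f x) * norm (g x)) \<le> norm ((norm (f x))\<^sup>2 + (norm (g x))\<^sup>2)"
  proof (rule AE_I2)
    fix x
    have "2 * (norm (f x) * norm (g x)) \<le> (norm (f x))\<^sup>2 + (norm (g x))\<^sup>2"
      using sum_squares_bound[of "norm (f x)" "norm (g x)"] by (simp only: mult.assoc)
    moreover have "norm (f x) * norm (g x) \<ge> 0" by simp
    ultimately have "norm (f x) * norm (g x) \<le> (norm (f x))\<^sup>2 + (norm (g x))\<^sup>2"
      by linarith
    then show "norm (norm (f x) * norm (g x)) \<le> norm ((norm (f x))\<^sup>2 + (norm (g x))\<^sup>2)"
      by simp
  qed
qed

lemma sq_integrable_mult:
  fixes f g :: "'a \<Rightarrow> complex"
  assumes "sq_integrable M f" "sq_integrable M g"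
  shows "integrable M (\<lambda>x. f x * g x)"
  by (rule Bochner_Integration.integrable_bound[OF sq_integrable_norm_mult[OF assms]])
     (use assms in \<open>auto simp: sq_integrable_def norm_mult\<close>)

lemma sq_integrable_add:
  assumes "sq_integrable M f" "sq_integrable M g"
  shows "sq_integrable M (\<lambda>x. f x + g x)"
  unfolding sq_integrable_def
proof
  show "(\<lambda>x. f x + g x) \<in> borel_measurable M"
    using assms by (auto simp: sq_integrable_def)
  show "integrable M (\<lambda>x. (norm (f x + g x))\<^sup>2)"
  proof (rule Bochner_Integration.integrable_bound)
    show "integrable M (\<lambda>x. (norm (f x))\<^sup>2 + 2 * (norm (f x) * norm (g x)) + (norm (g x))\<^sup>2)"
      using assms sq_integrable_norm_mult[OF assms] by (auto simp: sq_integrable_def)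
    show "(\<lambda>x. (norm (f x + g x))\<^sup>2) \<in> borel_measurable M"
      using assms by (auto simp: sq_integrable_def)
    show "AE x in M. norm ((norm (f x + g x))\<^sup>2)
        \<le> norm ((norm (f x))\<^sup>2 + 2 * (norm (f x) * norm (g x)) + (norm (g x))\<^sup>2)"
    proof (rule AE_I2)
      fix x
      have "(norm (f x + g x))\<^sup>2 \<le> (norm (f x) + norm (g x))\<^sup>2"
        by (intro power_mono norm_triangle_ineq) simp
      also have "\<dots> = (norm (f x))\<^sup>2 + 2 * (norm (f x) * norm (g x)) + (norm (g x))\<^sup>2"
        by (simp add: power2_sum)
      finally show "norm ((norm (f x + g x))\<^sup>2)
        \<le> norm ((norm (f x))\<^sup>2 + 2 * (norm (f x) * norm (g x)) + (norm (g x))\<^sup>2)"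
        by simp
    qed
  qed
qed

lemma sq_integrable_cnj:
  "sq_integrable M f \<Longrightarrow> sq_integrable M (\<lambda>x. cnj (f x))"
  using borel_measurable_continuous_on[of cnj f M] by (simp add: sq_integrable_def continuous_intros)

lemma sq_integrable_bounded_mult:
  fixes f g :: "'a \<Rightarrow> complex"
  assumes f: "sq_integrable M f" and g: "g \<in> borel_measurable M" "\<And>x. x \<in> space M \<Longrightarrow> norm (g x) \<le> C"
  shows "sq_integrable M (\<lambda>x. f x * g x)"
  unfolding sq_integrable_def
proof
  show "(\<lambda>x. f x * g x) \<in> borel_measurable M"
    using f g by (auto simp: sq_integrable_def)
  show "integrable M (\<lambda>x. (norm (f x * g x))\<^sup>2)"
  proof (rule Bochner_Integration.integrable_bound)
    show "integrable M (\<lambda>x. C\<^sup>2 * (norm (f x))\<^sup>2)"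
      using f by (auto simp: sq_integrable_def)
    show "(\<lambda>x. (norm (f x * g x))\<^sup>2) \<in> borel_measurable M"
      using f g by (auto simp: sq_integrable_def)
    show "AE x in M. norm ((norm (f x * g x))\<^sup>2) \<le> norm (C\<^sup>2 * (norm (f x))\<^sup>2)"
    proof (rule AE_I2)
      fix x assume "x \<in> space M"
      then have "(norm (g x))\<^sup>2 * (norm (f x))\<^sup>2 \<le> C\<^sup>2 * (norm (f x))\<^sup>2"
        by (intro mult_right_mono power_mono g) auto
      then show "norm ((norm (f x * g x))\<^sup>2) \<le> norm (C\<^sup>2 * (norm (f x))\<^sup>2)"
        by (simp add: norm_mult power_mult_distrib mult.commute)
    qed
  qed
qed

lemma sq_integrable_cmult:
  fixes f :: "'a \<Rightarrow> complex"
  shows "sq_integrable M f \<Longrightarrow> sq_integrable M (\<lambda>x. c * f x)"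
  using sq_integrable_bounded_mult[of M f "\<lambda>_. c" "norm c"] by (simp add: mult.commute)

lemma sq_integrable_sum:
  fixes f :: "'i \<Rightarrow> 'a \<Rightarrow> 'b::euclidean_space"
  assumes "\<And>i. i \<in> I \<Longrightarrow> sq_integrable M (f i)"
  shows "sq_integrable M (\<lambda>x. \<Sum>i\<in>I. f i x)"
  using assms
proof (induction I rule: infinite_finite_induct)
  case (insert i I)
  then show ?case using sq_integrable_add[of M "f i"] by simp
qed (auto simp: sq_integrable_def)

lemma Cauchy_Schwarz_integral_mult:
  fixes f g :: "'a \<Rightarrow> complex"
  assumes f: "sq_integrable M f" and g: "sq_integrable M g"
  shows "(norm (LINT x|M. f x * g x))\<^sup>2 \<le> (LINT x|M. (norm (f x))\<^sup>2) * (LINT x|M. (norm (g x))\<^sup>2)"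
proof -
  define A B C where "A = (LINT x|M. (norm (f x))\<^sup>2)" and "B = (LINT x|M. norm (f x) * norm (g x))"
    and "C = (LINT x|M. (norm (g x))\<^sup>2)"
  have nn: "A \<ge> 0" "B \<ge> 0" "C \<ge> 0"
    by (auto simp: A_def B_def C_def intro!: integral_nonneg_AE)
  have pos: "0 \<le> t\<^sup>2 * A - 2 * t * s * B + s\<^sup>2 * C" for t s :: real
  proof -
    have "(LINT x|M. (t * norm (f x) - s * norm (g x))\<^sup>2) =
        (LINT x|M. t\<^sup>2 * (norm (f x))\<^sup>2 - 2 * t * s * (norm (f x) * norm (g x)) + s\<^sup>2 * (norm (g x))\<^sup>2)"
      by (simp add: power2_diff power_mult_distrib algebra_simps)
    also have "\<dots> = t\<^sup>2 * A - 2 * t * s * B + s\<^sup>2 * C"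
      using sq_integrable_norm_mult[OF f g] f g by (simp add: sq_integrable_def A_def B_def C_def)
    finally show ?thesis
      by (metis (no_types, lifting) integral_nonneg_AE AE_I2 zero_le_power2)
  qed
  have "B\<^sup>2 \<le> A * C"
  proof (cases "C = 0")
    case True
    have "B = 0"
    proof (rule ccontr)
      assume "B \<noteq> 0"
      then have "B > 0" using nn by simp
      then show False using pos[of 1 "(A + 1) / (2 * B)"] True by (simp add: field_simps)
    qed
    then show ?thesis using True by simp
  next
    case False
    then have "C > 0" using nn by simp
    then have "0 \<le> C * (C * A - B\<^sup>2)"
      using pos[of C B] by (simp add: power2_eq_square algebra_simps)
    then show ?thesis using \<open>C > 0\<close> by (simp add: zero_le_mult_iff mult.commute)
  qed
  moreover have "norm (LINT x|M. f x * g x) \<le> B"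
    unfolding B_def using integral_norm_bound[of M "\<lambda>x. f x * g x"] by (simp add: norm_mult)
  then have "(norm (LINT x|M. f x * g x))\<^sup>2 \<le> B\<^sup>2"
    by (intro power_mono) auto
  ultimately show ?thesis by (simp add: A_def C_def)
qed

lemma sq_integrable_continuous:
  fixes f :: "real \<Rightarrow> 'b::euclidean_space"
  assumes "continuous_on {s..t} f"
  shows "sq_integrable (lebesgue_on {s..t}) f"
  unfolding sq_integrable_def
proof
  show "f \<in> borel_measurable (lebesgue_on {s..t})"
    using assms by (rule continuous_imp_measurable_on_sets_lebesgue) simp
  have "continuous_on {s..t} (\<lambda>x. (norm (f x))\<^sup>2)"
    using assms by (intro continuous_intros)
  then show "integrable (lebesgue_on {s..t}) (\<lambda>x. (norm (f x))\<^sup>2)"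
    by (rule continuous_imp_integrable_real)
qed

lemma integrable_lebesgue_on_iff:
  "integrable (lebesgue_on {s..t::real}) f \<longleftrightarrow> f absolutely_integrable_on {s..t}"
  for f :: "real \<Rightarrow> 'b::euclidean_space"
  by (simp add: integrable_restrict_space set_integrable_def)

lemma sq_integrable_imp_integrable:
  fixes f :: "real \<Rightarrow> complex"
  assumes "sq_integrable (lebesgue_on {s..t}) f"
  shows "integrable (lebesgue_on {s..t}) f"
  using sq_integrable_mult[OF assms sq_integrable_continuous[of s t "\<lambda>_. 1"]] by simp

lemma primitive_on_integral:
  assumes "primitive_on s t f f'"
  shows "(LINT x|lebesgue_on {s..t}. f' x) = f t - f s"
  using primitive_on_total[OF assms]
  by (subst lebesgue_integral_eq_integral) (auto simp: integrable_lebesgue_on_iff)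

lemma sq_integrable_cis: "sq_integrable (lebesgue_on {0..L}) (\<lambda>x. cis (q * x))"
  and sq_integrable_cis_minus: "sq_integrable (lebesgue_on {0..L}) (\<lambda>x. cis (- (q * x)))"
  by (rule sq_integrable_continuous, intro continuous_intros)+

lemma primitive_on_cis:
  "s \<le> t \<Longrightarrow> primitive_on s t (\<lambda>x. cis (q * x)) (\<lambda>x. \<i> * q * cis (q * x))"
proof (rule primitive_on_C1)
  fix x :: real
  have "((\<lambda>z. exp (\<i> * q * z)) has_field_derivative \<i> * q * exp (\<i> * q * of_real x)) (at (of_real x))"
    by (auto intro!: derivative_eq_intros)
  from has_vector_derivative_real_field[OF this]
  show "((\<lambda>x. cis (q * x)) has_vector_derivative \<i> * q * cis (q * x)) (at x)"
    by (simp add: cis_conv_exp mult.assoc)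
qed (auto intro!: continuous_intros)

definition fcoef :: "real \<Rightarrow> (real \<Rightarrow> complex) \<Rightarrow> real \<Rightarrow> complex" where
  "fcoef L v q = (LINT x|lebesgue_on {0..L}. v x * cis (- (q * x)))"

lemma fcoef_deriv:
  assumes "primitive_on 0 L v D"
  shows "fcoef L D q = v L * cis (- q * L) - v 0 + \<i> * q * fcoef L v q"
proof -
  let ?M = "lebesgue_on {0..L}"
  have L: "0 \<le> L" using primitive_on_le[OF assms] .
  note p = primitive_on_mult[OF assms primitive_on_cis[OF L, of "- q"]]
  have 1: "integrable ?M (\<lambda>x. D x * cis (- q * x))"
    using absolutely_integrable_continuous_mult[of 0 L "\<lambda>x. cis (- q * x)" D]
        primitive_on_total(2)[OF assms]
    by (simp add: integrable_lebesgue_on_iff mult.commute continuous_intros)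
  have 2: "integrable ?M (\<lambda>x. v x * cis (- q * x))"
    by (intro sq_integrable_mult sq_integrable_continuous primitive_on_continuous[OF assms]
        continuous_intros)
  have "v L * cis (- q * L) - v 0
      = (LINT x|?M. D x * cis (- q * x) + v x * (\<i> * of_real (- q) * cis (- q * x)))"
    using primitive_on_integral[OF p] by simp
  also have "\<dots> = (LINT x|?M. D x * cis (- q * x) + - (\<i> * q) * (v x * cis (- q * x)))"
    by (intro Bochner_Integration.integral_cong refl) (simp add: algebra_simps)
  also have "\<dots> = fcoef L D q - \<i> * q * fcoef L v q"
    using 1 2 by (subst Bochner_Integration.integral_add) (auto simp: fcoef_def)
  finally show ?thesis by (simp add: algebra_simps)
qed

text \<open>
  The frequencies \<open>q\<close> for which \<open>exp (\<i> q x)\<close> is multiplied by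
  \<open>exp (2 \<pi> \<i> \<alpha>)\<close> under a shift by \<open>L\<close>.
\<close>

definition freq :: "real \<Rightarrow> real \<Rightarrow> int \<Rightarrow> real" where
  "freq L \<alpha> k = 2 * pi / L * (of_int k + \<alpha>)"

lemma cis_freq_period:
  assumes "L \<noteq> 0"
  shows "cis (freq L \<alpha> k * L) = cis (2 * pi * \<alpha>)"
proof -
  have "freq L \<alpha> k * L = 2 * pi * of_int k + 2 * pi * \<alpha>"
    using assms by (simp add: freq_def field_simps)
  then show ?thesis
    by (simp add: cis_mult[symmetric] cis_multiple_2pi)
qed

text \<open>
  Quasi-periodicity is exactly what makes the boundary term vanish.
\<close>

lemma fcoef_deriv_freq:
  assumes "primitive_on 0 L v D" "L > 0" "v L = cis (2 * pi * \<alpha>) * v 0"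
  shows "fcoef L D (freq L \<alpha> k) = \<i> * freq L \<alpha> k * fcoef L v (freq L \<alpha> k)"
proof -
  have "cis (- freq L \<alpha> k * L) = cis (- (2 * pi * \<alpha>))"
    using cis_freq_period[of L \<alpha> k] assms(2) by (simp flip: cis_cnj)
  then show ?thesis
    using fcoef_deriv[OF assms(1), of "freq L \<alpha> k"] assms(3)
    by (simp add: cis_mult mult.commute mult.left_commute)
qed

lemma cis_freq_orthogonal:
  assumes "L > 0"
  shows "(LINT x|lebesgue_on {0..L}. cis (freq L \<alpha> k * x) * cis (- (freq L \<alpha> j * x)))
     = (if k = j then L else 0)"
proof (cases "k = j")
  case True
  then show ?thesis
    using assms by (simp add: cis_mult measure_restrict_space scaleR_conv_of_real)
next
  case False
  define q where "q = freq L \<alpha> k - freq L \<alpha> j"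
  have q: "q = freq L 0 (k - j)" "q \<noteq> 0"
    using False assms by (auto simp: q_def freq_def field_simps)
  have "(LINT x|lebesgue_on {0..L}. \<i> * q * cis (q * x)) = cis (q * L) - cis (q * 0)"
    using assms by (intro primitive_on_integral primitive_on_cis) simp
  also have "\<dots> = 0"
    using cis_freq_period[of L 0 "k - j"] assms by (simp add: q)
  finally have "(LINT x|lebesgue_on {0..L}. cis (q * x)) = 0"
    using q by simp
  then show ?thesis
    using False by (simp add: cis_mult q_def algebra_simps)
qed

lemma trig_poly_integral_norm:
  assumes "L > 0" "finite F"
  shows "(LINT x|lebesgue_on {0..L}. (norm (\<Sum>k\<in>F. c k * cis (freq L \<alpha> k * x)))\<^sup>2)
    = L * (\<Sum>k\<in>F. (norm (c k))\<^sup>2)"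
proof -
  let ?M = "lebesgue_on {0..L}"
  have "complex_of_real (LINT x|?M. (norm (\<Sum>k\<in>F. c k * cis (freq L \<alpha> k * x)))\<^sup>2)
    = (LINT x|?M. (\<Sum>k\<in>F. \<Sum>j\<in>F. c k * cnj (c j) *
         (cis (freq L \<alpha> k * x) * cis (- (freq L \<alpha> j * x)))))"
    unfolding integral_complex_of_real[symmetric] complex_norm_square
    by (simp add: sum_product cis_cnj mult_ac)
  also have "\<dots> = (\<Sum>k\<in>F. \<Sum>j\<in>F. c k * cnj (c j) * (if k = j then L else 0))"
    by (simp add: sq_integrable_mult sq_integrable_cis sq_integrable_cis_minus
        cis_freq_orthogonal[OF assms(1)])
  also have "\<dots> = (\<Sum>k\<in>F. c k * cnj (c k) * L)"
    using assms(2) by (intro sum.cong refl) (simp add: if_distrib cong: if_cong)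
  also have "\<dots> = complex_of_real (L * (\<Sum>k\<in>F. (norm (c k))\<^sup>2))"
    by (simp add: complex_norm_square sum_distrib_left mult.commute del: of_real_power)
  finally show ?thesis unfolding of_real_eq_iff .
qed

text \<open>
  The integrated form of \<open>\<bar>f - g\<bar>\<^sup>2 = \<bar>f\<bar>\<^sup>2 - 2 Re (f \<cdot> g) + \<bar>g\<bar>\<^sup>2\<close>, as it
  is used for Bessel inequalities.
\<close>

lemma integral_polarization:
  fixes a b c :: "'a \<Rightarrow> real"
  assumes "integrable M a" "integrable M b" "integrable M c"
  shows "(LINT x|M. a x - 2 * b x + c x) = (LINT x|M. a x) - 2 * (LINT x|M. b x) + (LINT x|M. c x)"
  using assms by simp

lemma Bessel_fcoef:
  assumes "L > 0" "finite F" and D: "sq_integrable (lebesgue_on {0..L}) D"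
  shows "(\<Sum>k\<in>F. (norm (fcoef L D (freq L \<alpha> k)))\<^sup>2) \<le> L * (LINT x|lebesgue_on {0..L}. (norm (D x))\<^sup>2)"
proof -
  let ?M = "lebesgue_on {0..L}"
  define d where "d k = fcoef L D (freq L \<alpha> k)" for k
  define T where "T x = (\<Sum>k\<in>F. d k / L * cis (freq L \<alpha> k * x))" for x
  have T: "sq_integrable ?M T"
    unfolding T_def by (intro sq_integrable_sum sq_integrable_cmult sq_integrable_cis)
  have DT: "integrable ?M (\<lambda>x. D x * cnj (T x))"
    by (intro sq_integrable_mult sq_integrable_cnj D T)
  have "(LINT x|?M. D x * cnj (T x))
      = (LINT x|?M. (\<Sum>k\<in>F. cnj (d k) / L * (D x * cis (- (freq L \<alpha> k * x)))))"
    by (simp add: T_def sum_distrib_left cis_cnj mult_ac)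
  also have "\<dots> = (\<Sum>k\<in>F. cnj (d k) / L * d k)"
    by (simp add: sq_integrable_mult D sq_integrable_cis_minus d_def fcoef_def)
  also have "\<dots> = of_real ((\<Sum>k\<in>F. (norm (d k))\<^sup>2) / L)"
    by (simp add: complex_norm_square sum_divide_distrib mult.commute del: of_real_power)
  finally have cross: "(LINT x|?M. D x * cnj (T x)) = of_real ((\<Sum>k\<in>F. (norm (d k))\<^sup>2) / L)" .
  have "(LINT x|?M. Re (D x * cnj (T x))) = (\<Sum>k\<in>F. (norm (d k))\<^sup>2) / L"
    using DT by (subst integral_Re) (simp_all add: cross)
  moreover have "(LINT x|?M. (norm (T x))\<^sup>2) = (\<Sum>k\<in>F. (norm (d k))\<^sup>2) / L"
    unfolding T_def using assms(1) trig_poly_integral_norm[OF assms(1,2), of "\<lambda>k. d k / L"]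
    by (simp add: norm_divide power_divide sum_divide_distrib[symmetric] power2_eq_square)
  moreover have "0 \<le> (LINT x|?M. (norm (D x))\<^sup>2 - 2 * Re (D x * cnj (T x)) + (norm (T x))\<^sup>2)"
  proof (rule integral_nonneg_AE, rule AE_I2)
    fix x
    have "(norm (D x - T x))\<^sup>2 = (norm (D x))\<^sup>2 - 2 * Re (D x * cnj (T x)) + (norm (T x))\<^sup>2"
      by (simp add: cmod_power2) (simp add: power2_eq_square algebra_simps)
    then show "0 \<le> (norm (D x))\<^sup>2 - 2 * Re (D x * cnj (T x)) + (norm (T x))\<^sup>2"
      by (metis zero_le_power2)
  qed
  moreover have "(LINT x|?M. (norm (D x))\<^sup>2 - 2 * Re (D x * cnj (T x)) + (norm (T x))\<^sup>2)
     = (LINT x|?M. (norm (D x))\<^sup>2) - 2 * (LINT x|?M. Re (D x * cnj (T x))) + (LINT x|?M. (norm (T x))\<^sup>2)"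
    using sq_integrable_integrable[OF D] sq_integrable_integrable[OF T] integrable_Re[OF DT]
    by (intro integral_polarization)
  ultimately have "(\<Sum>k\<in>F. (norm (d k))\<^sup>2) / L \<le> (LINT x|?M. (norm (D x))\<^sup>2)"
    by simp
  then show ?thesis
    using assms(1) by (simp add: d_def field_simps)
qed

text \<open>
  The odd part of the sum of the reciprocal squares: the sum over all positive integers is
  \<open>\<pi>\<^sup>2 / 6\<close>, the even ones contribute a quarter of it, and half-integers come in pairs
  \<open>\<plusminus> (n + 1/2)\<close>.
\<close>

lemma half_integer_sums:
  "(\<lambda>m. \<Sum>k\<in>{- int m..<int m}. 1 / (real_of_int k + 1/2)\<^sup>2) \<longlonglongrightarrow> pi\<^sup>2"
proof -
  have basel: "(\<lambda>n. 1 / (real n + 1)\<^sup>2) sums (pi\<^sup>2 / 6)"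
    using inverse_squares_sums by (simp add: add.commute)
  then have "(\<lambda>n. 1/4 * (1 / (real n + 1)\<^sup>2)) sums (1/4 * (pi\<^sup>2 / 6))"
    by (rule sums_mult)
  moreover have "(\<lambda>n. \<Sum>i\<in>{n * 2..<n * 2 + 2}. 1 / (real i + 1)\<^sup>2) sums (pi\<^sup>2 / 6)"
    by (rule sums_group[OF basel]) simp
  ultimately have "(\<lambda>n. (\<Sum>i\<in>{n * 2..<n * 2 + 2}. 1 / (real i + 1)\<^sup>2) - 1/4 * (1 / (real n + 1)\<^sup>2))
      sums (pi\<^sup>2 / 6 - 1/4 * (pi\<^sup>2 / 6))"
    by (intro sums_diff)
  moreover have "(\<Sum>i\<in>{n * 2..<n * 2 + 2}. 1 / (real i + 1)\<^sup>2) - 1/4 * (1 / (real n + 1)\<^sup>2)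
      = 1/4 * (1 / (real n + 1/2)\<^sup>2)" for n
  proof -
    have "{n * 2..<n * 2 + 2} = {2 * n, 2 * n + 1}" by auto
    moreover have "1 / (real (2 * n) + 1)\<^sup>2 = 1/4 * (1 / (real n + 1/2)\<^sup>2)"
    proof -
      have "real (2 * n) + 1 = 2 * (real n + 1/2)" by simp
      then show ?thesis unfolding power2_eq_square by (simp add: algebra_simps)
    qed
    moreover have "1 / (real (2 * n + 1) + 1)\<^sup>2 = 1/4 * (1 / (real n + 1)\<^sup>2)"
    proof -
      have "real (2 * n + 1) + 1 = 2 * (real n + 1)" by simp
      then show ?thesis unfolding power2_eq_square by (simp add: algebra_simps)
    qed
    ultimately show ?thesis by simp
  qed
  ultimately have "(\<lambda>n. 1/4 * (1 / (real n + 1/2)\<^sup>2)) sums (pi\<^sup>2 / 8)" by simp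
  from sums_mult[OF this, of 8] have "(\<lambda>n. 2 * (1 / (real n + 1/2)\<^sup>2)) sums pi\<^sup>2" by simp
  then have lim: "(\<lambda>m. \<Sum>n<m. 2 * (1 / (real n + 1/2)\<^sup>2)) \<longlonglongrightarrow> pi\<^sup>2"
    by (simp add: sums_def)
  have "(\<Sum>n<m. 2 * (1 / (real n + 1/2)\<^sup>2)) = (\<Sum>k\<in>{- int m..<int m}. 1 / (real_of_int k + 1/2)\<^sup>2)" for m
  proof (induction m)
    case (Suc m)
    have eq: "{- int (Suc m)..<int (Suc m)} = insert (- int m - 1) (insert (int m) {- int m..<int m})"
      by auto
    have "(- real m - 1 + 1/2)\<^sup>2 = (real m + 1/2)\<^sup>2"
      by (simp add: power2_eq_square algebra_simps)
    then show ?case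
      unfolding eq using Suc by simp
  qed simp
  then show ?thesis using lim by simp
qed


section \<open>Pointwise convergence of quasi-periodic Fourier series\<close>

text \<open>
  Both \<open>v x0 - v 0\<close> and \<open>v L - v x0 = - v 0 - v x0\<close> are integrals of \<open>D\<close>; half their
  difference is \<open>v x0\<close>. Point evaluation thus becomes the pairing of \<open>D\<close> with a step function.
\<close>

lemma antiperiodic_representation:
  assumes prim: "primitive_on 0 L v D" and D: "sq_integrable (lebesgue_on {0..L}) D"
    and anti: "v L = - v 0" and x0: "x0 \<in> {0..L}"
  shows "v x0 = (LINT x|lebesgue_on {0..L}. D x * (if x < x0 then 1/2 else - (1/2)))"
proof -
  let ?M = "lebesgue_on {0..L}"
  let ?h = "\<lambda>x. (if x < x0 then 1/2 else - (1/2)) :: complex"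
  have "integrable ?M (\<lambda>x. D x * ?h x)"
  proof (intro sq_integrable_imp_integrable sq_integrable_bounded_mult[where C = 1] D)
    have "?h \<in> borel_measurable borel" by measurable
    then show "?h \<in> borel_measurable ?M"
      by (intro measurable_restrict_space1) (simp add: measurable_completion)
  qed auto
  then have eq: "(LINT x|?M. D x * ?h x) = integral {0..L} (\<lambda>x. D x * ?h x)"
    by (intro lebesgue_integral_eq_integral) auto
  have "((\<lambda>x. D x * (1/2)) has_integral (v x0 - v 0) * (1/2)) {0..x0}"
    using x0 by (intro has_integral_mult_left primitive_on_has_integral[OF prim]) auto
  then have 1: "((\<lambda>x. D x * ?h x) has_integral (v x0 - v 0) * (1/2)) {0..x0}"
    by (rule has_integral_spike_finite[of "{x0}", rotated 2]) auto
  have "(D has_integral (v L - v x0)) {x0..L}"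
    using primitive_onD(2,4)[OF prim, of x0 L] x0 by (simp add: integrable_integral)
  then have "((\<lambda>x. D x * (- (1/2))) has_integral (v L - v x0) * (- (1/2))) {x0..L}"
    by (rule has_integral_mult_left)
  then have 2: "((\<lambda>x. D x * ?h x) has_integral (v L - v x0) * (- (1/2))) {x0..L}"
    by (rule has_integral_eq[rotated]) auto
  have "((\<lambda>x. D x * ?h x) has_integral (v x0 - v 0) * (1/2) + (v L - v x0) * (- (1/2))) {0..L}"
    using has_integral_combine[OF _ _ 1 2] x0 by auto
  then have "integral {0..L} (\<lambda>x. D x * ?h x) = (v x0 - v 0) * (1/2) + (v L - v x0) * (- (1/2))"
    by (rule integral_unique)
  also have "\<dots> = v x0" using anti by (simp add: field_simps)
  finally show ?thesis using eq by simp
qed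

text \<open>
  Both \<open>v x0\<close> and the partial sums of its Fourier series are pairings with \<open>D\<close>: the former with
  the step function \<open>h\<close> of \<open>antiperiodic_representation\<close>, the latter with the partial sums
  \<open>hm m\<close> of the Fourier series of \<open>h\<close>. By the Cauchy-Schwarz inequality it suffices that
  \<open>hm m\<close> tends to \<open>h\<close> in \<open>L\<^sup>2\<close>. The squared distance is explicit and tends to \<open>0\<close> by
  \<open>half_integer_sums\<close>.
\<close>

lemma antiperiodic_fourier:
  assumes prim: "primitive_on 0 L v D" and L: "L > 0" and D: "sq_integrable (lebesgue_on {0..L}) D"
    and anti: "v L = - v 0" and x0: "x0 \<in> {0..L}"
  shows "(\<lambda>m. \<Sum>k\<in>{- int m..<int m}. fcoef L v (freq L (1/2) k) / L * cis (freq L (1/2) k * x0))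
     \<longlonglongrightarrow> v x0"
proof -
  let ?M = "lebesgue_on {0..L}"
  define h where "h x = ((if x < x0 then 1/2 else - (1/2)) :: complex)" for x
  define q where "q = freq L (1/2)"
  let ?K = "\<lambda>m. {- int m..<int m}"
  let ?S = "\<lambda>m. \<Sum>k\<in>?K m. fcoef L v (q k) / L * cis (q k * x0)"
  define hm where "hm m x = (\<Sum>k\<in>?K m. cis (q k * x0) / (\<i> * q k * L) * cis (- (q k * x)))" for m x
  have q0: "q k \<noteq> 0" for k
  proof -
    have "2 * k + 1 \<noteq> 0" by presburger
    then have "real_of_int (2 * k + 1) \<noteq> 0" by (simp only: of_int_eq_0_iff not_False_eq_True)
    then show ?thesis using L by (simp add: q_def freq_def)
  qed
  have hh: "sq_integrable ?M h"
  proof -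
    have "h \<in> borel_measurable borel" unfolding h_def by measurable
    then have "h \<in> borel_measurable ?M"
      by (intro measurable_restrict_space1) (simp add: measurable_completion)
    moreover have "(\<lambda>x. (norm (h x))\<^sup>2) = (\<lambda>_. 1/4)"
      by (auto simp: h_def power2_eq_square)
    ultimately show ?thesis
      using sq_integrable_continuous[of 0 L "\<lambda>_. 1/2 :: real"]
      by (simp add: sq_integrable_def power2_eq_square)
  qed
  have shm: "sq_integrable ?M (hm m)" for m
    unfolding hm_def by (intro sq_integrable_sum sq_integrable_cmult sq_integrable_cis_minus)
  have hm_sq: "sq_integrable ?M (\<lambda>x. h x - hm m x)" for m
    using sq_integrable_add[OF hh sq_integrable_cmult[OF shm[of m], of "- 1"]] by simp
  have v: "v x0 = (LINT x|?M. D x * h x)"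
    unfolding h_def by (rule antiperiodic_representation[OF prim D anti x0])
  have period: "cis (q k * L) = - 1" for k
    using cis_freq_period[of L "1/2" k] L by (simp add: q_def)
  have per': "v L = cis (2 * pi * (1/2)) * v 0" using anti by simp
  have S: "?S m = (LINT x|?M. D x * hm m x)" for m
  proof -
    have "(LINT x|?M. D x * hm m x) =
       (LINT x|?M. (\<Sum>k\<in>?K m. cis (q k * x0) / (\<i> * q k * L) * (D x * cis (- (q k * x)))))"
      by (simp add: hm_def sum_distrib_left mult_ac)
    also have "\<dots> = (\<Sum>k\<in>?K m. cis (q k * x0) / (\<i> * q k * L) * fcoef L D (q k))"
      by (simp add: sq_integrable_mult D sq_integrable_cis_minus fcoef_def)
    also have "\<dots> = ?S m"
      using q0 fcoef_deriv_freq[OF prim L per'] by (simp add: q_def[symmetric] mult_ac)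
    finally show ?thesis by simp
  qed
  \<comment> \<open>The representation applied to \<open>cis (- q x) / (- \<i> q)\<close> gives the coefficients of \<open>h\<close>.\<close>
  have hc: "(LINT x|?M. h x * cis (- (q k * x))) = cis (- (q k * x0)) / (- \<i> * q k)" for k
  proof -
    have "cis (- (q k * x0)) / (- \<i> * q k) = (LINT x|?M. cis (- (q k * x)) * h x)"
      unfolding h_def
    proof (rule antiperiodic_representation[OF _ sq_integrable_cis_minus _ x0])
      have "primitive_on 0 L (\<lambda>x. (1 / (- \<i> * q k)) * cis (- (q k) * x))
        (\<lambda>x. (1 / (- \<i> * q k)) * (\<i> * of_real (- (q k)) * cis (- (q k) * x)))"
        using L by (intro primitive_on_cmult primitive_on_cis) simp
      then show "primitive_on 0 L (\<lambda>x. cis (- (q k * x)) / (- \<i> * q k)) (\<lambda>x. cis (- (q k * x)))"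
        by (rule primitive_on_cong) (use q0 in auto)
      have "cis (- (q k * L)) = - 1" using period[of k] by (simp flip: cis_cnj)
      then show "cis (- (q k * L)) / (- \<i> * q k) = - (cis (- (q k * 0)) / (- \<i> * q k))" by simp
    qed
    then show ?thesis by (simp add: mult.commute)
  qed
  define s where "s m = (\<Sum>k\<in>?K m. 1 / (q k)\<^sup>2) / L" for m
  have cross: "(LINT x|?M. h x * hm m x) = of_real (s m)" for m
  proof -
    have "(LINT x|?M. h x * hm m x) =
       (LINT x|?M. (\<Sum>k\<in>?K m. cis (q k * x0) / (\<i> * q k * L) * (h x * cis (- (q k * x)))))"
      by (simp add: hm_def sum_distrib_left mult_ac)
    also have "\<dots> = (\<Sum>k\<in>?K m. cis (q k * x0) / (\<i> * q k * L) * (LINT x|?M. h x * cis (- (q k * x))))"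
      by (simp add: sq_integrable_mult hh sq_integrable_cis_minus)
    also have "\<dots> = (\<Sum>k\<in>?K m. cis (q k * x0) / (\<i> * q k * L) * (cis (- (q k * x0)) / (- \<i> * q k)))"
      by (simp only: hc)
    also have "\<dots> = (\<Sum>k\<in>?K m. of_real (1 / (q k)\<^sup>2 / L))"
    proof (intro sum.cong refl)
      fix k
      have "cis (q k * x0) * cis (- (q k * x0)) = 1" by (simp add: cis_mult)
      then show "cis (q k * x0) / (\<i> * q k * L) * (cis (- (q k * x0)) / (- \<i> * q k))
          = of_real (1 / (q k)\<^sup>2 / L)"
        using q0[of k] L by (simp add: power2_eq_square field_simps)
    qed
    finally show ?thesis by (simp add: s_def sum_divide_distrib)
  qed
  have hmn: "(LINT x|?M. (norm (hm m x))\<^sup>2) = s m" for m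
  proof -
      have "(LINT x|?M. (norm (hm m x))\<^sup>2)
          = (LINT x|?M. (norm (\<Sum>k\<in>?K m. cnj (cis (q k * x0) / (\<i> * q k * L)) * cis (q k * x)))\<^sup>2)"
    proof (intro Bochner_Integration.integral_cong refl arg_cong[where f = "\<lambda>x. x\<^sup>2"])
      fix x
      have "cnj (hm m x) = (\<Sum>k\<in>?K m. cnj (cis (q k * x0) / (\<i> * q k * L)) * cis (q k * x))"
        by (simp add: hm_def cis_cnj)
      then show "norm (hm m x) = norm (\<Sum>k\<in>?K m. cnj (cis (q k * x0) / (\<i> * q k * L)) * cis (q k * x))"
        by (metis complex_mod_cnj)
    qed
    also have "\<dots> = L * (\<Sum>k\<in>?K m. (norm (cnj (cis (q k * x0) / (\<i> * q k * L))))\<^sup>2)"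
      unfolding q_def by (rule trig_poly_integral_norm[OF L]) simp
    also have "\<dots> = L * (\<Sum>k\<in>?K m. 1 / (q k)\<^sup>2 / L\<^sup>2)"
      by (simp add: norm_divide norm_mult power_divide power_mult_distrib)
    also have "\<dots> = s m"
      using L by (simp add: s_def sum_distrib_left sum_divide_distrib power2_eq_square[of L])
    finally show ?thesis .
  qed
  have dist: "(LINT x|?M. (norm (h x - hm m x))\<^sup>2) = L / 4 - s m" for m
  proof -
    have i1: "integrable ?M (\<lambda>x. h x * hm m x)" by (intro sq_integrable_mult hh shm)
    have "(norm (h x - hm m x))\<^sup>2 = 1/4 - 2 * Re (h x * hm m x) + (norm (hm m x))\<^sup>2" for x
      by (simp add: cmod_power2 h_def) (simp add: power2_eq_square algebra_simps)
    then have "(LINT x|?M. (norm (h x - hm m x))\<^sup>2)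
        = (LINT x|?M. 1/4 - 2 * Re (h x * hm m x) + (norm (hm m x))\<^sup>2)"
      by simp
    also have "\<dots> = (LINT x|?M. 1/4) - 2 * (LINT x|?M. Re (h x * hm m x))
        + (LINT x|?M. (norm (hm m x))\<^sup>2)"
      using sq_integrable_integrable[OF shm[of m]] integrable_Re[OF i1]
      by (intro integral_polarization) (auto simp: integrable_lebesgue_on_iff
          intro!: absolutely_integrable_continuous_real)
    also have "\<dots> = L / 4 - s m"
      using L i1 by (subst integral_Re) (simp_all add: cross hmn measure_restrict_space)
    finally show ?thesis .
  qed
  have slim: "s \<longlonglongrightarrow> L / 4"
  proof -
    have "s m = L / (4 * pi\<^sup>2) * (\<Sum>k\<in>?K m. 1 / (real_of_int k + 1/2)\<^sup>2)" for m
      using L by (simp add: s_def q_def freq_def sum_distrib_left sum_divide_distrib power_mult_distrib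
          power_divide) (simp add: power2_eq_square)
    then have "s = (\<lambda>m. L / (4 * pi\<^sup>2) * (\<Sum>k\<in>?K m. 1 / (real_of_int k + 1/2)\<^sup>2))" by blast
    moreover have "(\<lambda>m. L / (4 * pi\<^sup>2) * (\<Sum>k\<in>?K m. 1 / (real_of_int k + 1/2)\<^sup>2))
        \<longlonglongrightarrow> L / (4 * pi\<^sup>2) * pi\<^sup>2"
      by (intro tendsto_intros half_integer_sums)
    ultimately show ?thesis by simp
  qed
  define A where "A = (LINT x|?M. (norm (D x))\<^sup>2)"
  have bound: "norm (v x0 - ?S m) \<le> sqrt (A * (L / 4 - s m))" for m
  proof -
    have "v x0 - ?S m = (LINT x|?M. D x * (h x - hm m x))"
      unfolding v S right_diff_distrib
      by (intro Bochner_Integration.integral_diff[symmetric] sq_integrable_mult D hh shm)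
    then show ?thesis
      using Cauchy_Schwarz_integral_mult[OF D hm_sq[of m]]
      by (intro real_le_rsqrt) (simp add: dist A_def)
  qed
  have "(\<lambda>m. sqrt (A * (L / 4 - s m))) \<longlonglongrightarrow> sqrt (A * (L / 4 - L / 4))"
    by (intro tendsto_intros slim)
  then have "(\<lambda>m. sqrt (A * (L / 4 - s m))) \<longlonglongrightarrow> 0" by simp
  then have "(\<lambda>m. v x0 - ?S m) \<longlonglongrightarrow> 0"
    by (rule Lim_null_comparison[rotated]) (intro always_eventually allI bound)
  then have "(\<lambda>m. v x0 - (v x0 - ?S m)) \<longlonglongrightarrow> v x0 - 0"
    by (intro tendsto_intros)
  then show ?thesis by (simp add: q_def)
qed

text \<open>
  Multiplication by a suitable \<open>exp (\<i> \<gamma> x)\<close> turns a quasi-periodic function into an antiperiodic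
  one without changing its Fourier coefficients.
\<close>

lemma fourier_pointwise:
  assumes prim: "primitive_on 0 L v D" and L: "L > 0" and D: "sq_integrable (lebesgue_on {0..L}) D"
    and per: "v L = cis (2 * pi * \<alpha>) * v 0" and x0: "x0 \<in> {0..L}"
  shows "(\<lambda>m. \<Sum>k\<in>{- int m..<int m}. fcoef L v (freq L \<alpha> k) / L * cis (freq L \<alpha> k * x0)) \<longlonglongrightarrow> v x0"
proof -
  \<comment> \<open>chosen such that \<open>exp (2 \<pi> \<i> \<alpha>) exp (\<i> \<gamma> L) = - 1\<close>\<close>
  define \<gamma> where "\<gamma> = 2 * pi / L * (1/2 - \<alpha>)"
  define w where "w x = v x * cis (\<gamma> * x)" for x
  define D' where "D' x = D x * cis (\<gamma> * x) + v x * (\<i> * \<gamma> * cis (\<gamma> * x))" for x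
  have L0: "0 \<le> L" using L by simp
  have q: "freq L (1/2) k = freq L \<alpha> k + \<gamma>" for k
    by (simp add: freq_def \<gamma>_def algebra_simps add_divide_distrib diff_divide_distrib)
  have "primitive_on 0 L w D'"
    unfolding w_def[abs_def] D'_def[abs_def] by (intro primitive_on_mult prim primitive_on_cis L0)
  moreover have "sq_integrable (lebesgue_on {0..L}) D'"
    unfolding D'_def[abs_def]
  proof (rule sq_integrable_add)
    show "sq_integrable (lebesgue_on {0..L}) (\<lambda>x. D x * cis (\<gamma> * x))"
      by (rule sq_integrable_bounded_mult[where C = 1, OF D])
         (auto intro: sq_integrable_measurable sq_integrable_cis)
    show "sq_integrable (lebesgue_on {0..L}) (\<lambda>x. v x * (\<i> * \<gamma> * cis (\<gamma> * x)))"
      by (intro sq_integrable_continuous continuous_intros primitive_on_continuous[OF prim])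
  qed
  moreover have "w L = - w 0"
  proof -
    have "2 * pi * \<alpha> + \<gamma> * L = pi" using L by (simp add: \<gamma>_def field_simps)
    then have "cis (2 * pi * \<alpha>) * cis (\<gamma> * L) = - 1" by (simp only: cis_mult cis_pi)
    then show ?thesis using per by (simp add: w_def mult.commute mult.left_commute)
  qed
  ultimately have "(\<lambda>m. \<Sum>k\<in>{- int m..<int m}. fcoef L w (freq L (1/2) k) / L
      * cis (freq L (1/2) k * x0)) \<longlonglongrightarrow> w x0"
    using x0 by (intro antiperiodic_fourier L)
  moreover have "fcoef L w (freq L (1/2) k) = fcoef L v (freq L \<alpha> k)" for k
    unfolding fcoef_def w_def q
    by (intro Bochner_Integration.integral_cong refl) (simp add: cis_mult algebra_simps)
  moreover have "cis (freq L (1/2) k * x0) = cis (freq L \<alpha> k * x0) * cis (\<gamma> * x0)" for k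
    by (simp add: q cis_mult algebra_simps)
  ultimately have "(\<lambda>m. (\<Sum>k\<in>{- int m..<int m}. fcoef L v (freq L \<alpha> k) / L * cis (freq L \<alpha> k * x0))
      * cis (\<gamma> * x0))
      \<longlonglongrightarrow> v x0 * cis (\<gamma> * x0)"
    by (simp add: sum_distrib_right mult.assoc w_def)
  from tendsto_mult[OF this tendsto_const[of "cis (- (\<gamma> * x0))"]]
  show ?thesis by (simp add: mult.assoc cis_mult)
qed


section \<open>Periodic weak derivatives\<close>

lemma smooth_per_trig:
  assumes "L > 0"
  shows "(\<lambda>x. a * cos (freq L 0 k * x) + b * sin (freq L 0 k * x)) \<in> smooth_per L"
proof -
  define p where "p = freq L 0 k"
  have D: "((\<lambda>x. a * cos (p * x) + b * sin (p * x)) has_real_derivative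
      (b * p) * cos (p * x) + (- a * p) * sin (p * x)) (at x)" for a b x
    by (auto intro!: derivative_eq_intros)
  have "\<exists>a' b'. (deriv ^^ n) (\<lambda>x. a * cos (p * x) + b * sin (p * x))
      = (\<lambda>x. a' * cos (p * x) + b' * sin (p * x))" for n
  proof (induction n)
    case (Suc n)
    then obtain a' b' where *: "(deriv ^^ n) (\<lambda>x. a * cos (p * x) + b * sin (p * x))
        = (\<lambda>x. a' * cos (p * x) + b' * sin (p * x))" by blast
    have "deriv (\<lambda>x. a' * cos (p * x) + b' * sin (p * x))
        = (\<lambda>x. (b' * p) * cos (p * x) + (- a' * p) * sin (p * x))"
      using DERIV_imp_deriv[OF D] by blast
    with * have "(deriv ^^ Suc n) (\<lambda>x. a * cos (p * x) + b * sin (p * x))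
        = (\<lambda>x. (b' * p) * cos (p * x) + (- a' * p) * sin (p * x))"
      by simp
    then show ?case by blast
  qed auto
  moreover have "(\<lambda>x. a * cos (p * x) + b * sin (p * x)) differentiable_on UNIV" for a b
    using D by (meson differentiable_on_def differentiable_at_withinI real_differentiable_def)
  ultimately have "\<forall>n. (deriv ^^ n) (\<lambda>x. a * cos (p * x) + b * sin (p * x)) differentiable_on UNIV"
    by metis
  moreover have "periodic_fun_simple (\<lambda>x. a * cos (p * x) + b * sin (p * x)) L"
  proof
    fix x
    have "cis (p * (x + L)) = cis (p * x)"
      using cis_freq_period[of L 0 k] assms by (simp add: p_def distrib_left cis_mult[symmetric])
    then have "cos (p * (x + L)) = cos (p * x)" "sin (p * (x + L)) = sin (p * x)"
      by (simp_all add: cis.code)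
    then show "a * cos (p * (x + L)) + b * sin (p * (x + L)) = a * cos (p * x) + b * sin (p * x)"
      by simp
  qed
  ultimately show ?thesis by (simp add: smooth_per_def p_def)
qed

text \<open>
  Almost every point is a Lebesgue point of \<open>r\<close>, where \<open>r\<close> is the limit of averages over short
  intervals.
\<close>

lemma integral_zero_imp_AE_zero:
  fixes r :: "real \<Rightarrow> complex"
  assumes r: "r absolutely_integrable_on {0..L}"
    and zero: "\<And>x. x \<in> {0..L} \<Longrightarrow> integral {0..x} r = 0"
  shows "AE x in lebesgue_on {0..L}. r x = 0"
proof -
  define r0 where "r0 x = (if x \<in> {0..L} then r x else 0)" for x
  have "r0 integrable_on cbox a b" for a b
  proof -
    have "r0 integrable_on UNIV"
      unfolding r0_def integrable_restrict_UNIV using r by (simp add: absolutely_integrable_on_def)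
    then show ?thesis by (rule integrable_on_subcbox) simp
  qed
  then obtain N where N: "negligible N" and lim: "\<And>x e. \<lbrakk>x \<notin> N; 0 < e\<rbrakk>
      \<Longrightarrow> \<exists>d>0. \<forall>h. 0 < h \<and> h < d \<longrightarrow> norm (integral (cbox x (x + h *\<^sub>R One)) r0 /\<^sub>R h ^ DIM(real)
          - r0 x) < e"
    using integrable_ccontinuous_explicit by blast
  have z: "r x = 0" if x: "x \<in> {0..L}" "x \<notin> N \<union> {L}" for x
  proof (rule ccontr)
    assume "r x \<noteq> 0"
    then obtain d where d: "d > 0"
        "\<And>h. 0 < h \<Longrightarrow> h < d \<Longrightarrow> norm (integral {x..x + h} r0 /\<^sub>R h - r0 x) < norm (r x)"
      using lim[of x "norm (r x)"] x by auto
    define h where "h = min (d / 2) (L - x)"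
    have h: "0 < h" "h < d" "x + h \<le> L" using d(1) x by (auto simp: h_def)
    have "integral {x..x + h} r0 = integral {x..x + h} r"
      using h x by (intro integral_cong) (auto simp: r0_def)
    also have "\<dots> = 0"
    proof -
      have "primitive_on 0 L (\<lambda>x. integral {0..x} r) r"
        using r x by (intro primitive_on_indefinite_integral) auto
      from primitive_onD(4)[OF this, of x "x + h"] show ?thesis
        using x h zero[of x] zero[of "x + h"] by simp
    qed
    finally show False using d(2)[of h] h x by (simp add: r0_def)
  qed
  have "negligible (N \<union> {L})" using N by (intro negligible_Un) auto
  then have "AE x in lebesgue. x \<notin> N \<union> {L}"
    by (intro AE_not_in) (simp add: negligible_iff_null_sets)
  then have "AE x in lebesgue. x \<in> {0..L} \<longrightarrow> r x = 0"
    by eventually_elim (use z in blast)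
  then show ?thesis by (simp add: AE_restrict_space_iff)
qed

text \<open>
  Testing with sines and cosines gives \<open>g\<close> the Fourier coefficients that \<open>f'\<close> should have. Hence
  \<open>f\<close> and the primitive \<open>G\<close> of \<open>g\<close> have the same Fourier coefficients, except perhaps at
  frequency \<open>0\<close>. After subtraction of the mean, all coefficients of the difference \<open>r\<close> vanish; the
  primitive \<open>R\<close> of \<open>r\<close> is then the sum of its Fourier series, hence constant, and so
  \<open>r = 0\<close> almost everywhere.
\<close>

lemma weak_primitive_scalar:
  fixes f g :: "real \<Rightarrow> complex"
  assumes L: "L > 0" and f: "sq_integrable (lebesgue_on {0..L}) f"
    and g: "sq_integrable (lebesgue_on {0..L}) g"
    and weak: "\<And>\<phi>. \<phi> \<in> smooth_per L \<Longrightarrow>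
      (LINT x|lebesgue_on {0..L}. deriv \<phi> x *\<^sub>R f x) = - (LINT x|lebesgue_on {0..L}. \<phi> x *\<^sub>R g x)"
  obtains h where "primitive_on 0 L h g" "h L = h 0" "AE x in lebesgue_on {0..L}. f x = h x"
proof -
  let ?M = "lebesgue_on {0..L}"
  have gi: "g absolutely_integrable_on {0..L}"
    using sq_integrable_imp_integrable[OF g] by (simp add: integrable_lebesgue_on_iff)
  have weak_fcoef: "fcoef L g (freq L 0 k) = \<i> * freq L 0 k * fcoef L f (freq L 0 k)" for k
  proof -
    define p where "p = freq L 0 k"
    have D: "deriv (\<lambda>x. a * cos (p * x) + b * sin (p * x)) x
        = (b * p) * cos (p * x) + (- a * p) * sin (p * x)" for a b x
      by (rule DERIV_imp_deriv) (auto intro!: derivative_eq_intros)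
    have sqc: "sq_integrable ?M (\<lambda>x. of_real (cos (p * x)) :: complex)"
        "sq_integrable ?M (\<lambda>x. of_real (sin (p * x)) :: complex)"
      by (rule sq_integrable_continuous, intro continuous_intros)+
    note int = sq_integrable_mult[OF sqc(1) f] sq_integrable_mult[OF sqc(2) f]
      sq_integrable_mult[OF sqc(1) g] sq_integrable_mult[OF sqc(2) g]
    have 1: "- p * (LINT x|?M. of_real (sin (p * x)) * f x) = - (LINT x|?M. of_real (cos (p * x)) * g x)"
      using weak[OF smooth_per_trig[OF L, of 1 k 0]] unfolding p_def[symmetric] D
      by (simp add: scaleR_conv_of_real mult.assoc)
    have 2: "p * (LINT x|?M. of_real (cos (p * x)) * f x) = - (LINT x|?M. of_real (sin (p * x)) * g x)"
      using weak[OF smooth_per_trig[OF L, of 0 k 1]] unfolding p_def[symmetric] D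
      by (simp add: scaleR_conv_of_real mult.assoc)
    have cs: "u x * cis (- (p * x))
        = of_real (cos (p * x)) * u x - \<i> * (of_real (sin (p * x)) * u x)" for u :: "real \<Rightarrow> complex"
            and x
      by (simp add: complex_eq_iff)
    show ?thesis
      unfolding fcoef_def p_def[symmetric] cs using int 1 2
      by (simp add: algebra_simps)
  qed
  define G where "G x = integral {0..x} g" for x
  have G: "primitive_on 0 L G g"
    unfolding G_def[abs_def] using L gi by (intro primitive_on_indefinite_integral) auto
  have G0: "G 0 = 0" by (simp add: G_def)
  have GL: "G L = 0"
  proof -
    have "G L - G 0 = fcoef L g (freq L 0 0)"
      using primitive_on_integral[OF G] by (simp add: fcoef_def freq_def)
    also have "\<dots> = 0" unfolding weak_fcoef by (simp add: freq_def)
    finally show ?thesis using G0 by simp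
  qed
  have p0: "freq L 0 k \<noteq> 0" if "k \<noteq> 0" for k using that L by (simp add: freq_def)
  have sG: "sq_integrable ?M G" by (intro sq_integrable_continuous primitive_on_continuous[OF G])
  have fG: "fcoef L f (freq L 0 k) = fcoef L G (freq L 0 k)" if "k \<noteq> 0" for k
    using fcoef_deriv_freq[OF G L, of 0 k] weak_fcoef[of k] p0[OF that] G0 GL by simp
  define c where "c = (LINT x|?M. f x - G x) / L"
  \<comment> \<open>Subtracting the mean removes the remaining coefficient, that at frequency \<open>0\<close>.\<close>
  define r where "r x = f x - G x - c" for x
  have fG_sq: "sq_integrable ?M (\<lambda>x. f x - G x)"
    using sq_integrable_add[OF f sq_integrable_cmult[OF sG, of "- 1"]] by simp
  have r_sq: "sq_integrable ?M r"
    unfolding r_def using sq_integrable_add[OF fG_sq sq_integrable_continuous[of 0 L "\<lambda>_. - c"]] by simp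
  have rz: "fcoef L r (freq L 0 k) = 0" for k
  proof -
    have "fcoef L r (freq L 0 k) = fcoef L f (freq L 0 k) - fcoef L G (freq L 0 k)
        - c * (LINT x|?M. cis (freq L 0 0 * x) * cis (- (freq L 0 k * x)))"
      unfolding fcoef_def r_def left_diff_distrib
      using sq_integrable_mult[OF f sq_integrable_cis_minus[of L "freq L 0 k"]]
        sq_integrable_mult[OF sG sq_integrable_cis_minus[of L "freq L 0 k"]]
        sq_integrable_imp_integrable[OF sq_integrable_cis_minus[of L "freq L 0 k"]]
      by (simp add: freq_def)
    also have "\<dots> = 0"
    proof (cases "k = 0")
      case True
      have "c * L = (LINT x|?M. f x) - (LINT x|?M. G x)"
        using L sq_integrable_imp_integrable[OF f] sq_integrable_imp_integrable[OF sG]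
        by (simp add: c_def)
      then show ?thesis
        unfolding True cis_freq_orthogonal[OF L] by (simp add: fcoef_def freq_def)
    next
      case False
      then show ?thesis unfolding cis_freq_orthogonal[OF L] by (simp add: fG)
    qed
    finally show ?thesis .
  qed
  have ri: "r absolutely_integrable_on {0..L}"
    using sq_integrable_imp_integrable[OF r_sq] by (simp add: integrable_lebesgue_on_iff)
  define R where "R x = integral {0..x} r" for x
  have R: "primitive_on 0 L R r"
    unfolding R_def[abs_def] using L ri by (intro primitive_on_indefinite_integral) auto
  have R0: "R 0 = 0" by (simp add: R_def)
  have RL: "R L = 0"
    using primitive_on_integral[OF R] rz[of 0] R0 by (simp add: fcoef_def freq_def)
  have Rz: "fcoef L R (freq L 0 k) = 0" if "k \<noteq> 0" for k
    using fcoef_deriv_freq[OF R L, of 0 k] rz[of k] p0[OF that] R0 RL by simp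
  let ?S = "\<lambda>x m. \<Sum>k\<in>{- int m..<int m}. fcoef L R (freq L 0 k) / L * cis (freq L 0 k * x)"
  have const: "R x = fcoef L R 0 / L" if "x \<in> {0..L}" for x
  proof (rule LIMSEQ_unique)
    show "?S x \<longlonglongrightarrow> R x"
      using that R0 RL by (intro fourier_pointwise[OF R L r_sq]) auto
    have "?S x m = fcoef L R 0 / L" if "m > 0" for m
    proof -
      have "?S x m
          = (\<Sum>k\<in>{0}. fcoef L R (freq L 0 k) / L * cis (freq L 0 k * x))"
        using that Rz by (intro sum.mono_neutral_right) auto
      then show ?thesis by (simp add: freq_def)
    qed
    then have "eventually (\<lambda>m. ?S x m = fcoef L R 0 / L) sequentially"
      by (intro eventually_sequentiallyI[of 1]) auto
    then show "?S x \<longlonglongrightarrow> fcoef L R 0 / L"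
      by (rule tendsto_eventually)
  qed
  have "AE x in ?M. r x = 0"
  proof (rule integral_zero_imp_AE_zero[OF ri])
    fix x assume "x \<in> {0..L}"
    then have "R x = R 0" using const[of x] const[of 0] L by simp
    then show "integral {0..x} r = 0" by (simp add: R_def)
  qed
  then have ae: "AE x in ?M. f x = G x + c"
    by eventually_elim (simp add: r_def algebra_simps)
  have "primitive_on 0 L (\<lambda>x. G x + c) (\<lambda>x. g x + 0)"
    using L by (intro primitive_on_add G primitive_on_const) simp
  then show ?thesis
    using that[of "\<lambda>x. G x + c"] ae G0 GL by simp
qed


section \<open>A sharp pointwise bound by the kinetic energy\<close>

text \<open>
  The difference of the squares of the two sides is \<open>(cos \<theta> cosh t - 1)\<^sup>2\<close>. Equality for
  \<open>cos \<theta> cosh t = 1\<close> is the reason for the factor \<open>1 / \<bar>sin\<bar>\<close> in the first constant.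
\<close>

lemma sinh_abs_sin_le:
  fixes t \<theta> :: real
  shows "sinh t * \<bar>sin \<theta>\<bar> \<le> cosh t - cos \<theta>"
proof (rule power2_le_imp_le)
  have "(cosh t - cos \<theta>)\<^sup>2 - (sinh t * \<bar>sin \<theta>\<bar>)\<^sup>2
      = (cosh t - cos \<theta>)\<^sup>2 - (cosh t ^ 2 - 1) * (1 - (cos \<theta>)\<^sup>2)"
    by (simp add: power_mult_distrib sinh_square_eq sin_squared_eq)
  also have "\<dots> = (cos \<theta> * cosh t - 1)\<^sup>2"
    by (simp add: power2_eq_square algebra_simps)
  finally show "(sinh t * \<bar>sin \<theta>\<bar>)\<^sup>2 \<le> (cosh t - cos \<theta>)\<^sup>2"
    by (smt (verit) zero_le_power2)
  show "0 \<le> cosh t - cos \<theta>"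
    using cosh_real_ge_1[of t] cos_le_one[of \<theta>] by linarith
qed

lemma k_const_bound:
  assumes "\<alpha> \<notin> \<int>" "t > 0"
  shows "k_const \<alpha> > 0" "sinh t \<le> k_const \<alpha> * (cosh t - cos (2 * pi * \<alpha>))"
proof -
  define f where "f = frac \<alpha>"
  have f: "0 < f" "f < 1"
    using assms(1) frac_lt_1[of \<alpha>] by (auto simp: f_def frac_gt_0_iff)
  have \<alpha>: "2 * pi * \<alpha> = 2 * pi * f + 2 * pi * of_int \<lfloor>\<alpha>\<rfloor>"
    by (simp add: f_def frac_def algebra_simps)
  have sin: "sin (2 * pi * \<alpha>) = sin (2 * pi * f)" and cos: "cos (2 * pi * \<alpha>) = cos (2 * pi * f)"
    unfolding \<alpha> by (simp_all add: sin_add cos_add)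
  have "k_const \<alpha> > 0 \<and> sinh t \<le> k_const \<alpha> * (cosh t - cos (2 * pi * \<alpha>))"
  proof (cases "1/4 \<le> f \<and> f \<le> 3/4")
    case True
    have "0 \<le> cos (2 * pi * f - pi)"
      using True by (intro cos_ge_zero) (auto simp: field_simps)
    then have "cos (2 * pi * f) \<le> 0" by (simp add: cos_diff)
    moreover have "sinh t \<le> cosh t" by (simp add: sinh_def cosh_def field_simps)
    moreover have "k_const \<alpha> = 1" using True by (simp add: k_const_def f_def)
    ultimately show ?thesis by (simp add: cos)
  next
    case False
    have nz: "sin (2 * pi * f) \<noteq> 0"
    proof (cases "f < 1/4")
      case True
      then have "sin (2 * pi * f) > 0" using f by (intro sin_gt_zero) (auto simp: field_simps)
      then show ?thesis by simp
    next
      case False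
      with \<open>\<not> (1/4 \<le> f \<and> f \<le> 3/4)\<close> have "sin (2 * pi * f) < 0"
        using f by (intro sin_lt_zero) (auto simp: field_simps)
      then show ?thesis by simp
    qed
    have k: "k_const \<alpha> = 1 / \<bar>sin (2 * pi * f)\<bar>"
      using False by (auto simp: k_const_def f_def[symmetric] sin)
    show ?thesis
      using sinh_abs_sin_le[of t "2 * pi * f"] nz unfolding k cos by (simp add: field_simps)
  qed
  then show "k_const \<alpha> > 0" "sinh t \<le> k_const \<alpha> * (cosh t - cos (2 * pi * \<alpha>))" by auto
qed

text \<open>
  The function \<open>g\<close> solves \<open>g'' = b\<^sup>2 g\<close>, the Euler equation of the energy
  \<open>\<integral> \<bar>u'\<bar>\<^sup>2 + b\<^sup>2 \<bar>u\<bar>\<^sup>2\<close>. Therefore the energy of \<open>u\<close> exceeds a boundary term by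
  exactly the energy of \<open>u - g\<close>, which is nonnegative.
\<close>

lemma energy_ge_boundary:
  fixes u D g g' :: "real \<Rightarrow> complex"
  assumes u: "primitive_on s t u D"
    and E: "(\<lambda>x. (norm (D x))\<^sup>2 + b\<^sup>2 * (norm (u x))\<^sup>2) integrable_on {s..t}"
    and g: "\<And>x. (g has_vector_derivative g' x) (at x)"
    and g': "\<And>x. (g' has_vector_derivative of_real (b\<^sup>2) * g x) (at x)"
  shows "Re ((2 * u t - g t) * cnj (g' t)) - Re ((2 * u s - g s) * cnj (g' s))
      \<le> integral {s..t} (\<lambda>x. (norm (D x))\<^sup>2 + b\<^sup>2 * (norm (u x))\<^sup>2)"
proof -
  let ?\<Phi> = "\<lambda>x. Re ((2 * D x + - 1 * g' x) * cnj (g' x)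
      + (2 * u x + - 1 * g x) * cnj (of_real (b\<^sup>2) * g x))"
  let ?\<beta> = "Re ((2 * u t + - 1 * g t) * cnj (g' t) - (2 * u s + - 1 * g s) * cnj (g' s))"
  have st: "s \<le> t" by (rule primitive_on_le[OF u])
  have cont: "continuous_on {s..t} g" "continuous_on {s..t} g'"
    using g g' by (meson continuous_at_imp_continuous_on has_vector_derivative_continuous)+
  have pg: "primitive_on s t g g'"
    by (rule primitive_on_C1[OF st g cont(2)])
  have pg': "primitive_on s t (\<lambda>x. cnj (g' x)) (\<lambda>x. cnj (of_real (b\<^sup>2) * g x))"
    by (rule primitive_on_C1[OF st]) (intro has_vector_derivative_cnj g' continuous_intros cont)+
  have "primitive_on s t (\<lambda>x. (2 * u x + - 1 * g x) * cnj (g' x))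
     (\<lambda>x. (2 * D x + - 1 * g' x) * cnj (g' x) + (2 * u x + - 1 * g x) * cnj (of_real (b\<^sup>2) * g x))"
    by (intro primitive_on_mult primitive_on_add primitive_on_cmult u pg pg')
  from primitive_on_has_integral[OF this st order_refl]
  have "(?\<Phi>
     has_integral ?\<beta>) {s..t}"
    by (rule has_integral_Re)
  then have "?\<beta>
     \<le> integral {s..t} (\<lambda>x. (norm (D x))\<^sup>2 + b\<^sup>2 * (norm (u x))\<^sup>2)"
  proof (rule has_integral_le[OF _ integrable_integral[OF E]])
    fix x
    have "(norm (D x - g' x))\<^sup>2 + b\<^sup>2 * (norm (u x - g x))\<^sup>2 =
      (norm (D x))\<^sup>2 + b\<^sup>2 * (norm (u x))\<^sup>2
       - ?\<Phi> x"
      by (simp add: cmod_power2) (simp add: power2_eq_square algebra_simps)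
    then show "?\<Phi> x
      \<le> (norm (D x))\<^sup>2 + b\<^sup>2 * (norm (u x))\<^sup>2"
      by (smt (verit) zero_le_power2 mult_nonneg_nonneg)
  qed
  then show ?thesis by simp
qed

lemma has_vector_derivative_sinh_cosh:
  fixes c :: complex
  shows "((\<lambda>y. c * of_real (sinh (b * y + d)))
      has_vector_derivative c * of_real (b * cosh (b * y + d))) (at y)"
    and "((\<lambda>y. c * of_real (b * cosh (b * y + d)))
        has_vector_derivative of_real (b\<^sup>2) * (c * of_real (sinh (b * y + d)))) (at y)"
proof -
  have "((\<lambda>y. sinh (b * y + d)) has_real_derivative b * cosh (b * y + d)) (at y)"
    "((\<lambda>y. b * cosh (b * y + d)) has_real_derivative b\<^sup>2 * sinh (b * y + d)) (at y)"
    by (auto intro!: derivative_eq_intros simp: power2_eq_square)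
  from this[THEN has_vector_derivative_of_real, THEN has_vector_derivative_mult_right[where a = c]] show
    "((\<lambda>y. c * of_real (sinh (b * y + d)))
        has_vector_derivative c * of_real (b * cosh (b * y + d))) (at y)"
    "((\<lambda>y. c * of_real (b * cosh (b * y + d)))
        has_vector_derivative of_real (b\<^sup>2) * (c * of_real (sinh (b * y + d)))) (at y)"
    by (simp_all add: mult.left_commute)
qed

text \<open>
  The minimal energy at a given value \<open>u x0\<close> is that of the quasi-periodic Green function with pole at
  \<open>x0\<close>, scaled to this value: \<open>g0\<close> on \<open>[0, x0]\<close> and \<open>g1\<close> on \<open>[x0, L]\<close>. In the
  sum of the two inequalities \<open>energy_ge_boundary\<close> the terms at \<open>0\<close> and \<open>L\<close> cancel by
  quasi-periodicity, and those at \<open>x0\<close> leave the jump of the derivative.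
\<close>

lemma pointwise_energy_bound:
  assumes u: "primitive_on 0 L u D" and L: "L > 0" and D: "sq_integrable (lebesgue_on {0..L}) D"
    and per: "u L = cis \<theta> * u 0" and x0: "x0 \<in> {0..L}" and b: "b > 0"
  shows "(norm (u x0))\<^sup>2 * (2 * b * (cosh (b * L) - cos \<theta>))
    \<le> sinh (b * L) * ((LINT x|lebesgue_on {0..L}. (norm (D x))\<^sup>2)
        + b\<^sup>2 * (LINT x|lebesgue_on {0..L}. (norm (u x))\<^sup>2))"
proof -
  let ?M = "lebesgue_on {0..L}"
  define S where "S = sinh (b * L)"
  have S: "S > 0" using b L by (simp add: S_def)
  define E where "E x = (norm (D x))\<^sup>2 + b\<^sup>2 * (norm (u x))\<^sup>2" for x
  have su: "sq_integrable ?M u"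
    by (intro sq_integrable_continuous primitive_on_continuous[OF u])
  have Ei: "integrable ?M E"
    unfolding E_def using sq_integrable_integrable[OF D] sq_integrable_integrable[OF su] by simp
  have E: "E integrable_on {0..L}" by (intro integrable_on_lebesgue_on[OF Ei]) simp
  have E1: "E integrable_on {0..x0}" "E integrable_on {x0..L}"
    using x0 by (auto intro: integrable_on_subinterval[OF E])
  define p where "p = u x0"
  define g0 g0' g1 g1' where
    "g0 y = - (p * cis (- \<theta>) / S) * of_real (sinh (b * y + - (b * x0)))
        + p / S * of_real (sinh (b * y + b * (L - x0)))" and
    "g0' y = - (p * cis (- \<theta>) / S) * of_real (b * cosh (b * y + - (b * x0)))
        + p / S * of_real (b * cosh (b * y + b * (L - x0)))" and
    "g1 y = - (p / S) * of_real (sinh (b * y + - (b * (x0 + L))))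
        + p * cis \<theta> / S * of_real (sinh (b * y + - (b * x0)))" and
    "g1' y = - (p / S) * of_real (b * cosh (b * y + - (b * (x0 + L))))
        + p * cis \<theta> / S * of_real (b * cosh (b * y + - (b * x0)))" for y
  note vd = has_vector_derivative_sinh_cosh
  have d: "(g0 has_vector_derivative g0' x) (at x)" "(g1 has_vector_derivative g1' x) (at x)"
    "(g0' has_vector_derivative of_real (b\<^sup>2) * g0 x) (at x)"
        "(g1' has_vector_derivative of_real (b\<^sup>2) * g1 x) (at x)" for x
    unfolding g0_def g0'_def g1_def g1'_def distrib_left
    by (intro has_vector_derivative_add vd)+
  have 1: "Re ((2 * u x0 - g0 x0) * cnj (g0' x0)) - Re ((2 * u 0 - g0 0) * cnj (g0' 0))
      \<le> integral {0..x0} E"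
    unfolding E_def using x0 E1(1)
    by (intro energy_ge_boundary primitive_on_subinterval[OF u] d) (auto simp: E_def[abs_def])
  have 2: "Re ((2 * u L - g1 L) * cnj (g1' L)) - Re ((2 * u x0 - g1 x0) * cnj (g1' x0))
      \<le> integral {x0..L} E"
    unfolding E_def using x0 E1(2)
    by (intro energy_ge_boundary primitive_on_subinterval[OF u] d) (auto simp: E_def[abs_def])
  have cc: "cis \<theta> * cis (- \<theta>) = 1" by (simp add: cis_mult)
  have odd: "sinh (b * L + - (b * (x0 + L))) = - sinh (b * x0)"
      "cosh (b * L + - (b * (x0 + L))) = cosh (b * x0)"
    "sinh (b * x0 + - (b * (x0 + L))) = - S" "cosh (b * x0 + - (b * (x0 + L))) = cosh (b * L)"
    using sinh_minus[of "b * x0"] cosh_minus[of "b * x0"] sinh_minus[of "b * L"] cosh_minus[of "b * L"]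
    by (simp_all add: S_def distrib_left)
  have bL: "b * x0 + b * (L - x0) = b * L"
      "b * L + - (b * x0) = b * 0 + b * (L - x0)" by (simp_all add: algebra_simps)
  have w: "cis (- \<theta>) = 1 / cis \<theta>" "cis \<theta> \<noteq> 0"
    by (simp_all add: cis_divide[symmetric] divide_inverse)
  have S0: "complex_of_real S \<noteq> 0" using S by simp
  have e0: "g0 x0 = p" "g1 x0 = p"
    unfolding g0_def g1_def odd bL using S0 by (simp_all add: S_def[symmetric])
  have e1: "g1 L = cis \<theta> * g0 0" "g1' L = cis \<theta> * g0' 0"
    unfolding g0_def g1_def g0'_def g1'_def odd bL w(1) using S0 w(2)
    by (simp_all add: distrib_left right_diff_distrib)
  have "(2 * u L - g1 L) * cnj (g1' L) = (cis \<theta> * cnj (cis \<theta>)) * ((2 * u 0 - g0 0) * cnj (g0' 0))"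
    unfolding e1 per by (simp add: algebra_simps)
  then have bdry: "(2 * u L - g1 L) * cnj (g1' L) = (2 * u 0 - g0 0) * cnj (g0' 0)"
    using cc by (simp add: cis_cnj)
  have j0: "Re ((2 * u x0 - g0 x0) * cnj (g0' x0)) = (norm p)\<^sup>2 * (b / S * (cosh (b * L) - cos \<theta>))"
  proof -
    have "g0' x0 = p * (of_real (b / S) * (of_real (cosh (b * L)) - cis (- \<theta>)))"
      unfolding g0'_def bL w(1) using S0 w(2) by (simp add: algebra_simps diff_divide_distrib)
    then have "(2 * u x0 - g0 x0) * cnj (g0' x0)
        = of_real ((norm p)\<^sup>2) * cnj (of_real (b / S) * (of_real (cosh (b * L)) - cis (- \<theta>)))"
      unfolding e0 complex_norm_square by (simp add: p_def[symmetric] mult_ac)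
    then show ?thesis by (simp del: of_real_power)
  qed
  have j1: "Re ((2 * u x0 - g1 x0) * cnj (g1' x0)) = (norm p)\<^sup>2 * (b / S * (cos \<theta> - cosh (b * L)))"
  proof -
    have "g1' x0 = p * (of_real (b / S) * (cis \<theta> - of_real (cosh (b * L))))"
      unfolding g1'_def odd using S0 by (simp add: algebra_simps diff_divide_distrib)
    then have "(2 * u x0 - g1 x0) * cnj (g1' x0)
        = of_real ((norm p)\<^sup>2) * cnj (of_real (b / S) * (cis \<theta> - of_real (cosh (b * L))))"
      unfolding e0 complex_norm_square by (simp add: p_def[symmetric] mult_ac)
    then show ?thesis by (simp del: of_real_power)
  qed
  have "2 * ((norm p)\<^sup>2 * (b / S * (cosh (b * L) - cos \<theta>))) \<le> integral {0..x0} E + integral {x0..L} E"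
    using 1 2 unfolding bdry j0 j1 by (simp add: right_diff_distrib)
  also have "\<dots> = integral {0..L} E"
    using x0 E by (intro Henstock_Kurzweil_Integration.integral_combine) auto
  also have "\<dots> = (LINT x|?M. E x)"
    by (intro lebesgue_integral_eq_integral[symmetric] Ei) simp
  also have "\<dots> = (LINT x|?M. (norm (D x))\<^sup>2) + b\<^sup>2 * (LINT x|?M. (norm (u x))\<^sup>2)"
    unfolding E_def using sq_integrable_integrable[OF D] sq_integrable_integrable[OF su] by simp
  finally show ?thesis
    using S unfolding p_def S_def[symmetric] by (simp add: field_simps)
qed


section \<open>The first constant\<close>

lemma gram_expansion:
  fixes F :: "nat \<Rightarrow> real \<Rightarrow> complex ^ 'm"
  assumes F: "\<And>n j. n \<in> I \<Longrightarrow> sq_integrable M (\<lambda>x. F n x $ j)"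
  shows "of_real (\<Sum>j\<in>UNIV. LINT x|M. (norm (\<Sum>n\<in>I. \<xi> n * F n x $ j))\<^sup>2)
    = (\<Sum>n\<in>I. \<Sum>m\<in>I. \<xi> n * cnj (\<xi> m) * (LINT x|M. herm (F n x) (F m x)))"
proof -
  have int: "integrable M (\<lambda>x. F n x $ j * cnj (F m x $ j))" if "n \<in> I" "m \<in> I" for n m j
    by (intro sq_integrable_mult sq_integrable_cnj F that)
  have "of_real (\<Sum>j\<in>UNIV. LINT x|M. (norm (\<Sum>n\<in>I. \<xi> n * F n x $ j))\<^sup>2)
     = (\<Sum>j\<in>UNIV. LINT x|M. (\<Sum>n\<in>I. \<Sum>m\<in>I. \<xi> n * cnj (\<xi> m) * (F n x $ j * cnj (F m x $ j))))"
    unfolding of_real_sum integral_complex_of_real[symmetric] complex_norm_square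
    by (simp add: sum_product mult_ac)
  also have "\<dots> = (\<Sum>j\<in>UNIV. \<Sum>n\<in>I. \<Sum>m\<in>I. \<xi> n * cnj (\<xi> m) * (LINT x|M. F n x $ j * cnj (F m x $ j)))"
    using int by (intro sum.cong refl) simp
  also have "\<dots> = (\<Sum>n\<in>I. \<Sum>m\<in>I. \<Sum>j\<in>UNIV. \<xi> n * cnj (\<xi> m) * (LINT x|M. F n x $ j * cnj (F m x $ j)))"
    by (simp only: sum.swap[of _ _ UNIV])
  also have "\<dots> = (\<Sum>n\<in>I. \<Sum>m\<in>I. \<xi> n * cnj (\<xi> m) * (LINT x|M. herm (F n x) (F m x)))"
    using int by (intro sum.cong refl) (simp add: herm_def sum_distrib_left)
  finally show ?thesis .
qed

lemma norm_vec_square: "(norm (v :: complex ^ 'm))\<^sup>2 = (\<Sum>j\<in>UNIV. (norm (v $ j))\<^sup>2)"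
  by (simp add: norm_vec_def L2_set_def sum_nonneg)

lemma trace_density_cube_nonneg:
  "0 \<le> trace_cube N \<psi> x"
  unfolding trace_density_cube by (simp add: sum_nonneg)

text \<open>
  The situation after the gauge transformation: \<open>W n\<close> is the derivative of \<open>V n\<close>, and the magnetic
  field is present only through the phase in the boundary condition.
\<close>

locale quasi_periodic_system =
  fixes L \<alpha> :: real and N :: nat and V W :: "nat \<Rightarrow> real \<Rightarrow> complex ^ 'm"
  assumes L: "L > 0"
    and prim: "\<And>n j. n \<in> {1..N} \<Longrightarrow> primitive_on 0 L (\<lambda>x. V n x $ j) (\<lambda>x. W n x $ j)"
    and sqW: "\<And>n j. n \<in> {1..N} \<Longrightarrow> sq_integrable (lebesgue_on {0..L}) (\<lambda>x. W n x $ j)"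
    and per: "\<And>n. n \<in> {1..N} \<Longrightarrow> V n L = cis (2 * pi * \<alpha>) *s V n 0"
    and ortho: "\<And>n m. n \<in> {1..N} \<Longrightarrow> m \<in> {1..N} \<Longrightarrow>
      (LINT x|lebesgue_on {0..L}. herm (V n x) (V m x)) = (if n = m then 1 else 0)"
begin

abbreviation "M \<equiv> lebesgue_on {0..L}"

definition "energy = (\<Sum>n=1..N. \<Sum>j\<in>UNIV. LINT x|M. (norm (W n x $ j))\<^sup>2)"

abbreviation (input) "cube \<equiv> trace_cube N V"

lemma sqV: "n \<in> {1..N} \<Longrightarrow> sq_integrable M (\<lambda>x. V n x $ j)"
  by (intro sq_integrable_continuous primitive_on_continuous[OF prim])

lemma integrable_herm_V:
  "n \<in> {1..N} \<Longrightarrow> m \<in> {1..N} \<Longrightarrow> integrable M (\<lambda>x. herm (V n x) (V m x))"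
  unfolding herm_def
  by (intro Bochner_Integration.integrable_sum sq_integrable_mult sq_integrable_cnj sqV)

definition "energy_form \<xi> = (\<Sum>j\<in>UNIV. LINT x|M. (norm (\<Sum>n=1..N. \<xi> n * W n x $ j))\<^sup>2)"

definition "energy_gram n m = (LINT x|M. herm (W n x) (W m x))"

lemma energy_form_gram: "of_real (energy_form \<xi>) = (\<Sum>n=1..N. \<Sum>m=1..N. \<xi> n * cnj (\<xi> m) * energy_gram n m)"
  unfolding energy_form_def energy_gram_def by (rule gram_expansion[OF sqW])

lemma energy_eq_gram_trace: "of_real energy = (\<Sum>n=1..N. energy_gram n n)"
proof -
  have "of_real (LINT x|M. (norm (W n x $ j))\<^sup>2) = (LINT x|M. W n x $ j * cnj (W n x $ j))" for n j
    unfolding integral_complex_of_real[symmetric] complex_norm_square ..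
  moreover have "integrable M (\<lambda>x. W n x $ j * cnj (W n x $ j))" if "n \<in> {1..N}" for n j
    by (intro sq_integrable_mult sq_integrable_cnj sqW that)
  ultimately show ?thesis
    unfolding energy_def energy_gram_def herm_def by (simp del: of_real_power)
qed

lemma mass_form: "(\<Sum>j\<in>UNIV. LINT x|M. (norm (\<Sum>n=1..N. \<xi> n * V n x $ j))\<^sup>2) = (\<Sum>n=1..N. (norm (\<xi> n))\<^sup>2)"
proof -
  have "complex_of_real (\<Sum>j\<in>UNIV. LINT x|M. (norm (\<Sum>n=1..N. \<xi> n * V n x $ j))\<^sup>2)
     = (\<Sum>n=1..N. \<Sum>m=1..N. \<xi> n * cnj (\<xi> m) * (if n = m then 1 else 0))"
    by (subst gram_expansion[OF sqV]) (auto simp: ortho intro!: sum.cong)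
  also have "\<dots> = (\<Sum>n=1..N. \<xi> n * cnj (\<xi> n))"
    by (intro sum.cong refl) (simp add: if_distrib cong: if_cong)
  also have "\<dots> = of_real (\<Sum>n=1..N. (norm (\<xi> n))\<^sup>2)"
    by (simp add: complex_norm_square del: of_real_power)
  finally show ?thesis unfolding of_real_eq_iff .
qed

text \<open>
  The pointwise bound for the components of \<open>\<Sum> \<xi>\<^sub>n V\<^sub>n\<close>, added up; orthonormality of the
  \<open>V\<^sub>n\<close> turns the squared norm of this combination into \<open>\<Sum> \<bar>\<xi>\<^sub>n\<bar>\<^sup>2\<close>.
\<close>

lemma combination_bound:
  assumes \<alpha>: "\<alpha> \<notin> \<int>" and x: "x \<in> {0..L}" and b: "b > 0"
  shows "2 * b * (norm (\<Sum>n=1..N. \<xi> n *s V n x))\<^sup>2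
    \<le> k_const \<alpha> * (energy_form \<xi> + b\<^sup>2 * (\<Sum>n=1..N. (norm (\<xi> n))\<^sup>2))"
proof -
  define u D where "u j y = (\<Sum>n=1..N. \<xi> n * V n y $ j)" and "D j y = (\<Sum>n=1..N. \<xi> n * W n y $ j)" for j y
  define c where "c = cosh (b * L) - cos (2 * pi * \<alpha>)"
  have sinh: "sinh (b * L) > 0" using b L by simp
  have bL: "b * L > 0" using b L by simp
  note k = k_const_bound[OF \<alpha> bL]
  have c: "c > 0"
    using sinh k zero_less_mult_pos[of "k_const \<alpha>" c] unfolding c_def by linarith
  have "2 * b * (norm (u j x))\<^sup>2
      \<le> k_const \<alpha> * ((LINT x|M. (norm (D j x))\<^sup>2) + b\<^sup>2 * (LINT x|M. (norm (u j x))\<^sup>2))"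
    (is "_ \<le> _ * ?E") for j
  proof -
    have "primitive_on 0 L (u j) (D j)"
      unfolding u_def[abs_def] D_def[abs_def] using L
      by (intro primitive_on_sum primitive_on_cmult prim) auto
    moreover have "sq_integrable M (D j)"
      unfolding D_def[abs_def] by (intro sq_integrable_sum sq_integrable_cmult sqW)
    moreover have "u j L = cis (2 * pi * \<alpha>) * u j 0"
      unfolding u_def sum_distrib_left by (intro sum.cong refl) (simp add: per mult_ac)
    ultimately have "(norm (u j x))\<^sup>2 * (2 * b * c) \<le> sinh (b * L) * ?E"
      unfolding c_def using L x b by (intro pointwise_energy_bound)
    also have "\<dots> \<le> k_const \<alpha> * c * ?E"
      using k(2) by (intro mult_right_mono) (auto simp: c_def intro!: add_nonneg_nonneg
          integral_nonneg_AE)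
    finally have "c * (2 * b * (norm (u j x))\<^sup>2) \<le> c * (k_const \<alpha> * ?E)"
      by (simp add: mult_ac)
    then show ?thesis using c by (simp only: mult_le_cancel_left_pos)
  qed
  then have "(\<Sum>j\<in>UNIV. 2 * b * (norm (u j x))\<^sup>2) \<le>
      (\<Sum>j\<in>UNIV. k_const \<alpha> * ((LINT x|M. (norm (D j x))\<^sup>2) + b\<^sup>2 * (LINT x|M. (norm (u j x))\<^sup>2)))"
    by (intro sum_mono)
  also have "\<dots> = k_const \<alpha> * (energy_form \<xi> + b\<^sup>2 * (\<Sum>n=1..N. (norm (\<xi> n))\<^sup>2))"
    unfolding mass_form[symmetric] energy_form_def
    by (simp add: u_def D_def sum.distrib sum_distrib_left[symmetric])
  also have "(\<Sum>j\<in>UNIV. 2 * b * (norm (u j x))\<^sup>2) = 2 * b * (norm (\<Sum>n=1..N. \<xi> n *s V n x))\<^sup>2"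
    by (simp add: norm_vec_square u_def sum_distrib_left)
  finally show ?thesis .
qed

text \<open>
  For an eigenvector \<open>e\<close> the coefficients \<open>\<xi>\<^sub>n\<close> are those of \<open>U(x) e\<close>, and
  \<open>combination_bound\<close> becomes a bound for \<open>\<lambda>\<^sup>3\<close> by the energy of the combination. Summation over
  the basis with Parseval removes the eigenvectors.
\<close>

lemma cube_le_gram:
  assumes \<alpha>: "\<alpha> \<notin> \<int>" and x: "x \<in> {0..L}"
  shows "cube x \<le> K1 \<alpha> * Re (\<Sum>n=1..N. \<Sum>m=1..N. energy_gram n m * herm (V m x) (V n x))"
proof -
  obtain B :: "(complex ^ 'm) set" and lam where B: "finite B" "\<And>e. e \<in> B \<Longrightarrow> norm e = 1"
    and pars: "\<And>y z. (\<Sum>e\<in>B. herm y e * cnj (herm z e)) = 2 * herm y z"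
    and lam: "\<And>e. e \<in> B \<Longrightarrow> lam e = (\<Sum>n=1..N. (cmod (herm (V n x) e))\<^sup>2)"
    and eig: "\<And>e. e \<in> B \<Longrightarrow> (\<Sum>n=1..N. herm e (V n x) *s V n x) = lam e *\<^sub>R e"
    and tr: "cube x = (\<Sum>e\<in>B. lam e ^ 3) / 2"
    by (rule density_eigenbasis[where N = N and \<psi> = V and x = x]) (rule that)
  define \<xi> where "\<xi> e n = herm e (V n x)" for e n
  define k where "k = k_const \<alpha>"
  have k: "k > 0" unfolding k_def using k_const_bound(1)[OF \<alpha>, of 1] by simp
  have le: "lam e ^ 3 \<le> k\<^sup>2 * energy_form (\<xi> e)" if e: "e \<in> B" for e
  proof (cases "lam e = 0")
    case True
    then show ?thesis by (simp add: energy_form_def sum_nonneg integral_nonneg_AE)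
  next
    case False
    then have pos: "lam e > 0" using lam[OF e] by (simp add: sum_nonneg order_less_le)
    have mass: "(\<Sum>n=1..N. (norm (\<xi> e n))\<^sup>2) = lam e"
      unfolding lam[OF e] \<xi>_def by (subst cnj_herm[symmetric]) simp
    \<comment> \<open>For this \<open>b\<close> the mass term is half of the left-hand side.\<close>
    have "2 * (lam e / k) * (norm (\<Sum>n=1..N. \<xi> e n *s V n x))\<^sup>2
      \<le> k * (energy_form (\<xi> e) + (lam e / k)\<^sup>2 * (\<Sum>n=1..N. (norm (\<xi> e n))\<^sup>2))"
      unfolding k_def using pos k by (intro combination_bound \<alpha> x) (simp add: k_def)
    also have "norm (\<Sum>n=1..N. \<xi> e n *s V n x) = lam e"
      unfolding \<xi>_def eig[OF e] using B(2)[OF e] pos by simp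
    finally show ?thesis
      unfolding mass using k by (simp add: power2_eq_square power3_eq_cube field_simps)
  qed
  have "(\<Sum>e\<in>B. of_real (energy_form (\<xi> e)))
      = (\<Sum>e\<in>B. \<Sum>n=1..N. \<Sum>m=1..N. energy_gram n m * (herm (V m x) e * cnj (herm (V n x) e)))"
    unfolding energy_form_gram \<xi>_def by (simp add: cnj_herm mult_ac)
  also have "\<dots> = (\<Sum>n=1..N. \<Sum>m=1..N. \<Sum>e\<in>B. energy_gram n m * (herm (V m x) e * cnj (herm (V n x) e)))"
    by (simp only: sum.swap[of _ _ B])
  also have "\<dots> = 2 * (\<Sum>n=1..N. \<Sum>m=1..N. energy_gram n m * herm (V m x) (V n x))"
    by (simp add: sum_distrib_left[symmetric] pars) (simp add: sum_distrib_left mult_ac)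
  finally have "(\<Sum>e\<in>B. energy_form (\<xi> e))
      = Re (2 * (\<Sum>n=1..N. \<Sum>m=1..N. energy_gram n m * herm (V m x) (V n x)))"
    by (metis Re_complex_of_real of_real_sum)
  moreover have "(\<Sum>e\<in>B. lam e ^ 3) \<le> (\<Sum>e\<in>B. k\<^sup>2 * energy_form (\<xi> e))"
    by (intro sum_mono le)
  ultimately show ?thesis
    unfolding tr K1_def k_def[symmetric] by (simp add: sum_distrib_left[symmetric])
qed

theorem integral_cube_le_K1:
  assumes \<alpha>: "\<alpha> \<notin> \<int>"
  shows "(\<integral>\<^sup>+x. ennreal (cube x) \<partial>M) \<le> ennreal (K1 \<alpha> * energy)"
proof -
  define h where "h x = K1 \<alpha> * Re (\<Sum>n=1..N. \<Sum>m=1..N. energy_gram n m * herm (V m x) (V n x))" for x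
  have i: "integrable M (\<lambda>x. \<Sum>n=1..N. \<Sum>m=1..N. energy_gram n m * herm (V m x) (V n x))"
    by (intro Bochner_Integration.integrable_sum integrable_mult_right integrable_herm_V)
  have le: "cube x \<le> h x" if "x \<in> space M" for x
    using cube_le_gram[OF \<alpha>, of x] that by (simp add: h_def)
  have "(\<integral>\<^sup>+x. ennreal (cube x) \<partial>M) \<le> (\<integral>\<^sup>+x. ennreal (h x) \<partial>M)"
    by (intro nn_integral_mono ennreal_leI le)
  also have "\<dots> = ennreal (LINT x|M. h x)"
  proof (rule nn_integral_eq_integral)
    show "integrable M h" unfolding h_def[abs_def] using i by (intro integrable_mult_right integrable_Re)
    show "AE x in M. 0 \<le> h x" by (intro AE_I2 order_trans[OF trace_density_cube_nonneg le])
  qed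
  also have "(LINT x|M. h x) = K1 \<alpha>
      * Re (\<Sum>n=1..N. \<Sum>m=1..N. energy_gram n m * (LINT x|M. herm (V m x) (V n x)))"
  proof -
    have "(LINT x|M. (\<Sum>n=1..N. \<Sum>m=1..N. energy_gram n m * herm (V m x) (V n x)))
        = (\<Sum>n=1..N. LINT x|M. (\<Sum>m=1..N. energy_gram n m * herm (V m x) (V n x)))"
      by (intro Bochner_Integration.integral_sum Bochner_Integration.integrable_sum
          integrable_mult_right integrable_herm_V)
    also have "\<dots> = (\<Sum>n=1..N. \<Sum>m=1..N. LINT x|M. energy_gram n m * herm (V m x) (V n x))"
      by (intro sum.cong refl Bochner_Integration.integral_sum integrable_mult_right integrable_herm_V)
    finally show ?thesis
      unfolding h_def integral_mult_right_zero integral_Re[OF i] by simp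
  qed
  also have "(\<Sum>n=1..N. \<Sum>m=1..N. energy_gram n m * (LINT x|M. herm (V m x) (V n x)))
      = (\<Sum>n=1..N. energy_gram n n)"
  proof (intro sum.cong refl)
    fix n assume n: "n \<in> {1..N}"
    have "(\<Sum>m=1..N. energy_gram n m * (LINT x|M. herm (V m x) (V n x)))
        = (\<Sum>m=1..N. if m = n then energy_gram n m else 0)"
      using n by (intro sum.cong refl) (simp add: ortho)
    then show "(\<Sum>m=1..N. energy_gram n m * (LINT x|M. herm (V m x) (V n x))) = energy_gram n n"
        using n by simp
  qed
  also have "\<dots> = of_real energy" by (rule energy_eq_gram_trace[symmetric])
  finally show ?thesis by simp
qed

end


section \<open>The lattice sum and the cubic cutoff\<close>

text \<open>
  The bound is uniform in \<open>t\<close>: each term except the first is at most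
  \<open>t / (s - 1) - t / s\<close> with \<open>s = j + c + t\<close>.
\<close>

lemma telescoping_bound:
  fixes c t :: real
  assumes "c > 0" "t > 0" "finite G"
  shows "(\<Sum>j\<in>G. t / (real j + c + t)\<^sup>2) \<le> 1 / c + 1"
proof -
  have part: "(\<Sum>j<Suc m. t / (real j + c + t)\<^sup>2) \<le> 1 / c + t / (c + t) - t / (real m + c + t)" for m
  proof (induction m)
    case 0
    have "t * c \<le> (c + t)\<^sup>2" using assms by (simp add: power2_eq_square algebra_simps)
    then have "t / (c + t)\<^sup>2 \<le> 1 / c" using assms by (simp add: field_simps)
    then show ?case by simp
  next
    case (Suc m)
    define s where "s = real m + c + t"
    have s: "s > 0" using assms by (simp add: s_def)
    have "t / (s + 1)\<^sup>2 \<le> t / (s * (s + 1))"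
      using s assms by (intro divide_left_mono) (auto simp: power2_eq_square intro!: mult_right_mono)
    also have "\<dots> = t / s - t / (s + 1)" using s by (simp add: field_simps)
    finally show ?case using Suc by (simp add: s_def algebra_simps)
  qed
  obtain m where "G \<subseteq> {..<Suc m}"
    using assms(3) by (meson finite_nat_iff_bounded lessThan_subset_iff le_SucI order_trans order_refl)
  then have "(\<Sum>j\<in>G. t / (real j + c + t)\<^sup>2) \<le> (\<Sum>j<Suc m. t / (real j + c + t)\<^sup>2)"
    using assms by (intro sum_mono2) auto
  also have "\<dots> \<le> 1 / c + t / (c + t) - t / (real m + c + t)" by (rule part)
  also have "\<dots> \<le> 1 / c + 1"
    using assms by (smt (verit) divide_le_eq_1_pos divide_nonneg_nonneg of_nat_0_le_iff)
  finally show ?thesis .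
qed

lemma cubic_kernel_bound:
  fixes a t :: real
  assumes "a > 0" "t > 0"
  shows "t ^ 5 / (a ^ 3 + t ^ 3)\<^sup>2 \<le> 4 * (t / (a + t)\<^sup>2)"
proof -
  have "t ^ 4 * (a + t)\<^sup>2 \<le> 4 * (a ^ 3 + t ^ 3)\<^sup>2"
  proof (cases "a \<le> t")
    case True
    then have "t ^ 4 * (a + t)\<^sup>2 \<le> t ^ 4 * (2 * t)\<^sup>2"
      using assms by (intro mult_left_mono power_mono) auto
    also have "\<dots> = 4 * (t ^ 3)\<^sup>2" by (simp add: power_mult_distrib flip: power_mult power_add)
    also have "\<dots> \<le> 4 * (a ^ 3 + t ^ 3)\<^sup>2" using assms by (intro mult_left_mono power_mono) auto
    finally show ?thesis .
  next
    case False
    then have "t ^ 4 * (a + t)\<^sup>2 \<le> t ^ 4 * (2 * a)\<^sup>2"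
      using assms by (intro mult_left_mono power_mono) auto
    also have "\<dots> = 4 * (t ^ 3 * a\<^sup>2) * t" by (simp add: power_mult_distrib eval_nat_numeral)
    also have "\<dots> \<le> 4 * (t ^ 3 * a\<^sup>2) * a" using False assms by (intro mult_left_mono) auto
    also have "\<dots> = 4 * (a ^ 3 * t ^ 3)" by (simp add: eval_nat_numeral)
    also have "\<dots> \<le> 4 * (a ^ 3 + t ^ 3)\<^sup>2"
    proof -
      have "0 < a ^ 3" "0 < t ^ 3" using assms by auto
      then have "0 \<le> (a ^ 3)\<^sup>2 + (t ^ 3)\<^sup>2 + a ^ 3 * t ^ 3" by simp
      then show ?thesis by (simp add: power2_sum algebra_simps)
    qed
    finally show ?thesis .
  qed
  then have "t * (t ^ 4 * (a + t)\<^sup>2) \<le> t * (4 * (a ^ 3 + t ^ 3)\<^sup>2)"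
    using assms by (intro mult_left_mono) auto
  then have "t ^ 5 * (a + t)\<^sup>2 \<le> 4 * t * (a ^ 3 + t ^ 3)\<^sup>2"
    by (simp add: eval_nat_numeral mult_ac)
  moreover have "(a ^ 3 + t ^ 3)\<^sup>2 > 0" "(a + t)\<^sup>2 > 0"
    by (intro zero_less_power add_pos_pos assms)+
  moreover have "p / X \<le> 4 * (q / Y)" if "p * Y \<le> 4 * q * X" "X > 0" "Y > 0" for p q X Y :: real
    using that by (simp add: field_simps)
  ultimately show ?thesis by blast
qed

lemma int_add_nonzero:
  fixes \<alpha> :: real
  assumes "\<alpha> \<notin> \<int>"
  shows "of_int k + \<alpha> \<noteq> 0"
  using assms by (metis Ints_minus Ints_of_int add_eq_0_iff)

definition spectral_sup :: "real \<Rightarrow> real" where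
  "spectral_sup \<alpha> = (SUP b\<in>{0..}. b powr (5 / 3) * (\<Sum>\<^sub>\<infinity>k::int. 1 / (\<bar>of_int k + \<alpha>\<bar> ^ 3 + b)\<^sup>2))"

text \<open>
  Finiteness of the supremum. With \<open>b = t\<^sup>3\<close> the terms are dominated by
  \<open>4 t / (\<bar>k + \<alpha>\<bar> + t)\<^sup>2\<close>, whose sums over \<open>k + \<alpha> > 0\<close> and over \<open>k + \<alpha> < 0\<close> are
  bounded uniformly in \<open>t\<close> by telescoping.
\<close>

lemma spectral_sum_bounded:
  fixes \<alpha> :: real
  assumes "\<alpha> \<notin> \<int>"
  obtains C where "\<And>b F. b > 0 \<Longrightarrow> finite F \<Longrightarrow>
     b powr (5 / 3) * (\<Sum>k\<in>F. 1 / (\<bar>of_int k + \<alpha>\<bar> ^ 3 + b)\<^sup>2) \<le> C"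
proof -
  define \<beta> where "\<beta> = frac \<alpha>"
  have \<beta>: "0 < \<beta>" "\<beta> < 1"
    using assms frac_lt_1[of \<alpha>] by (auto simp: \<beta>_def frac_gt_0_iff)
  \<comment> \<open>\<open>\<bar>k + \<alpha>\<bar>\<close> is \<open>j + \<beta>\<close> with \<open>j = k + n\<close> for \<open>k + n \<ge> 0\<close>,
    and \<open>j + (1 - \<beta>)\<close> with \<open>j = - (k + n) - 1\<close> for \<open>k + n < 0\<close>.\<close>
  define n where "n = \<lfloor>\<alpha>\<rfloor>"
  have \<alpha>: "\<alpha> = of_int n + \<beta>" by (simp add: \<beta>_def n_def frac_def)
  have "b powr (5 / 3) * (\<Sum>k\<in>F. 1 / (\<bar>of_int k + \<alpha>\<bar> ^ 3 + b)\<^sup>2) \<le> 4 * ((1 / \<beta> + 1) + (1 / (1 - \<beta>) + 1))"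
    if b: "b > 0" and F: "finite F" for b :: real and F :: "int set"
  proof -
    define t where "t = b powr (1 / 3)"
    have t: "t > 0" using b by (simp add: t_def)
    have b3: "b = t ^ 3" and b5: "b powr (5 / 3) = t ^ 5"
      using b by (simp_all add: t_def powr_powr flip: powr_realpow)
    let ?g = "\<lambda>k. t / (\<bar>of_int k + \<alpha>\<bar> + t)\<^sup>2"
    define F1 F2 where "F1 = {k\<in>F. k + n \<ge> 0}" and "F2 = {k\<in>F. k + n < 0}"
    have pos: "\<bar>of_int k + \<alpha>\<bar> > 0" for k
      using int_add_nonzero[OF assms] by simp
    have "b powr (5 / 3) * (\<Sum>k\<in>F. 1 / (\<bar>of_int k + \<alpha>\<bar> ^ 3 + b)\<^sup>2)
       = (\<Sum>k\<in>F. t ^ 5 / (\<bar>of_int k + \<alpha>\<bar> ^ 3 + t ^ 3)\<^sup>2)"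
      unfolding b5 by (simp add: b3 sum_distrib_left)
    also have "\<dots> \<le> (\<Sum>k\<in>F. 4 * (t / (\<bar>of_int k + \<alpha>\<bar> + t)\<^sup>2))"
      by (intro sum_mono cubic_kernel_bound pos t)
    also have "\<dots> = 4 * sum ?g F" by (simp add: sum_distrib_left)
    also have "sum ?g F =
        sum ?g F1 + sum ?g F2"
      using F by (subst sum.union_disjoint[symmetric]) (auto simp: F1_def F2_def intro!: sum.cong)
    also have "sum ?g F1 = (\<Sum>j\<in>(\<lambda>k. nat (k + n)) ` F1. t / (real j + \<beta> + t)\<^sup>2)"
    proof (subst sum.reindex)
      show "inj_on (\<lambda>k. nat (k + n)) F1" by (auto simp: inj_on_def F1_def)
      have "\<bar>of_int k + \<alpha>\<bar> = real (nat (k + n)) + \<beta>" if "k \<in> F1" for k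
      proof -
        have "real (nat (k + n)) = real_of_int (k + n)" using that by (simp add: F1_def)
        moreover have "real_of_int (k + n) \<ge> 0" using that by (simp only: F1_def) simp
        ultimately show ?thesis using \<beta> by (simp add: \<alpha>)
      qed
      then show "sum ?g F1 = (\<Sum>j\<in>F1. ((\<lambda>j. t / (real j + \<beta> + t)\<^sup>2) \<circ> (\<lambda>k. nat (k + n))) j)"
        by simp
    qed
    also have "sum ?g F2 = (\<Sum>j\<in>(\<lambda>k. nat (- (k + n) - 1)) ` F2. t / (real j + (1 - \<beta>) + t)\<^sup>2)"
    proof (subst sum.reindex)
      show "inj_on (\<lambda>k. nat (- (k + n) - 1)) F2" by (auto simp: inj_on_def F2_def)
      have "\<bar>of_int k + \<alpha>\<bar> = real (nat (- (k + n) - 1)) + (1 - \<beta>)" if "k \<in> F2" for k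
      proof -
        have "k + n \<le> - 1" using that by (simp add: F2_def)
        then have "real_of_int (k + n) \<le> - 1"
            "real (nat (- (k + n) - 1)) = - real_of_int (k + n) - 1" by linarith+
        then show ?thesis using \<beta> by (simp add: \<alpha>)
      qed
      then show "sum ?g F2 = (\<Sum>j\<in>F2. ((\<lambda>j. t / (real j + (1 - \<beta>) + t)\<^sup>2) \<circ> (\<lambda>k. nat (- (k + n) - 1))) j)"
        by simp
    qed
    finally show ?thesis
      using telescoping_bound[OF \<beta>(1) t, of "(\<lambda>k. nat (k + n)) ` F1"]
        telescoping_bound[of "1 - \<beta>" t "(\<lambda>k. nat (- (k + n) - 1)) ` F2"] \<beta> t F
      by (simp add: F1_def F2_def)
  qed
  then show ?thesis using that by blast
qed

lemma spectral_sum_le_sup: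
  fixes \<alpha> :: real
  assumes \<alpha>: "\<alpha> \<notin> \<int>" and b: "b > 0" and F: "finite F"
  shows "b powr (5 / 3) * (\<Sum>k\<in>F. 1 / (\<bar>of_int k + \<alpha>\<bar> ^ 3 + b)\<^sup>2) \<le> spectral_sup \<alpha>"
proof -
  define f where "f b k = 1 / (\<bar>of_int k + \<alpha>\<bar> ^ 3 + b)\<^sup>2" for b and k :: int
  obtain C where C: "\<And>b F. b > 0 \<Longrightarrow> finite F \<Longrightarrow> b powr (5 / 3) * (\<Sum>k\<in>F. f b k) \<le> C"
    using spectral_sum_bounded[OF \<alpha>] unfolding f_def by blast
  have f0: "f b k \<ge> 0" for b k by (simp add: f_def)
  have le: "(\<Sum>k\<in>F. f b k) \<le> C / b powr (5 / 3)" if "b > 0" "finite F" for b F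
    using C[OF that] that by (simp add: field_simps)
  have summ: "f b summable_on UNIV" if "b > 0" for b
    using f0 le[OF that] by (intro nonneg_bounded_partial_sums_imp_summable_on[where C
        = "C / b powr (5 / 3)"])
      (auto intro!: eventually_finite_subsets_at_top_weakI)
  have infle: "b powr (5 / 3) * infsum (f b) UNIV \<le> C" if "b > 0" for b
  proof -
    have "infsum (f b) UNIV \<le> C / b powr (5 / 3)"
      using le[OF that] by (intro infsum_le_finite_sums summ that) auto
    then show ?thesis using that by (simp add: field_simps)
  qed
  have "bdd_above ((\<lambda>b. b powr (5 / 3) * infsum (f b) UNIV) ` {0..})"
  proof (rule bdd_aboveI2)
    fix b :: real assume "b \<in> {0..}"
    then show "b powr (5 / 3) * infsum (f b) UNIV \<le> max 0 C"
      using infle[of b] by (cases "b = 0") auto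
  qed
  then have "b powr (5 / 3) * infsum (f b) UNIV \<le> spectral_sup \<alpha>"
    unfolding spectral_sup_def f_def using b by (intro cSUP_upper) auto
  moreover have "(\<Sum>k\<in>F. f b k) \<le> infsum (f b) UNIV"
    using f0 by (intro finite_sum_le_infsum summ b F) auto
  then have "b powr (5 / 3) * (\<Sum>k\<in>F. f b k) \<le> b powr (5 / 3) * infsum (f b) UNIV"
    by (intro mult_left_mono) auto
  ultimately show ?thesis by (simp add: f_def)
qed

lemma spectral_sup_pos:
  fixes \<alpha> :: real
  assumes "\<alpha> \<notin> \<int>"
  shows "spectral_sup \<alpha> > 0"
proof -
  have "0 < 1 / (\<bar>of_int 0 + \<alpha>\<bar> ^ 3 + 1)\<^sup>2" by (simp add: add_nonneg_eq_0_iff)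
  also have "\<dots> \<le> spectral_sup \<alpha>"
    using spectral_sum_le_sup[OF assms, of 1 "{0}"] by simp
  finally show ?thesis .
qed

lemma K2_eq: "K2 \<alpha> = 5 / (3 * sqrt 3 * pi) * (spectral_sup \<alpha>)\<^sup>2"
  by (simp add: K2_def spectral_sup_def)

text \<open>
  The smooth substitute for the indicator of \<open>t < a\<close>. In the variable \<open>E = t\<^sup>2\<close> the sharp
  indicator would give the layer-cake formula \<open>a\<^sup>2 = \<integral> 1 dE\<close> over \<open>E < a\<^sup>2\<close>; the present shape is the
  optimal one for this argument.
\<close>

definition cutoff :: "real \<Rightarrow> real \<Rightarrow> real" where
  "cutoff a t = a ^ 3 / (a ^ 3 + t ^ 3)"

text \<open>
  After scaling to \<open>a = 1\<close> the integrand is \<open>2 s / (1 + s\<^sup>3)\<^sup>2\<close>, which has an elementary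
  primitive \<open>H\<close> by partial fractions.
\<close>

lemma nn_integral_cutoff_square:
  assumes a: "a > 0"
  shows "(\<integral>\<^sup>+t. ennreal (2 * t * (cutoff a t)\<^sup>2) * indicator {0..} t \<partial>lborel)
      = ennreal (4 * pi / (9 * sqrt 3) * a\<^sup>2)"
proof -
  define H where "H s = 2 / 3 * (s\<^sup>2 / (1 + s ^ 3) - ln (1 + s) / 3 + ln (s\<^sup>2 - s + 1) / 6
     + arctan ((2 * s - 1) / sqrt 3) / sqrt 3)" for s :: real
  have H: "(H has_real_derivative 2 * s / (1 + s ^ 3)\<^sup>2) (at s)" if s: "s \<ge> 0" for s
  proof -
    let ?d = "2 / 3 * ((2 * s * (1 + s ^ 3) - s\<^sup>2 * (3 * s\<^sup>2)) / (1 + s ^ 3)\<^sup>2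
        - (1 / (1 + s)) / 3 + ((2 * s - 1) / (s\<^sup>2 - s + 1)) / 6
        + (1 / (1 + ((2 * s - 1) / sqrt 3)\<^sup>2) * (2 / sqrt 3)) / sqrt 3)"
    have q: "s\<^sup>2 - s + 1 > 0"
    proof -
      have "s\<^sup>2 - s + 1 = (s - 1/2)\<^sup>2 + 3/4" by (simp add: power2_eq_square algebra_simps)
      then show ?thesis by (simp add: add_nonneg_pos)
    qed
    have c: "1 + s ^ 3 > 0" "1 + s > 0" using s by (auto intro: add_pos_nonneg)
    have fac: "1 + s ^ 3 = (1 + s) * (s\<^sup>2 - s + 1)"
        by (simp add: power2_eq_square power3_eq_cube algebra_simps)
    have arc: "1 + ((2 * s - 1) / sqrt 3)\<^sup>2 = 4 / 3 * (s\<^sup>2 - s + 1)"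
      by (simp add: power_divide) (simp add: power2_eq_square field_simps)
    have "((\<lambda>s. s\<^sup>2 / (1 + s ^ 3)) has_real_derivative (2 * s * (1 + s ^ 3) - s\<^sup>2 * (3 * s\<^sup>2)) / (1
        + s ^ 3)\<^sup>2) (at s)"
      using c by (auto intro!: derivative_eq_intros simp: power2_eq_square)
    moreover have "((\<lambda>s. ln (1 + s) / 3) has_real_derivative (1 / (1 + s)) / 3) (at s)"
      using c by (auto intro!: derivative_eq_intros simp: field_simps)
    moreover have "((\<lambda>s. ln (s\<^sup>2 - s + 1) / 6) has_real_derivative ((2 * s - 1) / (s\<^sup>2 - s
        + 1)) / 6) (at s)"
      using q by (intro DERIV_cdivide) (auto intro!: derivative_eq_intros)
    moreover have "((\<lambda>s. arctan ((2 * s - 1) / sqrt 3) / sqrt 3) has_real_derivative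
        (1 / (1 + ((2 * s - 1) / sqrt 3)\<^sup>2) * (2 / sqrt 3)) / sqrt 3) (at s)"
      by (auto intro!: derivative_eq_intros simp: divide_inverse)
    ultimately have d: "(H has_real_derivative ?d) (at s)"
      unfolding H_def[abs_def] by (intro DERIV_cmult DERIV_add DERIV_diff)
    have e1: "(1 / (1 + ((2 * s - 1) / sqrt 3)\<^sup>2) * (2 / sqrt 3)) / sqrt 3 = 1 / (2 * (s\<^sup>2 - s + 1))"
    proof -
      have "(2 / sqrt 3) / sqrt 3 = 2 / 3" by simp
      then have "(1 / (4 / 3 * (s\<^sup>2 - s + 1)) * (2 / sqrt 3)) / sqrt 3
          = 1 / (4 / 3 * (s\<^sup>2 - s + 1)) * (2 / 3)"
        by (simp only: times_divide_eq_right[symmetric])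
      also have "\<dots> = 1 / (2 * (s\<^sup>2 - s + 1))"
        using q by (simp add: field_simps)
      finally show ?thesis unfolding arc .
    qed
    have e2: "(- (1 / (1 + s)) / 3 + ((2 * s - 1) / (s\<^sup>2 - s + 1)) / 6 + 1 / (2 * (s\<^sup>2 - s + 1)))
        = s / (1 + s ^ 3)"
    proof -
      have "- (1 / r) / 3 + p / q / 6 + 1 / (2 * q) = (- 2 * q + p * r + 3 * r) / (6 * (r * q))"
        if "r > 0" "q > 0" for p q r :: real
        using that by (simp add: field_simps)
      from this[OF c(2) q] have "- (1 / (1 + s)) / 3 + ((2 * s - 1) / (s\<^sup>2 - s + 1)) / 6
          + 1 / (2 * (s\<^sup>2 - s + 1))
          = (- 2 * (s\<^sup>2 - s + 1) + (2 * s - 1) * (1 + s) + 3 * (1 + s)) / (6 * (1 + s ^ 3))"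
        unfolding fac .
      also have "- 2 * (s\<^sup>2 - s + 1) + (2 * s - 1) * (1 + s) + 3 * (1 + s) = 6 * s"
        by (simp add: power2_eq_square algebra_simps)
      also have "6 * s / (6 * (1 + s ^ 3)) = s / (1 + s ^ 3)"
        by (rule mult_divide_mult_cancel_left) simp
      finally show ?thesis .
    qed
    have e3: "(2 * s * (1 + s ^ 3) - s\<^sup>2 * (3 * s\<^sup>2)) / (1 + s ^ 3)\<^sup>2 + s / (1 + s ^ 3)
        = 3 * s / (1 + s ^ 3)\<^sup>2"
    proof -
      have "(2 * s * Z - p) / Z\<^sup>2 + s / Z = (3 * s * Z - p) / Z\<^sup>2" if "Z > 0" for p Z :: real
        using that by (simp add: field_simps power2_eq_square)
      from this[OF c(1)] have "(2 * s * (1 + s ^ 3) - s\<^sup>2 * (3 * s\<^sup>2)) / (1 + s ^ 3)\<^sup>2 + s / (1 + s ^ 3)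
          = (3 * s * (1 + s ^ 3) - s\<^sup>2 * (3 * s\<^sup>2)) / (1 + s ^ 3)\<^sup>2" .
      also have "3 * s * (1 + s ^ 3) - s\<^sup>2 * (3 * s\<^sup>2) = 3 * s"
        by (simp add: eval_nat_numeral algebra_simps)
      finally show ?thesis .
    qed
    have "?d = 2 * s / (1 + s ^ 3)\<^sup>2"
    proof -
      have "2 / 3 * (p - x / 3 + y + z) = 2 * s / v" if "- x / 3 + y + z = w" "p + w = 3 * s / v"
        for p v w x y z :: real
      proof -
        have "p - x / 3 + y + z = 3 * s / v" using that by simp
        then show ?thesis by simp
      qed
      from this[OF e2 e3] show ?thesis unfolding e1 .
    qed
    then show ?thesis using d by simp
  qed
  have lim: "(H \<longlongrightarrow> pi / (3 * sqrt 3)) at_top"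
  proof -
    have "((\<lambda>s::real. s\<^sup>2 / (1 + s ^ 3) - ln (1 + s) / 3 + ln (s\<^sup>2 - s + 1) / 6) \<longlongrightarrow> 0) at_top"
      by real_asymp
    moreover have "((\<lambda>s::real. arctan ((2 * s - 1) / sqrt 3)) \<longlongrightarrow> pi / 2) at_top"
      by (rule filterlim_compose[OF tendsto_arctan_at_top]) real_asymp
    ultimately have "(H \<longlongrightarrow> 2 / 3 * (0 + (pi / 2) / sqrt 3)) at_top"
      unfolding H_def[abs_def] by (intro tendsto_intros) auto
    then show ?thesis by simp
  qed
  have H0: "H 0 = - pi / (9 * sqrt 3)"
  proof -
    have "arctan (1 / sqrt 3) = pi / 6"
      by (rule arctan_unique) (simp_all add: tan_30)
    then have "arctan (- (1 / sqrt 3)) = - (pi / 6)"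
      by (simp only: arctan_minus)
    then show ?thesis by (simp add: H_def)
  qed
  have cut: "2 * t * (cutoff a t)\<^sup>2 = a * (2 * (t / a) / (1 + (t / a) ^ 3)\<^sup>2)" if "t \<ge> 0" for t
  proof -
    have "a ^ 3 + t ^ 3 > 0" using a that by (intro add_pos_nonneg) auto
    moreover have "1 + (t / a) ^ 3 = (a ^ 3 + t ^ 3) / a ^ 3" using a
        by (simp add: power_divide field_simps)
    ultimately show ?thesis using a by (simp add: cutoff_def power_divide field_simps)
  qed
  have "(\<integral>\<^sup>+t. ennreal (2 * t * (cutoff a t)\<^sup>2) * indicator {0..} t \<partial>lborel)
     = ennreal (a\<^sup>2 * (pi / (3 * sqrt 3)) - a\<^sup>2 * H (0 / a))"
  proof (rule nn_integral_FTC_atLeast)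
    show "(\<lambda>t. 2 * t * (cutoff a t)\<^sup>2) \<in> borel_measurable borel"
      unfolding cutoff_def by measurable
    show "0 \<le> 2 * t * (cutoff a t)\<^sup>2" if "0 \<le> t" for t using that by simp
    show "((\<lambda>t. a\<^sup>2 * H (t / a)) has_real_derivative 2 * t * (cutoff a t)\<^sup>2) (at t)" if "0 \<le> t" for t
    proof -
      have "((\<lambda>t. a\<^sup>2 * H (t / a)) has_real_derivative a\<^sup>2
          * (2 * (t / a) / (1 + (t / a) ^ 3)\<^sup>2 * (1 / a))) (at t)"
        using a that by (intro DERIV_cmult DERIV_chain2[OF H]) (auto intro!: derivative_eq_intros)
      then show ?thesis unfolding cut[OF that] using a by (simp add: power2_eq_square)
    qed
    have "filterlim (\<lambda>t. t / a) at_top at_top"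
      using a by real_asymp
    then show "((\<lambda>t. a\<^sup>2 * H (t / a)) \<longlongrightarrow> a\<^sup>2 * (pi / (3 * sqrt 3))) at_top"
      by (intro tendsto_intros filterlim_compose[OF lim])
  qed
  also have "a\<^sup>2 * (pi / (3 * sqrt 3)) - a\<^sup>2 * H (0 / a) = 4 * pi / (9 * sqrt 3) * a\<^sup>2"
    by (simp add: H0 field_simps)
  finally show ?thesis .
qed


abbreviation "half_line \<equiv> lebesgue_on {0::real..}"

lemma cutoff_bounds: "a > 0 \<Longrightarrow> t \<ge> 0 \<Longrightarrow> 0 \<le> cutoff a t"
  by (simp add: cutoff_def)

lemma cutoff_measurable: "cutoff a \<in> borel_measurable half_line"
proof -
  have "cutoff a \<in> borel_measurable borel"
    unfolding cutoff_def[abs_def] by measurable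
  then show ?thesis
    by (intro measurable_restrict_space1) (simp add: measurable_completion)
qed

lemma cutoff_square_integral:
  assumes "a > 0"
  shows "has_bochner_integral half_line (\<lambda>t. 2 * t * (cutoff a t)\<^sup>2) (4 * pi / (9 * sqrt 3) * a\<^sup>2)"
proof (rule has_bochner_integral_nn_integral)
  have [measurable]: "(\<lambda>t. t) \<in> borel_measurable half_line"
    by (intro measurable_restrict_space1) (simp add: measurable_completion)
  show "(\<lambda>t. 2 * t * (cutoff a t)\<^sup>2) \<in> borel_measurable half_line"
    using cutoff_measurable[of a] by measurable
  show "AE t in half_line. 0 \<le> 2 * t * (cutoff a t)\<^sup>2" by (rule AE_I2) simp
  have "(\<integral>\<^sup>+t. ennreal (2 * t * (cutoff a t)\<^sup>2) \<partial>half_line)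
      = (\<integral>\<^sup>+t. ennreal (2 * t * (cutoff a t)\<^sup>2) * indicator {0..} t \<partial>lebesgue)"
    by (rule nn_integral_restrict_space) simp
  also have "\<dots> = (\<integral>\<^sup>+t. ennreal (2 * t * (cutoff a t)\<^sup>2) * indicator {0..} t \<partial>lborel)"
    by (rule nn_integral_completion)
  finally show "(\<integral>\<^sup>+t. ennreal (2 * t * (cutoff a t)\<^sup>2) \<partial>half_line)
      = ennreal (4 * pi / (9 * sqrt 3) * a\<^sup>2)"
    using nn_integral_cutoff_square[OF assms] by simp
qed simp

lemma integrable_cutoff_product:
  assumes "a > 0" "a' > 0"
  shows "integrable half_line (\<lambda>t. 2 * t * (cutoff a t * cutoff a' t))"
proof (rule Bochner_Integration.integrable_bound)
  have [measurable]: "(\<lambda>t. t) \<in> borel_measurable half_line"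
    by (intro measurable_restrict_space1) (simp add: measurable_completion)
  show "integrable half_line (\<lambda>t. 2 * t * (cutoff a t)\<^sup>2 + 2 * t * (cutoff a' t)\<^sup>2)"
    using assms by (intro Bochner_Integration.integrable_add) (blast intro: cutoff_square_integral
        integrable.intros)+
  show "(\<lambda>t. 2 * t * (cutoff a t * cutoff a' t)) \<in> borel_measurable half_line"
    using cutoff_measurable[of a] cutoff_measurable[of a'] by measurable
  show "AE t in half_line. norm (2 * t * (cutoff a t * cutoff a' t))
      \<le> norm (2 * t * (cutoff a t)\<^sup>2 + 2 * t * (cutoff a' t)\<^sup>2)"
  proof (rule AE_I2)
    fix t assume "t \<in> space half_line"
    then have t: "t \<ge> 0" by simp
    have nn: "0 \<le> cutoff a t * cutoff a' t" using assms t by (simp add: cutoff_bounds)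
    have "2 * (cutoff a t * cutoff a' t) \<le> (cutoff a t)\<^sup>2 + (cutoff a' t)\<^sup>2"
      using sum_squares_bound[of "cutoff a t" "cutoff a' t"] by (simp only: mult.assoc)
    then have "cutoff a t * cutoff a' t \<le> (cutoff a t)\<^sup>2 + (cutoff a' t)\<^sup>2" using nn by linarith
    then have "2 * t * (cutoff a t * cutoff a' t) \<le> 2 * t * ((cutoff a t)\<^sup>2 + (cutoff a' t)\<^sup>2)"
      using t by (intro mult_left_mono) auto
    moreover have "0 \<le> 2 * t * (cutoff a t * cutoff a' t)" using t nn by simp
    ultimately show "norm (2 * t * (cutoff a t * cutoff a' t))
        \<le> norm (2 * t * (cutoff a t)\<^sup>2 + 2 * t * (cutoff a' t)\<^sup>2)"
      by (simp add: distrib_left)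
  qed
qed

text \<open>
  The integral in \<open>t\<close> of a finite Fourier sum is again a finite quadratic form, so no interchange with
  the integral in \<open>x\<close> is ever needed.
\<close>

lemma cutoff_quadratic:
  fixes z :: "'i \<Rightarrow> complex"
  assumes a: "\<And>k. k \<in> F \<Longrightarrow> a k > 0"
  shows "has_bochner_integral half_line (\<lambda>t. 2 * t * (norm (\<Sum>k\<in>F. of_real (cutoff (a k) t) * z k))\<^sup>2)
    (\<Sum>k\<in>F. \<Sum>l\<in>F. (LINT t|half_line. 2 * t * (cutoff (a k) t * cutoff (a l) t)) * Re (z k * cnj (z l)))"
proof -
  have "(norm (\<Sum>k\<in>F. of_real (cutoff (a k) t) * z k))\<^sup>2
     = (\<Sum>k\<in>F. \<Sum>l\<in>F. cutoff (a k) t * cutoff (a l) t * Re (z k * cnj (z l)))" for t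
  proof -
    have "complex_of_real ((norm (\<Sum>k\<in>F. of_real (cutoff (a k) t) * z k))\<^sup>2)
       = (\<Sum>k\<in>F. \<Sum>l\<in>F. of_real (cutoff (a k) t * cutoff (a l) t) * (z k * cnj (z l)))"
      unfolding complex_norm_square by (simp add: sum_product mult_ac)
    then have "Re (complex_of_real ((norm (\<Sum>k\<in>F. of_real (cutoff (a k) t) * z k))\<^sup>2))
       = Re (\<Sum>k\<in>F. \<Sum>l\<in>F. of_real (cutoff (a k) t * cutoff (a l) t) * (z k * cnj (z l)))"
      by (rule arg_cong)
    moreover have "Re (complex_of_real r * w) = r * Re w" for r w by simp
    ultimately show ?thesis by (simp only: Re_complex_of_real Re_sum)
  qed
  then have eq: "2 * t * (norm (\<Sum>k\<in>F. of_real (cutoff (a k) t) * z k))\<^sup>2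
     = (\<Sum>k\<in>F. \<Sum>l\<in>F. 2 * t * (cutoff (a k) t * cutoff (a l) t) * Re (z k * cnj (z l)))" for t
    by (simp only: sum_distrib_left mult.assoc)
  show ?thesis
    unfolding eq
    by (intro has_bochner_integral_sum has_bochner_integral_mult_left has_bochner_integral_integrable
        integrable_cutoff_product a)
qed

text \<open>
  For \<open>t \<le> lam / c\<close> the hypothesis bounds \<open>y t\<close> from below by
  \<open>(\<surd>lam - \<surd>(c t))\<^sup>2\<close>. The integral of \<open>2 t\<close> times this over \<open>[0, lam / c]\<close> is
  \<open>lam\<^sup>3 / (15 c\<^sup>2)\<close>.
\<close>

lemma cube_le_layer_integral:
  fixes y :: "real \<Rightarrow> real"
  assumes lam: "lam \<ge> 0" and c: "c > 0" and y: "\<And>t. t \<ge> 0 \<Longrightarrow> y t \<ge> 0"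
    and le: "\<And>t. t > 0 \<Longrightarrow> sqrt lam \<le> sqrt (y t) + sqrt (c * t)"
    and int: "integrable half_line (\<lambda>t. 2 * t * y t)"
  shows "lam ^ 3 \<le> 15 * c\<^sup>2 * (LINT t|half_line. 2 * t * y t)"
proof -
  \<comment> \<open>\<open>\<surd>lam = \<surd>(c t)\<close> at \<open>t = T\<close>; beyond \<open>T\<close> the lower bound for \<open>y\<close> is trivial.\<close>
  define T where "T = lam / c"
  have T: "T \<ge> 0" using lam c by (simp add: T_def)
  define s where "s = sqrt (lam * c)"
  define q where "q t = 2 * t * (lam - 2 * s * sqrt t + c * t)" for t
  define Q where "Q t = lam * t\<^sup>2 - 8 / 5 * s * (t\<^sup>2 * sqrt t) + 2 / 3 * c * t ^ 3" for t
  have Y: "(\<lambda>t. 2 * t * y t) integrable_on {0..}"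
    using integrable_on_lebesgue_on[OF int] by simp
  have "(q has_integral (Q T - Q 0)) {0..T}"
  proof (rule fundamental_theorem_of_calculus_interior[OF T])
    show "continuous_on {0..T} Q"
      unfolding Q_def by (intro continuous_intros)
    fix t assume "t \<in> {0<..<T}"
    then have t: "t > 0" by simp
    have "((\<lambda>t. t\<^sup>2 * sqrt t) has_real_derivative 5 / 2 * (t * sqrt t)) (at t)"
    proof -
      have "((\<lambda>t. t\<^sup>2 * sqrt t) has_real_derivative 2 * t * sqrt t
          + t\<^sup>2 * (inverse (sqrt t) / 2)) (at t)"
        using t by (auto intro!: derivative_eq_intros)
      moreover have "t\<^sup>2 * (inverse (sqrt t) / 2) = t * sqrt t / 2"
      proof -
        have "t * inverse (sqrt t) = sqrt t" using t by (simp add: field_simps)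
        then show ?thesis by (simp add: power2_eq_square mult.assoc)
      qed
      ultimately show ?thesis by simp
    qed
    then have "(Q has_real_derivative lam * (2 * t) - 8 / 5 * s * (5 / 2 * (t * sqrt t))
        + 2 / 3 * c * (3 * t\<^sup>2)) (at t)"
      unfolding Q_def[abs_def]
      by (intro DERIV_add DERIV_diff DERIV_cmult) (auto intro!: derivative_eq_intros)
    moreover have "lam * (2 * t) - 8 / 5 * s * (5 / 2 * (t * sqrt t)) + 2 / 3 * c * (3 * t\<^sup>2) = q t"
      by (simp add: q_def power2_eq_square algebra_simps)
    ultimately show "(Q has_vector_derivative q t) (at t)"
      by (simp add: has_real_derivative_iff_has_vector_derivative)
  qed
  then have qi: "(q has_integral Q T) {0..T}" by (simp add: Q_def)
  have QT: "Q T = lam ^ 3 / (15 * c\<^sup>2)"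
  proof -
    have "s * sqrt T = lam"
      using lam c by (simp add: s_def T_def real_sqrt_mult[symmetric])
    then have e: "s * (T\<^sup>2 * sqrt T) = T\<^sup>2 * lam"
      by (simp only: mult.left_commute[of s])
    have e': "c * T ^ 3 = T\<^sup>2 * lam" using c by (simp add: T_def power3_eq_cube power2_eq_square)
    have "Q T = lam * T\<^sup>2 - 8 / 5 * (s * (T\<^sup>2 * sqrt T)) + 2 / 3 * (c * T ^ 3)"
      by (simp add: Q_def)
    also have "\<dots> = T\<^sup>2 * lam / 15" unfolding e e' by simp
    also have "\<dots> = lam ^ 3 / (15 * c\<^sup>2)" by (simp add: T_def power2_eq_square power3_eq_cube)
    finally show ?thesis .
  qed
  have "Q T \<le> integral {0..T} (\<lambda>t. 2 * t * y t)"
  proof (rule has_integral_le[OF qi integrable_integral])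
    show "(\<lambda>t. 2 * t * y t) integrable_on {0..T}"
      by (rule integrable_on_subinterval[OF Y]) auto
    fix t assume t: "t \<in> {0..T}"
    show "q t \<le> 2 * t * y t"
    proof (cases "t = 0")
      case False
      then have t0: "t > 0" using t by simp
      have "c * t \<le> lam" using t c by (simp add: T_def field_simps)
      then have "0 \<le> sqrt lam - sqrt (c * t)" by simp
      moreover have "sqrt lam - sqrt (c * t) \<le> sqrt (y t)" using le[OF t0] by simp
      ultimately have "(sqrt lam - sqrt (c * t))\<^sup>2 \<le> (sqrt (y t))\<^sup>2" by (intro power_mono) auto
      moreover have "(sqrt lam - sqrt (c * t))\<^sup>2 = lam - 2 * s * sqrt t + c * t"
        using lam c t0 by (simp add: power2_diff s_def real_sqrt_mult power_mult_distrib)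
      ultimately have "lam - 2 * s * sqrt t + c * t \<le> y t" using y[of t] t0 by simp
      then show ?thesis unfolding q_def using t0 by (intro mult_left_mono) auto
    qed (simp add: q_def)
  qed
  also have "\<dots> \<le> integral {0..} (\<lambda>t. 2 * t * y t)"
    using y by (intro integral_subset_le Y integrable_on_subinterval[OF Y]) auto
  also have "\<dots> = (LINT t|half_line. 2 * t * y t)"
    by (rule lebesgue_integral_eq_integral[OF int, symmetric]) simp
  finally show ?thesis using c unfolding QT by (simp add: field_simps)
qed


section \<open>The second constant\<close>

lemma cube_formula:
  "trace_cube N \<psi> x
    = (\<Sum>n=1..N. \<Sum>j\<in>UNIV. (norm (\<Sum>m=1..N. herm (\<psi> n x) (\<psi> m x) * \<psi> m x $ j))\<^sup>2)"
  unfolding trace_density_cube density_matrix_mult by (simp add: norm_vec_square)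

context quasi_periodic_system
begin

lemma Bessel_V:
  assumes \<rho>: "\<And>j. sq_integrable M (\<lambda>y. \<rho> y $ j)"
  shows "(\<Sum>n=1..N. (norm (LINT y|M. herm (V n y) (\<rho> y)))\<^sup>2) \<le> (\<Sum>j\<in>UNIV. LINT y|M. (norm (\<rho> y $ j))\<^sup>2)"
proof -
  define \<beta> where "\<beta> n = (LINT y|M. herm (\<rho> y) (V n y))" for n
  define u where "u j y = (\<Sum>n=1..N. \<beta> n * V n y $ j)" for j y
  have u: "sq_integrable M (u j)" for j
    unfolding u_def[abs_def] by (intro sq_integrable_sum sq_integrable_cmult sqV)
  have \<rho>u: "integrable M (\<lambda>y. \<rho> y $ j * cnj (u j y))" for j
    by (intro sq_integrable_mult sq_integrable_cnj u \<rho>)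
  have \<rho>V: "integrable M (\<lambda>y. \<rho> y $ j * cnj (V n y $ j))" if "n \<in> {1..N}" for n j
    by (intro sq_integrable_mult sq_integrable_cnj \<rho> sqV that)
  have "(\<Sum>j\<in>UNIV. LINT y|M. \<rho> y $ j * cnj (u j y))
      = (\<Sum>j\<in>UNIV. LINT y|M. (\<Sum>n=1..N. cnj (\<beta> n) * (\<rho> y $ j * cnj (V n y $ j))))"
    by (simp add: u_def sum_distrib_left mult_ac)
  also have "\<dots> = (\<Sum>j\<in>UNIV. \<Sum>n=1..N. cnj (\<beta> n) * (LINT y|M. \<rho> y $ j * cnj (V n y $ j)))"
    using \<rho>V by (intro sum.cong refl) simp
  also have "\<dots> = (\<Sum>n=1..N. \<Sum>j\<in>UNIV. cnj (\<beta> n) * (LINT y|M. \<rho> y $ j * cnj (V n y $ j)))"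
    by (rule sum.swap)
  also have "\<dots> = (\<Sum>n=1..N. cnj (\<beta> n) * \<beta> n)"
    using \<rho>V by (intro sum.cong refl) (simp add: \<beta>_def herm_def sum_distrib_left)
  also have "\<dots> = of_real (\<Sum>n=1..N. (norm (\<beta> n))\<^sup>2)"
    by (simp add: complex_norm_square mult.commute del: of_real_power)
  finally have "Re (\<Sum>j\<in>UNIV. LINT y|M. \<rho> y $ j * cnj (u j y)) = (\<Sum>n=1..N. (norm (\<beta> n))\<^sup>2)"
    by (simp only: Re_complex_of_real)
  then have cross: "(\<Sum>j\<in>UNIV. LINT y|M. Re (\<rho> y $ j * cnj (u j y))) = (\<Sum>n=1..N. (norm (\<beta> n))\<^sup>2)"
    by (simp only: integral_Re[OF \<rho>u] Re_sum)
  have "0 \<le> (LINT y|M. (norm (\<rho> y $ j))\<^sup>2) - 2 * (LINT y|M. Re (\<rho> y $ j * cnj (u j y)))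
      + (LINT y|M. (norm (u j y))\<^sup>2)" for j
  proof -
    have "(norm (\<rho> y $ j - u j y))\<^sup>2
        = (norm (\<rho> y $ j))\<^sup>2 - 2 * Re (\<rho> y $ j * cnj (u j y)) + (norm (u j y))\<^sup>2" for y
      by (simp add: cmod_power2) (simp add: power2_eq_square algebra_simps)
    then have "0 \<le> (LINT y|M. (norm (\<rho> y $ j))\<^sup>2 - 2 * Re (\<rho> y $ j * cnj (u j y)) + (norm (u j y))\<^sup>2)"
      by (metis (no_types, lifting) integral_nonneg_AE AE_I2 zero_le_power2)
    also have "\<dots> = (LINT y|M. (norm (\<rho> y $ j))\<^sup>2) - 2 * (LINT y|M. Re (\<rho> y $ j * cnj (u j y)))
        + (LINT y|M. (norm (u j y))\<^sup>2)"
      by (intro integral_polarization sq_integrable_integrable \<rho> u integrable_Re \<rho>u)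
    finally show ?thesis .
  qed
  then have "0 \<le> (\<Sum>j\<in>UNIV. (LINT y|M. (norm (\<rho> y $ j))\<^sup>2)
      - 2 * (LINT y|M. Re (\<rho> y $ j * cnj (u j y))) + (LINT y|M. (norm (u j y))\<^sup>2))"
    by (intro sum_nonneg) auto
  also have "\<dots> = (\<Sum>j\<in>UNIV. LINT y|M. (norm (\<rho> y $ j))\<^sup>2) - (\<Sum>n=1..N. (norm (\<beta> n))\<^sup>2)"
  proof -
    have mass: "(\<Sum>j\<in>UNIV. LINT y|M. (norm (u j y))\<^sup>2) = (\<Sum>n=1..N. (norm (\<beta> n))\<^sup>2)"
      unfolding u_def by (rule mass_form)
    show ?thesis
      by (simp only: sum.distrib sum_subtractf sum_distrib_left[symmetric] cross mass)
  qed
  finally have "(\<Sum>n=1..N. (norm (\<beta> n))\<^sup>2) \<le> (\<Sum>j\<in>UNIV. LINT y|M. (norm (\<rho> y $ j))\<^sup>2)" by simp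
  moreover have "norm (LINT y|M. herm (V n y) (\<rho> y)) = norm (\<beta> n)" for n
    unfolding \<beta>_def by (simp add: cnj_herm[symmetric, of "\<rho> _"])
  ultimately show ?thesis by simp
qed

definition "coef n k = (\<chi> j. fcoef L (\<lambda>x. V n x $ j) (freq L \<alpha> k))"

text \<open>
  The multipliers \<open>\<phi>\<close> that occur are \<open>1\<close>, the cutoff at level \<open>t\<close>, and their
  difference.
\<close>

definition "filtered F \<phi> n x = (\<Sum>k\<in>F. (of_real (\<phi> k) * cis (freq L \<alpha> k * x) / L) *s coef n k)"

lemma filtered_component:
  "filtered F \<phi> n x $ j = (\<Sum>k\<in>F. of_real (\<phi> k) * (cis (freq L \<alpha> k * x) / L * coef n k $ j))"
  by (simp add: filtered_def mult.assoc)

lemma filtered_diff: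
  "filtered F (\<lambda>k. \<phi> k - \<eta> k) n x = filtered F \<phi> n x - filtered F \<eta> n x"
  by (simp add: vec_eq_iff filtered_component left_diff_distrib diff_divide_distrib sum_subtractf)

text \<open>
  The left-hand side collects the pairings of the \<open>V n\<close> with a single trigonometric polynomial times
  \<open>e\<close>. The Bessel inequality for the orthonormal \<open>V n\<close> bounds it independently of the number of
  functions.
\<close>

lemma multiplier_bound:
  assumes "norm e = 1" "finite F"
  shows "(\<Sum>n=1..N. (norm (herm (filtered F \<phi> n x) e))\<^sup>2) \<le> (\<Sum>k\<in>F. (\<phi> k)\<^sup>2) / L"
proof -
  define s where "s k = of_real (\<phi> k) * cis (freq L \<alpha> k * x) / L" for k
  define \<tau> where "\<tau> y = (\<Sum>k\<in>F. s k * cis (- (freq L \<alpha> k * y)))" for y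
  have \<tau>: "sq_integrable M \<tau>"
    unfolding \<tau>_def[abs_def] by (intro sq_integrable_sum sq_integrable_cmult sq_integrable_cis_minus)
  \<comment> \<open>The kernel of the multiplier at the point \<open>x\<close>, in the direction \<open>e\<close>.\<close>
  define \<rho> where "\<rho> y = cnj (\<tau> y) *s e" for y
  have \<rho>: "sq_integrable M (\<lambda>y. \<rho> y $ j)" for j
    using sq_integrable_cmult[OF sq_integrable_cnj[OF \<tau>], of "e $ j"] by (simp add: \<rho>_def mult.commute)
  have "herm (filtered F \<phi> n x) e = (LINT y|M. herm (V n y) (\<rho> y))" if n: "n \<in> {1..N}" for n
  proof -
    have i1: "integrable M (\<lambda>y. V n y $ j * cis (- (q * y)))" for j q
      by (intro sq_integrable_mult sq_integrable_cis_minus sqV n)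
    have c: "herm (coef n k) e = (LINT y|M. herm (V n y) e * cis (- (freq L \<alpha> k * y)))" for k
    proof -
      have "herm (coef n k) e = (\<Sum>j\<in>UNIV. LINT y|M. cnj (e $ j)
          * (V n y $ j * cis (- (freq L \<alpha> k * y))))"
        by (simp add: herm_def coef_def fcoef_def mult.commute)
      also have "\<dots> = (LINT y|M. (\<Sum>j\<in>UNIV. cnj (e $ j) * (V n y $ j * cis (- (freq L \<alpha> k * y)))))"
        using i1 by (intro Bochner_Integration.integral_sum[symmetric]) simp
      finally show ?thesis by (simp add: herm_def sum_distrib_left sum_distrib_right mult_ac)
    qed
    have i2: "integrable M (\<lambda>y. herm (V n y) e * cis (- (q * y)))" for q
    proof -
      have "integrable M (\<lambda>y. \<Sum>j\<in>UNIV. cnj (e $ j) * (V n y $ j * cis (- (q * y))))"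
        using i1 by (intro Bochner_Integration.integrable_sum integrable_mult_right)
      then show ?thesis by (simp add: herm_def sum_distrib_left sum_distrib_right mult_ac)
    qed
    have "herm (filtered F \<phi> n x) e
        = (\<Sum>k\<in>F. s k * (LINT y|M. herm (V n y) e * cis (- (freq L \<alpha> k * y))))"
      by (simp add: filtered_def herm_sum_left herm_simps c s_def)
    also have "\<dots> = (LINT y|M. (\<Sum>k\<in>F. s k * (herm (V n y) e * cis (- (freq L \<alpha> k * y)))))"
      using i2 by (subst Bochner_Integration.integral_sum) auto
    also have "\<dots> = (LINT y|M. herm (V n y) (\<rho> y))"
      by (simp add: \<rho>_def herm_simps \<tau>_def sum_distrib_left sum_distrib_right mult_ac)
    finally show ?thesis .
  qed
  then have "(\<Sum>n=1..N. (norm (herm (filtered F \<phi> n x) e))\<^sup>2)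
      = (\<Sum>n=1..N. (norm (LINT y|M. herm (V n y) (\<rho> y)))\<^sup>2)"
    by (intro sum.cong refl) simp
  also have "\<dots> \<le> (\<Sum>j\<in>UNIV. LINT y|M. (norm (\<rho> y $ j))\<^sup>2)"
    by (rule Bessel_V[OF \<rho>])
  also have "\<dots> = (\<Sum>j\<in>UNIV. (norm (e $ j))\<^sup>2) * (LINT y|M. (norm (\<tau> y))\<^sup>2)"
    by (simp add: \<rho>_def norm_mult power_mult_distrib sum_distrib_right mult.commute)
  also have "(\<Sum>j\<in>UNIV. (norm (e $ j))\<^sup>2) = 1"
    using assms(1) norm_vec_square[of e] by simp
  also have "(LINT y|M. (norm (\<tau> y))\<^sup>2) = (LINT y|M. (norm (\<Sum>k\<in>F. cnj (s k) * cis (freq L \<alpha> k * y)))\<^sup>2)"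
  proof -
    have "cnj (\<tau> y) = (\<Sum>k\<in>F. cnj (s k) * cis (freq L \<alpha> k * y))" for y
      by (simp add: \<tau>_def cis_cnj)
    then have "norm (\<tau> y) = norm (\<Sum>k\<in>F. cnj (s k) * cis (freq L \<alpha> k * y))" for y
      by (metis complex_mod_cnj)
    then show ?thesis by simp
  qed
  also have "\<dots> = L * (\<Sum>k\<in>F. (norm (cnj (s k)))\<^sup>2)"
    by (rule trig_poly_integral_norm[OF L assms(2)])
  also have "\<dots> = L * (\<Sum>k\<in>F. (\<phi> k)\<^sup>2 / L\<^sup>2)"
    by (simp add: s_def norm_mult norm_divide power_divide)
  also have "\<dots> = (\<Sum>k\<in>F. (\<phi> k)\<^sup>2) / L"
    using L by (simp add: sum_divide_distrib[symmetric] power2_eq_square)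
  finally show ?thesis by simp
qed

text \<open>
  The Minkowski inequality for the splitting of the Fourier multiplier \<open>1\<close> into the cutoff and its
  complement. The complement is controlled by \<open>multiplier_bound\<close>, and with \<open>b = t\<^sup>3\<close> the sum of
  squares is \<open>t\<close> times the expression in the definition of \<open>spectral_sup\<close>.
\<close>

lemma sqrt_layer_bound:
  assumes \<alpha>: "\<alpha> \<notin> \<int>" and e: "norm e = 1" and F: "finite F" and t: "t > 0"
  shows "sqrt (\<Sum>n=1..N. (norm (herm (filtered F (\<lambda>_. 1) n x) e))\<^sup>2)
    \<le> sqrt (\<Sum>n=1..N. (norm (herm (filtered F (\<lambda>k. cutoff \<bar>of_int k + \<alpha>\<bar> t) n x) e))\<^sup>2)
      + sqrt (spectral_sup \<alpha> / L * t)"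
proof -
  define f where "f k = cutoff \<bar>of_int k + \<alpha>\<bar> t" for k :: int
  have "(\<Sum>k\<in>F. (1 - f k)\<^sup>2) = t * (t ^ 5 * (\<Sum>k\<in>F. 1 / (\<bar>of_int k + \<alpha>\<bar> ^ 3 + t ^ 3)\<^sup>2))"
  proof -
    have "(1 - f k)\<^sup>2 = t * (t ^ 5 * (1 / (\<bar>of_int k + \<alpha>\<bar> ^ 3 + t ^ 3)\<^sup>2))" for k
    proof -
      have "\<bar>of_int k + \<alpha>\<bar> ^ 3 + t ^ 3 > 0" using t by (intro add_nonneg_pos) auto
      then have "1 - f k = t ^ 3 / (\<bar>of_int k + \<alpha>\<bar> ^ 3 + t ^ 3)"
        by (simp add: f_def cutoff_def field_simps)
      then show ?thesis by (simp add: power_divide eval_nat_numeral)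
    qed
    then show ?thesis by (simp add: sum_distrib_left)
  qed
  also have "\<dots> \<le> t * spectral_sup \<alpha>"
  proof -
    have "(t ^ 3) powr (5 / 3) = (t powr 3) powr (5 / 3)"
      using t by (simp only: powr_numeral)
    also have "\<dots> = t powr 5" by (simp add: powr_powr)
    also have "\<dots> = t ^ 5" using t by (simp only: powr_numeral)
    finally have "t ^ 5 = (t ^ 3) powr (5 / 3)" by simp
    then show ?thesis
      using spectral_sum_le_sup[OF \<alpha> _ F, of "t ^ 3"] t by (intro mult_left_mono) auto
  qed
  finally have tail: "(\<Sum>n=1..N. (norm (herm (filtered F (\<lambda>k. 1 - f k) n x) e))\<^sup>2)
      \<le> spectral_sup \<alpha> / L * t"
    using multiplier_bound[OF e F, of "\<lambda>k. 1 - f k" x] L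
    by (smt (verit) divide_right_mono mult.commute times_divide_eq_left)
  have split: "filtered F (\<lambda>_. 1) n x = filtered F f n x + filtered F (\<lambda>k. 1 - f k) n x" for n
    using filtered_diff[of F "\<lambda>_. 1" f n x] by simp
  have "L2_set (\<lambda>n. norm (herm (filtered F (\<lambda>_. 1) n x) e)) {1..N}
     \<le> L2_set (\<lambda>n. norm (herm (filtered F f n x) e)
         + norm (herm (filtered F (\<lambda>k. 1 - f k) n x) e)) {1..N}"
    by (intro L2_set_mono) (auto simp: split herm_simps norm_triangle_ineq)
  also have "\<dots> \<le> L2_set (\<lambda>n. norm (herm (filtered F f n x) e)) {1..N}
      + L2_set (\<lambda>n. norm (herm (filtered F (\<lambda>k. 1 - f k) n x) e)) {1..N}"
    by (rule L2_set_triangle_ineq)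
  also have "L2_set (\<lambda>n. norm (herm (filtered F (\<lambda>k. 1 - f k) n x) e)) {1..N}
      \<le> sqrt (spectral_sup \<alpha> / L * t)"
    unfolding L2_set_def using tail by simp
  finally show ?thesis by (simp add: L2_set_def f_def)
qed

text \<open>
  \<open>cube_le_layer_integral\<close> for each eigenvector; Parseval then removes the eigenvectors from the integrand.
\<close>

lemma truncated_cube_le:
  assumes \<alpha>: "\<alpha> \<notin> \<int>" and F: "finite F"
  defines "w \<equiv> \<lambda>k l. LINT t|half_line. 2 * t * (cutoff \<bar>of_int k + \<alpha>\<bar> t * cutoff \<bar>of_int l + \<alpha>\<bar> t)"
  defines "P \<equiv> filtered F (\<lambda>_. 1)"
  shows "trace_cube N P x
    \<le> 15 * (spectral_sup \<alpha> / L)\<^sup>2 * (\<Sum>n=1..N. \<Sum>j\<in>UNIV. \<Sum>k\<in>F. \<Sum>l\<in>F. w k l *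
        Re (cis (freq L \<alpha> k * x) * cis (- (freq L \<alpha> l * x))
            * (coef n k $ j * cnj (coef n l $ j) / L\<^sup>2)))"
proof -
  define c where "c = spectral_sup \<alpha> / L"
  have c: "c > 0" using L spectral_sup_pos[OF \<alpha>] by (simp add: c_def)
  have apos: "\<bar>of_int k + \<alpha>\<bar> > 0" for k :: int
    using int_add_nonzero[OF \<alpha>] by simp
  define Y where "Y t = filtered F (\<lambda>k. cutoff \<bar>of_int k + \<alpha>\<bar> t)" for t
  obtain B :: "(complex ^ 'm) set" and lam where B: "finite B" "\<And>e. e \<in> B \<Longrightarrow> norm e = 1"
    and pars: "\<And>y z. (\<Sum>e\<in>B. herm y e * cnj (herm z e)) = 2 * herm y z"
    and lam: "\<And>e. e \<in> B \<Longrightarrow> lam e = (\<Sum>n=1..N. (cmod (herm (P n x) e))\<^sup>2)"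
    and tr: "trace_cube N P x = (\<Sum>e\<in>B. lam e ^ 3) / 2"
    by (rule density_eigenbasis[where N = N and \<psi> = P and x = x]) (rule that)
  have hermY: "herm (Y t n x) e
      = (\<Sum>k\<in>F. of_real (cutoff \<bar>of_int k + \<alpha>\<bar> t) * (cis (freq L \<alpha> k * x) / L * herm (coef n k) e))"
          for t n e
    by (simp add: Y_def filtered_def herm_sum_left herm_simps mult.assoc)
  have int_e: "integrable half_line (\<lambda>t. 2 * t * (\<Sum>n=1..N. (norm (herm (Y t n x) e))\<^sup>2))" for e
    unfolding hermY sum_distrib_left
    by (intro Bochner_Integration.integrable_sum integrable.intros[OF cutoff_quadratic] apos)
  have norm_sum: "(\<Sum>e\<in>B. (norm (herm v e))\<^sup>2) = 2 * (norm v)\<^sup>2" for v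
  proof -
    have "complex_of_real (\<Sum>e\<in>B. (norm (herm v e))\<^sup>2) = of_real (2 * (norm v)\<^sup>2)"
      using pars[of v v] by (simp add: herm_self complex_norm_square del: of_real_power)
    then show ?thesis unfolding of_real_eq_iff .
  qed
  have "lam e ^ 3 \<le> 15 * c\<^sup>2 * (LINT t|half_line. 2 * t * (\<Sum>n=1..N. (norm (herm (Y t n x) e))\<^sup>2))"
      if e: "e \<in> B" for e
  proof (rule cube_le_layer_integral[OF _ c _ _ int_e])
    show "sqrt (lam e) \<le> sqrt (\<Sum>n=1..N. (norm (herm (Y t n x) e))\<^sup>2) + sqrt (c * t)" if "t > 0" for t
      unfolding lam[OF e] P_def Y_def c_def by (rule sqrt_layer_bound[OF \<alpha> B(2)[OF e] F that])
  qed (auto simp: lam[OF e] intro!: sum_nonneg)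
  then have "(\<Sum>e\<in>B. lam e ^ 3)
      \<le> (\<Sum>e\<in>B. 15 * c\<^sup>2 * (LINT t|half_line. 2 * t * (\<Sum>n=1..N. (norm (herm (Y t n x) e))\<^sup>2)))"
    by (rule sum_mono)
  also have "\<dots> = 15 * c\<^sup>2 * (LINT t|half_line. (\<Sum>e\<in>B. 2 * t * (\<Sum>n=1..N. (norm (herm (Y t n x) e))\<^sup>2)))"
    using int_e by (subst Bochner_Integration.integral_sum) (auto simp: sum_distrib_left)
  also have "(\<lambda>t. \<Sum>e\<in>B. 2 * t * (\<Sum>n=1..N. (norm (herm (Y t n x) e))\<^sup>2))
     = (\<lambda>t. 2 * (\<Sum>n=1..N. \<Sum>j\<in>UNIV. 2 * t * (norm (Y t n x $ j))\<^sup>2))"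
  proof
    fix t
    have "(\<Sum>e\<in>B. 2 * t * (\<Sum>n=1..N. (norm (herm (Y t n x) e))\<^sup>2))
        = 2 * t * (\<Sum>n=1..N. \<Sum>e\<in>B. (norm (herm (Y t n x) e))\<^sup>2)"
      by (simp only: sum_distrib_left[symmetric] sum.swap[of _ B])
    also have "\<dots> = 2 * (\<Sum>n=1..N. \<Sum>j\<in>UNIV. 2 * t * (norm (Y t n x $ j))\<^sup>2)"
      by (simp add: norm_sum norm_vec_square sum_distrib_left)
    finally show "(\<Sum>e\<in>B. 2 * t * (\<Sum>n=1..N. (norm (herm (Y t n x) e))\<^sup>2))
      = 2 * (\<Sum>n=1..N. \<Sum>j\<in>UNIV. 2 * t * (norm (Y t n x $ j))\<^sup>2)" .
  qed
  also have "(LINT t|half_line. 2 * (\<Sum>n=1..N. \<Sum>j\<in>UNIV. 2 * t * (norm (Y t n x $ j))\<^sup>2))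
    = 2 * (\<Sum>n=1..N. \<Sum>j\<in>UNIV. \<Sum>k\<in>F. \<Sum>l\<in>F. w k l *
        Re ((cis (freq L \<alpha> k * x) / L * coef n k $ j) * cnj (cis (freq L \<alpha> l * x) / L * coef n l $ j)))"
    unfolding Y_def filtered_component w_def
    by (intro has_bochner_integral_integral_eq has_bochner_integral_mult_right has_bochner_integral_sum
        cutoff_quadratic apos)
  also have "\<dots> = 2 * (\<Sum>n=1..N. \<Sum>j\<in>UNIV. \<Sum>k\<in>F. \<Sum>l\<in>F. w k l *
        Re (cis (freq L \<alpha> k * x) * cis (- (freq L \<alpha> l * x))
            * (coef n k $ j * cnj (coef n l $ j) / L\<^sup>2)))"
  proof -
    have "(cis (freq L \<alpha> k * x) / L * coef n k $ j) * cnj (cis (freq L \<alpha> l * x) / L * coef n l $ j)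
       = cis (freq L \<alpha> k * x) * cis (- (freq L \<alpha> l * x))
           * (coef n k $ j * cnj (coef n l $ j) / L\<^sup>2)" for n j k l
      by (simp add: cis_cnj power2_eq_square)
    then show ?thesis by (simp only:)
  qed
  finally show ?thesis
    unfolding tr c_def[symmetric] by simp
qed

lemma coef_energy:
  assumes F: "finite F"
  shows "(\<Sum>n=1..N. \<Sum>j\<in>UNIV. \<Sum>k\<in>F. \<bar>of_int k + \<alpha>\<bar>\<^sup>2 * (norm (coef n k $ j))\<^sup>2)
      \<le> L ^ 3 / (4 * pi\<^sup>2) * energy"
proof -
  have "(\<Sum>k\<in>F. \<bar>of_int k + \<alpha>\<bar>\<^sup>2 * (norm (coef n k $ j))\<^sup>2)
      \<le> L ^ 3 / (4 * pi\<^sup>2) * (LINT x|M. (norm (W n x $ j))\<^sup>2)"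
    if n: "n \<in> {1..N}" for n j
  proof -
    have "V n L $ j = cis (2 * pi * \<alpha>) * V n 0 $ j" using per[OF n] by simp
    then have fc: "fcoef L (\<lambda>x. W n x $ j) (freq L \<alpha> k) = \<i> * freq L \<alpha> k * coef n k $ j" for k
      unfolding coef_def using fcoef_deriv_freq[OF prim[OF n, of j] L, of \<alpha>] by simp
    have "(\<Sum>k\<in>F. \<bar>of_int k + \<alpha>\<bar>\<^sup>2 * (norm (coef n k $ j))\<^sup>2)
       = (\<Sum>k\<in>F. L\<^sup>2 / (4 * pi\<^sup>2) * (norm (fcoef L (\<lambda>x. W n x $ j) (freq L \<alpha> k)))\<^sup>2)"
    proof (intro sum.cong refl)
      fix k
      have "(freq L \<alpha> k)\<^sup>2 = 4 * pi\<^sup>2 / L\<^sup>2 * \<bar>of_int k + \<alpha>\<bar>\<^sup>2"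
        by (simp add: freq_def power_mult_distrib power_divide)
      then have "(norm (fcoef L (\<lambda>x. W n x $ j) (freq L \<alpha> k)))\<^sup>2
          = 4 * pi\<^sup>2 / L\<^sup>2 * \<bar>of_int k + \<alpha>\<bar>\<^sup>2 * (norm (coef n k $ j))\<^sup>2"
        unfolding fc by (simp add: norm_mult power_mult_distrib)
      then show "\<bar>of_int k + \<alpha>\<bar>\<^sup>2 * (norm (coef n k $ j))\<^sup>2
          = L\<^sup>2 / (4 * pi\<^sup>2) * (norm (fcoef L (\<lambda>x. W n x $ j) (freq L \<alpha> k)))\<^sup>2"
        using L by simp
    qed
    also have "\<dots> = L\<^sup>2 / (4 * pi\<^sup>2) * (\<Sum>k\<in>F. (norm (fcoef L (\<lambda>x. W n x $ j) (freq L \<alpha> k)))\<^sup>2)"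
      by (simp only: sum_distrib_left)
    also have "\<dots> \<le> L\<^sup>2 / (4 * pi\<^sup>2) * (L * (LINT x|M. (norm (W n x $ j))\<^sup>2))"
      by (intro mult_left_mono Bessel_fcoef L F sqW n) simp
    finally show ?thesis by (simp add: power2_eq_square power3_eq_cube mult_ac)
  qed
  then have "(\<Sum>n=1..N. \<Sum>j\<in>UNIV. \<Sum>k\<in>F. \<bar>of_int k + \<alpha>\<bar>\<^sup>2 * (norm (coef n k $ j))\<^sup>2)
     \<le> (\<Sum>n=1..N. \<Sum>j\<in>UNIV. L ^ 3 / (4 * pi\<^sup>2) * (LINT x|M. (norm (W n x $ j))\<^sup>2))"
    by (intro sum_mono) auto
  then show ?thesis by (simp only: energy_def sum_distrib_left)
qed

text \<open>
  Integration in \<open>x\<close> leaves the diagonal terms \<open>k = l\<close> of \<open>truncated_cube_le\<close>, for which the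
  weight is \<open>4 \<pi> / (9 \<surd>3)\<close> times \<open>\<bar>k + \<alpha>\<bar>\<^sup>2\<close>.
\<close>

lemma integral_truncated_cube_le:
  assumes \<alpha>: "\<alpha> \<notin> \<int>" and F: "finite F"
  defines "P \<equiv> filtered F (\<lambda>_. 1)"
  shows "(\<integral>\<^sup>+x. ennreal (trace_cube N P x) \<partial>M)
    \<le> ennreal (K2 \<alpha> * energy)"
proof -
  define w where "w k l = (LINT t|half_line. 2 * t
      * (cutoff \<bar>of_int k + \<alpha>\<bar> t * cutoff \<bar>of_int l + \<alpha>\<bar> t))" for k l :: int
  define c where "c = spectral_sup \<alpha> / L"
  define h where "h x = (\<Sum>n=1..N. \<Sum>j\<in>UNIV. \<Sum>k\<in>F. \<Sum>l\<in>F. w k l *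
        Re (cis (freq L \<alpha> k * x) * cis (- (freq L \<alpha> l * x))
            * (coef n k $ j * cnj (coef n l $ j) / L\<^sup>2)))" for x
  let ?cube = "\<lambda>x. trace_cube N P x"
  have le: "?cube x \<le> 15 * c\<^sup>2 * h x" for x
    unfolding h_def w_def c_def P_def by (rule truncated_cube_le[OF \<alpha> F])
  have icis: "integrable M (\<lambda>x. cis (freq L \<alpha> k * x) * cis (- (freq L \<alpha> l * x)))" for k l
    by (intro sq_integrable_mult sq_integrable_cis sq_integrable_cis_minus)
  have wkk: "w k k = 4 * pi / (9 * sqrt 3) * \<bar>of_int k + \<alpha>\<bar>\<^sup>2" for k
  proof -
    have "\<bar>of_int k + \<alpha>\<bar> > 0" using int_add_nonzero[OF \<alpha>] by simp
    from has_bochner_integral_integral_eq[OF cutoff_square_integral[OF this]] show ?thesis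
      by (simp add: w_def power2_eq_square)
  qed
  have "has_bochner_integral M h (\<Sum>n=1..N. \<Sum>j\<in>UNIV. \<Sum>k\<in>F. \<Sum>l\<in>F. w k l *
        Re ((if k = l then L else 0) * (coef n k $ j * cnj (coef n l $ j) / L\<^sup>2)))"
    unfolding h_def[abs_def]
  proof (intro has_bochner_integral_sum has_bochner_integral_mult_right has_bochner_integral_Re
      has_bochner_integral_mult_left)
    show "has_bochner_integral M (\<lambda>x. cis (freq L \<alpha> k * x)
        * cis (- (freq L \<alpha> l * x))) (complex_of_real (if k = l then L else 0))" for k l
      using icis[of k l] cis_freq_orthogonal[OF L, of \<alpha> k l] by (simp add: has_bochner_integral_iff)
  qed
  moreover have "(\<Sum>n=1..N. \<Sum>j\<in>UNIV. \<Sum>k\<in>F. \<Sum>l\<in>F. w k l *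
        Re ((if k = l then L else 0) * (coef n k $ j * cnj (coef n l $ j) / L\<^sup>2)))
     = 4 * pi / (9 * sqrt 3) / L * (\<Sum>n=1..N. \<Sum>j\<in>UNIV. \<Sum>k\<in>F. \<bar>of_int k + \<alpha>\<bar>\<^sup>2 * (norm (coef n k $ j))\<^sup>2)"
  proof -
    have "(\<Sum>l\<in>F. w k l * Re ((if k = l then L else 0) * (coef n k $ j * cnj (coef n l $ j) / L\<^sup>2)))
       = 4 * pi / (9 * sqrt 3) / L * (\<bar>of_int k + \<alpha>\<bar>\<^sup>2 * (norm (coef n k $ j))\<^sup>2)" if "k \<in> F" for n j k
    proof -
      have "(\<Sum>l\<in>F. w k l * Re ((if k = l then L else 0) * (coef n k $ j * cnj (coef n l $ j) / L\<^sup>2)))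
        = (\<Sum>l\<in>F. if k = l then w k k * Re (L * (coef n k $ j * cnj (coef n k $ j) / L\<^sup>2)) else 0)"
        by (intro sum.cong refl) auto
      also have "\<dots> = w k k * Re (L * (coef n k $ j * cnj (coef n k $ j) / L\<^sup>2))"
        using F that by simp
      also have "L * (coef n k $ j * cnj (coef n k $ j) / L\<^sup>2) = of_real ((norm (coef n k $ j))\<^sup>2 / L)"
        using L unfolding complex_norm_square[symmetric] by (simp add: power2_eq_square)
      finally show ?thesis by (simp add: wkk)
    qed
    then show ?thesis by (simp add: sum_distrib_left)
  qed
  ultimately have hb: "has_bochner_integral M h (4 * pi / (9 * sqrt 3) / L *
      (\<Sum>n=1..N. \<Sum>j\<in>UNIV. \<Sum>k\<in>F. \<bar>of_int k
          + \<alpha>\<bar>\<^sup>2 * (norm (coef n k $ j))\<^sup>2))" (is "has_bochner_integral M h ?I")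
    by simp
  have "(\<integral>\<^sup>+x. ennreal (?cube x) \<partial>M) \<le> (\<integral>\<^sup>+x. ennreal (15 * c\<^sup>2 * h x) \<partial>M)"
    by (intro nn_integral_mono ennreal_leI le)
  also have "\<dots> = ennreal (LINT x|M. 15 * c\<^sup>2 * h x)"
  proof (rule nn_integral_eq_integral)
    show "integrable M (\<lambda>x. 15 * c\<^sup>2 * h x)"
      using hb by (intro integrable_mult_right) (auto simp: has_bochner_integral_iff)
    show "AE x in M. 0 \<le> 15 * c\<^sup>2 * h x"
      by (intro AE_I2 order_trans[OF trace_density_cube_nonneg le])
  qed
  also have "(LINT x|M. 15 * c\<^sup>2 * h x) = 15 * c\<^sup>2 * ?I"
    using hb by (simp add: has_bochner_integral_iff)
  also have "\<dots> \<le> 15 * c\<^sup>2 * (4 * pi / (9 * sqrt 3) / L * (L ^ 3 / (4 * pi\<^sup>2) * energy))"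
    using L by (intro mult_left_mono coef_energy F) auto
  also have "\<dots> = K2 \<alpha> * energy"
    unfolding K2_eq c_def using L by (simp add: power2_eq_square power3_eq_cube field_simps)
  finally show ?thesis by (auto simp: ennreal_leI)
qed

theorem integral_cube_le_K2:
  assumes \<alpha>: "\<alpha> \<notin> \<int>"
  shows "(\<integral>\<^sup>+x. ennreal (cube x) \<partial>M) \<le> ennreal (K2 \<alpha> * energy)"
proof -
  define P where "P m = filtered {- int m..<int m} (\<lambda>_. 1)" for m
  define Q where "Q m x = trace_cube N (P m) x" for m x
  have lim: "(\<lambda>m. Q m x) \<longlonglongrightarrow> cube x" if x: "x \<in> {0..L}" for x
  proof -
    have P: "(\<lambda>m. P m n x $ j) \<longlonglongrightarrow> V n x $ j" if n: "n \<in> {1..N}" for n j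
    proof -
      have "V n L $ j = cis (2 * pi * \<alpha>) * V n 0 $ j" using per[OF n] by simp
      from fourier_pointwise[OF prim[OF n] L sqW[OF n] this x]
      show ?thesis
        unfolding P_def filtered_component by (simp add: coef_def mult.commute)
    qed
    show ?thesis
      unfolding Q_def cube_formula herm_def
      by (intro tendsto_intros P) auto
  qed
  have meas: "(\<lambda>x. ennreal (Q m x)) \<in> borel_measurable M" for m
  proof -
    have "continuous_on {0..L} (Q m)"
      unfolding Q_def[abs_def] cube_formula herm_def P_def filtered_component using L
      by (intro continuous_intros) auto
    then have "Q m \<in> borel_measurable M"
      by (rule continuous_imp_measurable_on_sets_lebesgue) simp
    then show ?thesis by simp
  qed
  have "(\<integral>\<^sup>+x. ennreal (cube x) \<partial>M) = (\<integral>\<^sup>+x. liminf (\<lambda>m. ennreal (Q m x)) \<partial>M)"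
  proof (rule nn_integral_cong)
    fix x assume "x \<in> space M"
    then have "(\<lambda>m. ennreal (Q m x)) \<longlonglongrightarrow> ennreal (cube x)"
      using lim by (intro tendsto_ennrealI) auto
    then show "ennreal (cube x) = liminf (\<lambda>m. ennreal (Q m x))"
      by (intro lim_imp_Liminf[symmetric]) auto
  qed
  also have "\<dots> \<le> liminf (\<lambda>m. \<integral>\<^sup>+x. ennreal (Q m x) \<partial>M)"
    by (rule nn_integral_liminf[OF meas])
  also have "\<dots> \<le> liminf (\<lambda>m::nat. ennreal (K2 \<alpha> * energy))"
    unfolding Q_def P_def
    by (intro Liminf_mono always_eventually allI integral_truncated_cube_le[OF \<alpha>]) simp
  finally show ?thesis by (simp add: Liminf_const)
qed

end


section \<open>The gauge transformation and the inequality\<close>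

lemma set_lebesgue_integral_lebesgue_on:
  fixes f :: "real \<Rightarrow> 'b::euclidean_space"
  shows "(LINT x:{0..L}|lebesgue. f x) = (LINT x|lebesgue_on {0..L}. f x)"
  by (simp add: set_lebesgue_integral_def integral_restrict_space)

lemma L2_per_sq_integrable:
  fixes f :: "real \<Rightarrow> 'b::euclidean_space"
  assumes "f \<in> L2_per L"
  shows "sq_integrable (lebesgue_on {0..L}) f"
proof -
  have "f \<in> borel_measurable (lebesgue_on {0..L})"
    using assms by (simp add: L2_per_def set_borel_measurable_def borel_measurable_restrict_space_iff)
  then show ?thesis
    using assms by (simp add: L2_per_def sq_integrable_def integrable_lebesgue_on_iff)
qed

lemma sq_integrable_component:
  fixes f :: "'a \<Rightarrow> complex ^ 'm"
  assumes "sq_integrable M f"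
  shows "sq_integrable M (\<lambda>x. f x $ j)"
  unfolding sq_integrable_def
proof
  have m: "f \<in> borel_measurable M" using assms by (rule sq_integrable_measurable)
  have "continuous_on UNIV (\<lambda>v :: complex ^ 'm. v $ j)" by (intro continuous_intros)
  from borel_measurable_continuous_on[OF this m]
  show mj: "(\<lambda>x. f x $ j) \<in> borel_measurable M" .
  show "integrable M (\<lambda>x. (norm (f x $ j))\<^sup>2)"
    by (rule Bochner_Integration.integrable_bound[OF sq_integrable_integrable[OF assms]])
       (use mj in \<open>auto intro!: power_mono Finite_Cartesian_Product.norm_nth_le\<close>)
qed

lemma weak_deriv_component:
  fixes f g :: "real \<Rightarrow> complex ^ 'm"
  assumes f: "sq_integrable (lebesgue_on {0..L}) f" and g: "sq_integrable (lebesgue_on {0..L}) g"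
    and weak: "is_weak_deriv L f g" and \<phi>: "\<phi> \<in> smooth_per L"
  shows "(LINT x|lebesgue_on {0..L}. deriv \<phi> x *\<^sub>R f x $ j)
      = - (LINT x|lebesgue_on {0..L}. \<phi> x *\<^sub>R g x $ j)"
proof -
  let ?M = "lebesgue_on {0..L}"
  have "(deriv ^^ k) \<phi> differentiable_on UNIV" for k using \<phi> by (simp add: smooth_per_def)
  from this[of 0] this[of 1] have cont: "continuous_on {0..L} \<phi>" "continuous_on {0..L} (deriv \<phi>)"
    by (auto intro: continuous_on_subset[OF differentiable_imp_continuous_on])
  have comp: "(LINT x|?M. u x *\<^sub>R v x) $ j = (LINT x|?M. u x *\<^sub>R v x $ j)"
    if u: "continuous_on {0..L} u" and v: "sq_integrable ?M v" for u :: "real \<Rightarrow> real"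
        and v :: "real \<Rightarrow> complex ^ 'm"
  proof -
    have su: "sq_integrable ?M u" by (rule sq_integrable_continuous[OF u])
    have "integrable ?M (\<lambda>x. u x *\<^sub>R v x)"
      by (rule Bochner_Integration.integrable_bound[OF sq_integrable_norm_mult[OF su v]])
         (use su v in \<open>auto simp: sq_integrable_def\<close>)
    from integral_bounded_linear[OF bounded_linear_vec_nth this, of j] show ?thesis by simp
  qed
  have "(LINT x|?M. deriv \<phi> x *\<^sub>R f x) = - (LINT x|?M. \<phi> x *\<^sub>R g x)"
    using weak \<phi> by (simp add: is_weak_deriv_def set_lebesgue_integral_lebesgue_on)
  then have "(LINT x|?M. deriv \<phi> x *\<^sub>R f x) $ j = (- (LINT x|?M. \<phi> x *\<^sub>R g x)) $ j" by simp
  then show ?thesis by (simp add: comp[OF cont(2) f] comp[OF cont(1) g])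
qed

lemma weak_deriv_H1_per:
  assumes "f \<in> H1_per L"
  shows "weak_deriv L f \<in> L2_per L" "is_weak_deriv L f (weak_deriv L f)"
  using assms someI_ex[of "\<lambda>g. g \<in> L2_per L \<and> is_weak_deriv L f g"]
  by (auto simp: H1_per_def weak_deriv_def)

lemma H1_per_primitive:
  fixes f :: "real \<Rightarrow> complex ^ 'm"
  assumes L: "L > 0" and f: "f \<in> H1_per L"
  obtains h :: "real \<Rightarrow> complex ^ 'm" where
    "\<And>j. primitive_on 0 L (\<lambda>x. h x $ j) (\<lambda>x. weak_deriv L f x $ j)" "h L = h 0"
    "AE x in lebesgue_on {0..L}. f x = h x"
proof -
  let ?M = "lebesgue_on {0..L}" and ?g = "weak_deriv L f"
  have sf: "sq_integrable ?M f" and sg: "sq_integrable ?M ?g"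
    using f weak_deriv_H1_per[OF f] by (auto simp: H1_per_def intro: L2_per_sq_integrable)
  have "\<exists>h. primitive_on 0 L h (\<lambda>x. ?g x $ j) \<and> h L = h 0 \<and> (AE x in ?M. f x $ j = h x)" for j
    by (rule weak_primitive_scalar[OF L sq_integrable_component[OF sf, of j]
        sq_integrable_component[OF sg, of j]
          weak_deriv_component[OF sf sg weak_deriv_H1_per(2)[OF f]]]) blast+
  then obtain h where h: "\<And>j. primitive_on 0 L (h j) (\<lambda>x. ?g x $ j)" "\<And>j. h j L = h j 0"
    "\<And>j. AE x in ?M. f x $ j = h j x" by metis
  show ?thesis
  proof (rule that[of "\<lambda>x. \<chi> j. h j x"])
    have "AE x in ?M. \<forall>j\<in>UNIV. f x $ j = h j x"
      using h(3) by (subst AE_finite_all) auto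
    then show "AE x in ?M. f x = (\<chi> j. h j x)"
      by eventually_elim (simp add: vec_eq_iff)
  qed (use h in \<open>auto simp: vec_eq_iff\<close>)
qed

lemma primitive_on_gauge:
  assumes L: "L > 0" and a: "a absolutely_integrable_on {0..L}"
  shows "primitive_on 0 L (\<lambda>x. cis (integral {0..x} a)) (\<lambda>x. \<i> * of_real (a x)
      * cis (integral {0..x} a))"
proof -
  have ca: "(\<lambda>x. complex_of_real (a x)) absolutely_integrable_on {0..L}"
    using absolutely_integrable_linear[OF a bounded_linear_of_real] by (simp add: o_def)
  have ai: "a integrable_on {0..x}" if "x \<in> {0..L}" for x
    using a that by (auto simp: absolutely_integrable_on_def intro: integrable_on_subinterval)
  have "integral {0..x} (\<lambda>x. complex_of_real (a x)) = of_real (integral {0..x} a)" if "x \<in> {0..L}" for x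
    using integral_linear[OF ai[OF that] bounded_linear_of_real] by (simp add: o_def)
  then have "primitive_on 0 L (\<lambda>x. complex_of_real (integral {0..x} a)) (\<lambda>x. complex_of_real (a x))"
    by (intro primitive_on_cong[OF primitive_on_indefinite_integral[OF less_imp_le[OF L] ca]]) auto
  from primitive_on_exp[OF primitive_on_cmult[OF this, of \<i>]] show ?thesis
    by (rule primitive_on_cong) (auto simp: cis_conv_exp)
qed

lemma density_matrix_phase:
  fixes \<psi> :: "nat \<Rightarrow> real \<Rightarrow> complex ^ 'm"
  assumes "norm u = 1"
  shows "density_matrix N (\<lambda>n x. u *s \<psi> n x) x = density_matrix N \<psi> x"
proof -
  have "u * cnj u = 1" using assms complex_norm_square[of u] by simp
  moreover have "u * v * (cnj u * w) = u * cnj u * (v * w)" for v w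
    by (simp only: mult_ac)
  ultimately have "u * v * (cnj u * w) = v * w" for v w by simp
  then have "(u *s v) $ i * cnj ((u *s w) $ j) = v $ i * cnj (w $ j)" for v w :: "complex ^ 'm" and i j
    by (simp only: vector_smult_component complex_cnj_mult)
  then show ?thesis by (simp only: density_matrix_def)
qed

text \<open>
  With \<open>E = exp (\<i> A)\<close> and \<open>h n\<close> the absolutely continuous representative of \<open>\<psi> n\<close>, the
  functions \<open>V n = E h n\<close> have the derivative \<open>W n = E (h n' + \<i> a h n)\<close>, and \<open>E L\<close> is the
  phase given by the flux. Finite energy makes \<open>W n\<close> square integrable.
\<close>

lemma magnetic_gauge:
  fixes L \<alpha> :: real and a :: "real \<Rightarrow> real" and N :: nat
    and \<psi> :: "nat \<Rightarrow> real \<Rightarrow> complex ^ 'm"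
  assumes L: "L > 0" and a: "a absolutely_integrable_on {0..L}" and \<alpha>: "\<alpha> = magnetic_flux L a"
    and H1: "\<And>n. n \<in> {1..N} \<Longrightarrow> \<psi> n \<in> H1_per L" and on: "orthonormal_L2 L N \<psi>"
    and fin: "\<And>n. n \<in> {1..N} \<Longrightarrow>
      (\<integral>\<^sup>+x. ennreal ((norm (\<i> *s weak_deriv L (\<psi> n) x - a x *\<^sub>R \<psi> n x))\<^sup>2) \<partial>lebesgue_on {0..L}) < \<infinity>"
  obtains V W :: "nat \<Rightarrow> real \<Rightarrow> complex ^ 'm" where "quasi_periodic_system L \<alpha> N V W"
    "AE x in lebesgue_on {0..L}. density_matrix N V x = density_matrix N \<psi> x"
    "\<And>n. n \<in> {1..N} \<Longrightarrow> AE x in lebesgue_on {0..L}.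
        norm (W n x) = norm (\<i> *s weak_deriv L (\<psi> n) x - a x *\<^sub>R \<psi> n x)"
proof -
  let ?M = "lebesgue_on {0..L}"
  let ?P = "\<lambda>n (h :: real \<Rightarrow> complex ^ 'm).
    (\<forall>j. primitive_on 0 L (\<lambda>x. h x $ j) (\<lambda>x. weak_deriv L (\<psi> n) x $ j)) \<and> h L
        = h 0 \<and> (AE x in ?M. \<psi> n x = h x)"
  have "\<forall>n\<in>{1..N}. \<exists>h. ?P n h"
  proof
    fix n assume "n \<in> {1..N}"
    from H1_per_primitive[OF L H1[OF this]]
    show "\<exists>h. ?P n h"
      by blast
  qed
  from bchoice[OF this] obtain h :: "nat \<Rightarrow> real \<Rightarrow> complex ^ 'm" where
    h: "\<And>n j. n \<in> {1..N} \<Longrightarrow> primitive_on 0 L (\<lambda>x. h n x $ j) (\<lambda>x. weak_deriv L (\<psi> n) x $ j)"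
    "\<And>n. n \<in> {1..N} \<Longrightarrow> h n L = h n 0" "\<And>n. n \<in> {1..N} \<Longrightarrow> AE x in ?M. \<psi> n x = h n x"
    by blast
  define E where "E x = cis (integral {0..x} a)" for x
  have E1: "norm (E x) = 1" for x by (simp add: E_def)
  have E0: "E 0 = 1" by (simp add: E_def)
  have EL: "E L = cis (2 * pi * \<alpha>)"
    using set_lebesgue_integral_eq_integral(2)[OF a] by (simp add: E_def \<alpha> magnetic_flux_def)
  have E: "primitive_on 0 L E (\<lambda>x. \<i> * of_real (a x) * E x)"
    unfolding E_def[abs_def] by (rule primitive_on_gauge[OF L a])
  define V where "V n x = E x *s h n x" for n x
  define W where "W n x = E x *s (weak_deriv L (\<psi> n) x + (\<i> * of_real (a x)) *s h n x)" for n x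
  have prim: "primitive_on 0 L (\<lambda>x. V n x $ j) (\<lambda>x. W n x $ j)" if "n \<in> {1..N}" for n j
    using primitive_on_mult[OF E h(1)[OF that, of j]]
    by (rule primitive_on_cong) (simp_all add: V_def W_def algebra_simps)
  have normW: "AE x in ?M. norm (W n x) = norm (\<i> *s weak_deriv L (\<psi> n) x - a x *\<^sub>R \<psi> n x)"
      if "n \<in> {1..N}" for n
    using h(3)[OF that]
  proof eventually_elim
    fix x assume *: "\<psi> n x = h n x"
    have sc: "norm (c *s v) = norm v" if "norm c = 1" for c and v :: "complex ^ 'm"
      using that by (simp add: norm_vec_def norm_mult)
    have "\<i> *s weak_deriv L (\<psi> n) x - a x *\<^sub>R \<psi> n x
        = \<i> *s (weak_deriv L (\<psi> n) x + (\<i> * of_real (a x)) *s h n x)"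
      by (simp add: vec_eq_iff * scaleR_conv_of_real[where 'a
          = complex] distrib_left mult.assoc[symmetric])
    then show "norm (W n x) = norm (\<i> *s weak_deriv L (\<psi> n) x - a x *\<^sub>R \<psi> n x)"
      unfolding W_def by (simp only: sc[OF E1] sc[OF norm_ii])
  qed
  have sqW: "sq_integrable ?M (\<lambda>x. W n x $ j)" if n: "n \<in> {1..N}" for n j
    unfolding sq_integrable_def
  proof
    show m: "(\<lambda>x. W n x $ j) \<in> borel_measurable ?M"
      using primitive_on_total(2)[OF prim[OF n, of j]] unfolding integrable_lebesgue_on_iff[symmetric]
      by (rule borel_measurable_integrable)
    show "integrable ?M (\<lambda>x. (norm (W n x $ j))\<^sup>2)"
    proof (rule integrableI_bounded)
      show "(\<lambda>x. (norm (W n x $ j))\<^sup>2) \<in> borel_measurable ?M" using m by measurable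
      have "(\<integral>\<^sup>+x. ennreal (norm ((norm (W n x $ j))\<^sup>2)) \<partial>?M)
          \<le> (\<integral>\<^sup>+x. ennreal ((norm (\<i> *s weak_deriv L (\<psi> n) x - a x *\<^sub>R \<psi> n x))\<^sup>2) \<partial>?M)"
      proof (rule nn_integral_mono_AE)
        show "AE x in ?M. ennreal (norm ((norm (W n x $ j))\<^sup>2))
            \<le> ennreal ((norm (\<i> *s weak_deriv L (\<psi> n) x - a x *\<^sub>R \<psi> n x))\<^sup>2)"
          using normW[OF n]
        proof eventually_elim
          fix x assume e: "norm (W n x) = norm (\<i> *s weak_deriv L (\<psi> n) x - a x *\<^sub>R \<psi> n x)"
          show "ennreal (norm ((norm (W n x $ j))\<^sup>2))
              \<le> ennreal ((norm (\<i> *s weak_deriv L (\<psi> n) x - a x *\<^sub>R \<psi> n x))\<^sup>2)"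
            unfolding e[symmetric] using Finite_Cartesian_Product.norm_nth_le[of "W n x" j]
            by (intro ennreal_leI) (simp add: power_mono)
        qed
      qed
      then show "(\<integral>\<^sup>+x. ennreal (norm ((norm (W n x $ j))\<^sup>2)) \<partial>?M) < \<infinity>"
        using fin[OF n] by (rule order_le_less_trans)
    qed
  qed
  have ae: "AE x in ?M. \<forall>n\<in>{1..N}. \<psi> n x = h n x"
    using h(3) by (subst AE_finite_all) auto
  have "quasi_periodic_system L \<alpha> N V W"
  proof
    show "V n L = cis (2 * pi * \<alpha>) *s V n 0" if "n \<in> {1..N}" for n
      using h(2)[OF that] by (simp add: V_def E0 EL)
    fix n m assume nm: "n \<in> {1..N}" "m \<in> {1..N}"
    have sV: "sq_integrable ?M (\<lambda>x. V k x $ j)" if "k \<in> {1..N}" for k j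
      by (intro sq_integrable_continuous primitive_on_continuous[OF prim[OF that]])
    have mV: "(\<lambda>x. herm (V n x) (V m x)) \<in> borel_measurable ?M"
      unfolding herm_def using nm
      by (intro borel_measurable_integrable Bochner_Integration.integrable_sum sq_integrable_mult
          sq_integrable_cnj sV)
    have s\<psi>: "sq_integrable ?M (\<lambda>x. \<psi> k x $ j)" if "k \<in> {1..N}" for k j
      using H1[OF that] by (intro sq_integrable_component L2_per_sq_integrable) (simp add: H1_per_def)
    have m\<psi>: "(\<lambda>x. \<Sum>j\<in>UNIV. \<psi> n x $ j * cnj (\<psi> m x $ j)) \<in> borel_measurable ?M"
      using nm
      by (intro borel_measurable_integrable Bochner_Integration.integrable_sum sq_integrable_mult
          sq_integrable_cnj s\<psi>)
    have "(LINT x|?M. herm (V n x) (V m x)) = (LINT x|?M. (\<Sum>j\<in>UNIV. \<psi> n x $ j * cnj (\<psi> m x $ j)))"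
    proof (rule integral_cong_AE[OF mV m\<psi>])
      show "AE x in ?M. herm (V n x) (V m x) = (\<Sum>j\<in>UNIV. \<psi> n x $ j * cnj (\<psi> m x $ j))"
        using ae
      proof eventually_elim
        fix x assume "\<forall>n\<in>{1..N}. \<psi> n x = h n x"
        moreover have "cnj (E x) * E x = 1" using complex_norm_square[of "E x"] E1
            by (simp add: mult.commute)
        ultimately show "herm (V n x) (V m x) = (\<Sum>j\<in>UNIV. \<psi> n x $ j * cnj (\<psi> m x $ j))"
          using nm by (simp add: V_def herm_simps mult.assoc[symmetric]) (simp add: herm_def)
      qed
    qed
    then show "(LINT x|?M. herm (V n x) (V m x)) = (if n = m then 1 else 0)"
      using on nm by (simp add: orthonormal_L2_def set_lebesgue_integral_lebesgue_on)
  qed (use L prim sqW in auto)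
  moreover have "AE x in ?M. density_matrix N V x = density_matrix N \<psi> x"
    using ae
  proof eventually_elim
    fix x assume "\<forall>n\<in>{1..N}. \<psi> n x = h n x"
    then have "density_matrix N h x = density_matrix N \<psi> x" by (simp add: density_matrix_def)
    moreover have "density_matrix N V x = density_matrix N h x"
      using density_matrix_phase[OF E1[of x], of N h x] by (simp add: density_matrix_def V_def)
    ultimately show "density_matrix N V x = density_matrix N \<psi> x" by simp
  qed
  ultimately show ?thesis using that normW by blast
qed

lemma (in quasi_periodic_system) energy_nn_integral:
  "ennreal energy = (\<Sum>n=1..N. \<integral>\<^sup>+x. ennreal ((norm (W n x))\<^sup>2) \<partial>M)"
proof -
  have "(\<integral>\<^sup>+x. ennreal ((norm (W n x))\<^sup>2) \<partial>M) = ennreal (\<Sum>j\<in>UNIV. LINT x|M. (norm (W n x $ j))\<^sup>2)"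
      if n: "n \<in> {1..N}" for n
  proof -
    have "(\<integral>\<^sup>+x. ennreal (\<Sum>j\<in>UNIV. (norm (W n x $ j))\<^sup>2) \<partial>M)
        = ennreal (LINT x|M. (\<Sum>j\<in>UNIV. (norm (W n x $ j))\<^sup>2))"
      using sq_integrable_integrable[OF sqW[OF n]]
      by (intro nn_integral_eq_integral Bochner_Integration.integrable_sum AE_I2 sum_nonneg) auto
    then show ?thesis
      using sq_integrable_integrable[OF sqW[OF n]] by (simp add: norm_vec_square)
  qed
  then have "(\<Sum>n=1..N. \<integral>\<^sup>+x. ennreal ((norm (W n x))\<^sup>2) \<partial>M)
      = (\<Sum>n=1..N. ennreal (\<Sum>j\<in>UNIV. LINT x|M. (norm (W n x $ j))\<^sup>2))"
    by (intro sum.cong) auto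
  also have "\<dots> = ennreal energy"
    unfolding energy_def by (rule sum_ennreal) (auto intro!: sum_nonneg integral_nonneg_AE)
  finally show ?thesis by simp
qed

lemma K_const_pos:
  assumes "\<alpha> \<notin> \<int>"
  shows "K_const \<alpha> > 0"
  using k_const_bound(1)[OF assms, of 1] spectral_sup_pos[OF assms]
  by (simp add: K_const_def K1_def K2_eq)

theorem theorem3p1:
  fixes L \<alpha> :: real and a :: "real \<Rightarrow> real" and N :: nat
    and \<psi> :: "nat \<Rightarrow> real \<Rightarrow> complex ^ 'm"
  assumes "L > 0"
    and "periodic_fun_simple a L"
    and "set_integrable lebesgue {0..L} a"
    and "\<alpha> = magnetic_flux L a"
    and "\<alpha> \<notin> \<int>"
    and "N \<ge> 1"
    and "\<And>n. n \<in> {1..N} \<Longrightarrow> \<psi> n \<in> H1_per L"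
    and "orthonormal_L2 L N \<psi>"
  defines "U \<equiv> density_matrix N \<psi>"
  shows "(\<integral>\<^sup>+x\<in>{0..L}. ennreal (Re (trace (U x ** U x ** U x))) \<partial>lebesgue)
           \<le> ennreal (K_const \<alpha>) *
              (\<Sum>n=1..N. \<integral>\<^sup>+x\<in>{0..L}.
                 ennreal ((norm (\<i> *s weak_deriv L (\<psi> n) x - a x *\<^sub>R \<psi> n x))\<^sup>2) \<partial>lebesgue)"
proof -
  let ?M = "lebesgue_on {0..L}"
  let ?e = "\<lambda>n x. ennreal ((norm (\<i> *s weak_deriv L (\<psi> n) x - a x *\<^sub>R \<psi> n x))\<^sup>2)"
  have restrict: "(\<integral>\<^sup>+x\<in>{0..L}. f x \<partial>lebesgue) = (\<integral>\<^sup>+x. f x \<partial>?M)" for f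
    by (rule nn_integral_restrict_space[symmetric]) simp
  have Kpos: "K_const \<alpha> > 0" by (rule K_const_pos[OF assms(5)])
  show ?thesis
  proof (cases "\<forall>n\<in>{1..N}. (\<integral>\<^sup>+x. ?e n x \<partial>?M) < \<infinity>")
    case False
    then obtain n where n: "n \<in> {1..N}" "(\<integral>\<^sup>+x. ?e n x \<partial>?M) = \<infinity>"
      by (auto simp: less_top[symmetric])
    then have s: "(\<Sum>n=1..N. \<integral>\<^sup>+x. ?e n x \<partial>?M) = \<infinity>"
      using sum.remove[of "{1..N}" n "\<lambda>n. \<integral>\<^sup>+x. ?e n x \<partial>?M"] by simp
    show ?thesis
      unfolding restrict s using Kpos by (simp add: ennreal_mult_top)
  next
    case True
    then obtain V W :: "nat \<Rightarrow> real \<Rightarrow> complex ^ 'm" where sys: "quasi_periodic_system L \<alpha> N V W"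
      and dens: "AE x in ?M. density_matrix N V x = density_matrix N \<psi> x"
      and nW: "\<And>n. n \<in> {1..N} \<Longrightarrow> AE x in ?M. norm (W n x)
          = norm (\<i> *s weak_deriv L (\<psi> n) x - a x *\<^sub>R \<psi> n x)"
      using magnetic_gauge[OF assms(1,3,4,7,8)] by blast
    interpret quasi_periodic_system L \<alpha> N V W by (rule sys)
    have "(\<integral>\<^sup>+x. ennreal (Re (trace (U x ** U x ** U x))) \<partial>?M) = (\<integral>\<^sup>+x. ennreal (cube x) \<partial>?M)"
      using dens by (intro nn_integral_cong_AE) (auto simp: U_def elim!: eventually_mono)
    also have "\<dots> \<le> ennreal (K_const \<alpha> * energy)"
      using integral_cube_le_K1[OF assms(5)] integral_cube_le_K2[OF assms(5)]
      by (simp add: K_const_def min_def)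
    also have "\<dots> = ennreal (K_const \<alpha>) * ennreal energy"
      using Kpos by (simp add: ennreal_mult')
    also have "ennreal energy = (\<Sum>n=1..N. \<integral>\<^sup>+x. ?e n x \<partial>?M)"
      unfolding energy_nn_integral
      by (intro sum.cong refl nn_integral_cong_AE) (use nW in \<open>fastforce elim!: eventually_mono\<close>)
    finally show ?thesis unfolding restrict .
  qed
qed

end
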